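(* Let $P$ be the $\mathbf{g}$-polytope for $\mathrm{Path}(\mathbf{k})$ or $\mathrm{Cycle}(\mathbf{k})$ (with the lab framing), excluding $\mathrm{Cycle}(1,1)$. A pulling sequence for $P$ yields the DKK triangulation of $P$ if and only if it consists entirely of DKK pull steps.
   Context: DAGs. The DAGs considered are finite acyclic directed multigraphs with a source $s$ and a sink $t$; inner vertices are the other vertices; a DAG is full if every inner vertex has indegree and outdegree $2$. The inner graph is the subgraph induced by the inner vertices; an inner route is a maximal directed path in it. A route is a directed path from $s$ to $t$. $\mathrm{Path}(\mathbf{k})$, $\mathbf{k}=(k_1,\dots,k_r)$ a sequence of positive integers: the full DAG with inner vertices $1,\dots,n$, $n=k_1+\cdots+k_r+1$, with one inner edge between $i$ and $i+1$ for each $i<n$; the first $k_1$ inner edges are directed $i\to i+1$, the next $k_2$ are directed $i+1\to i$, and so on alternating. Edges from $s$ and to $t$ (possibly parallel pairs) are added as needed to make it full. $\mathrm{Cycle}(\mathbf{k})$, $r$ even: same, with $n=k_1+\cdots+k_r$ inner vertices and inner edges between $i$ and $i+1$ modulo $n$ (so the $r$-th inner route starts at vertex $1$ and runs $1\to n\to n-1\to\cdots$). Lab framing: edges are labeled by $\{1,2\}$; inner edges of odd-numbered inner routes get label $2$, those of even-numbered inner routes get label $1$, and source and sink edges are labeled so that at each inner vertex the two incoming edges have distinct labels and the two outgoing edges have distinct labels. An inner route with constant label is a leg (here every inner route is a leg). A route is exceptional if all its edges have the same label (equivalently, it is coherent, in the sense below, with every route); an exceptional route is long if it contains a leg and short otherwise.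 Each edge lies on a unique exceptional route. Every route other than a short exceptional one lies on a unique leg (its intersection with the inner graph is contained in that leg). Coherence: let $[u,v]$ be a maximal common subpath of routes $R,S$ with $u,v$ inner vertices (possibly $u=v$), so they enter $u$ by distinct edges and leave $v$ by distinct edges. They are in conflict at $[u,v]$ if the one entering $u$ by the smaller label leaves $v$ by the larger label. $R,S$ are coherent if they are in conflict at no such $[u,v]$. A clique is a set of pairwise coherent routes. $\mathbf{g}$-polytope: $\mathbf{g}(R)=(a_v)_v\in\mathbb{Z}^n$ with $a_v=-1$ if $R$ enters $v$ with label $1$ and leaves with label $2$, $a_v=1$ if it enters with label $2$ and leaves with label $1$, and $a_v=0$ otherwise. $P$ is the convex hull of all $\mathbf{g}(R)$. Routes are identified with their $\mathbf{g}$-vectors; exceptional routes correspond to the origin $\vec 0$ and count as elements of any sequence containing $\vec 0$. The DKK triangulation of $P$ is the (unimodular) triangulation whose maximal simplices are $\mathrm{conv}\{\mathbf{g}(R):R\in M\}$, $M$ a maximal clique. Pulling: a subdivision of a $d$-dimensional polytope $P$ is a finite collection of $d$-dimensional polytopes (cells) with union $P$, any two distinct ones meeting in a common (possibly empty) proper face; it is refined by another subdivision if each cell of the latter is contained in a cell of the former. For a subdivision $\mathcal{S}$ and $x\in P$, $\mathrm{pull}(\mathcal{S};x)$ is obtained by keeping each cell not containing $x$ and replacing each cell $S\ni x$ by the polytopes $\mathrm{conv}(F,x)$ for all facets $F$ of $S$ not containing $x$. $\mathrm{pull}(P;(x^1,\dots,x^m))$ is the result of successively pulling $\{P\}$ at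 $x^1,\dots,x^m$. A sequence $V=(\vec0,R_1,\dots,R_i)$ of routes starting with the origin is pull-coherent if $\mathrm{pull}(P;V)$ is refined by the DKK triangulation. A pulling sequence for $P$ is a sequence $(\vec 0,R_1,\dots,R_p)$ of routes starting with the origin, at which $P$ is successively pulled; it yields the DKK triangulation if $\mathrm{pull}(P;(\vec0,R_1,\dots,R_p))$ is the DKK triangulation of $P$. Edge names: a source or sink edge at inner vertex $i$ is named $i$ if it lies on a short exceptional route; if it lies on a long exceptional route it is named $i^-$ if it is a source edge labeled $2$ or a sink edge labeled $1$, and $i^+$ if it is a sink edge labeled $2$ or a source edge labeled $1$. Names are ordered $1^-<1<1^+<2^-<2<2^+<\cdots<n^-<n<n^+$. Coherence diagram: an array of boxes in bijection with the routes. Rows are indexed top to bottom by source-edge names, columns left to right by sink-edge names, both increasing, and a route with source edge $a$ and sink edge $b$ is the box in row $a$, column $b$. For $\mathrm{Cycle}(\mathbf{k})$, two additional rows indexed $1^-,1^+$ are placed at the bottom; routes with source edge $1^\pm$ lying on the $r$-th leg are placed in these bottom rows and the other routes with these source edges in the top rows. Each bottom row $1^\pm$, read left to right, is continued to the east by the top row $1^\pm$ (the right boundary of the former being identified with the left boundary of the latter). $\mathrm{N}(R),\mathrm{S}(R),\mathrm{E}(R),\mathrm{W}(R)$ are the sets of boxes strictly above $R$ in its column, strictly below $R$ in its column, strictly to the right of $R$ in its row, strictly to the left of $R$ in its row (rows $1^\pm$ continuing across the identification in the cycle case). DKK pull step: let $V=(\vec0,R_1,\dots,R_i)$ be pull-coherent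 and $R\notin V$ a route. Appending $R$ to $V$ is a DKK pull step if both (a) $\mathrm{W}(R)\subseteq V$ or $\mathrm{N}(R)\subseteq V$, and (b) $\mathrm{E}(R)\subseteq V$ or $\mathrm{S}(R)\subseteq V$. A pulling sequence consists entirely of DKK pull steps if each of its routes after the initial origin is appended to the preceding ones by a DKK pull step.
   Formalization: Pulling sequences are required to have distinct, non-exceptional routes after the origin and to be complete: every route is pulled, or the result is a triangulation. Otherwise the claim fails, e.g. for (0) alone on Path(2), or when a route is repeated. *)

theory Defs
  imports
    "HOL-Analysis.Analysis"
    "HOL-Library.Sublist"
    "Graph_Theory.Digraph_Component"
begin

section \<open>Framed DAGs, routes and coherence\<close>

text \<open>Paths are lists of edges.\<close>

record ('v, 'e) framed_dag =
  graph :: "('v, 'e) pre_digraph"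
  src :: 'v
  snk :: 'v
  lab :: "'e \<Rightarrow> nat"

definition route :: "('v, 'e) framed_dag \<Rightarrow> 'e list \<Rightarrow> bool" where
  "route D R \<longleftrightarrow> pre_digraph.apath (graph D) (src D) R (snk D)"

definition inner_vertices :: "('v, 'e) framed_dag \<Rightarrow> 'v set" where
  "inner_vertices D = verts (graph D) - {src D, snk D}"

definition inner_graph :: "('v, 'e) framed_dag \<Rightarrow> ('v, 'e) pre_digraph" where
  "inner_graph D = graph D \<restriction> inner_vertices D"

definition inner_path :: "('v, 'e) framed_dag \<Rightarrow> 'e list \<Rightarrow> bool" where
  "inner_path D p \<longleftrightarrow> (\<exists>u v. pre_digraph.apath (inner_graph D) u p v)"

definition inner_route :: "('v, 'e) framed_dag \<Rightarrow> 'e list \<Rightarrow> bool" where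
  "inner_route D p \<longleftrightarrow> inner_path D p \<and> (\<forall>q. inner_path D q \<and> sublist p q \<longrightarrow> q = p)"

definition constant_label :: "('v, 'e) framed_dag \<Rightarrow> 'e list \<Rightarrow> bool" where
  "constant_label D p \<longleftrightarrow> (\<exists>l. \<forall>e\<in>set p. lab D e = l)"

definition leg :: "('v, 'e) framed_dag \<Rightarrow> 'e list \<Rightarrow> bool" where
  "leg D p \<longleftrightarrow> inner_route D p \<and> constant_label D p"

definition exceptional :: "('v, 'e) framed_dag \<Rightarrow> 'e list \<Rightarrow> bool" where
  "exceptional D R \<longleftrightarrow> route D R \<and> constant_label D R"

definition long_exceptional :: "('v, 'e) framed_dag \<Rightarrow> 'e list \<Rightarrow> bool" where
  "long_exceptional D R \<longleftrightarrow> exceptional D R \<and> (\<exists>p. leg D p \<and> sublist p R)"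

definition short_exceptional :: "('v, 'e) framed_dag \<Rightarrow> 'e list \<Rightarrow> bool" where
  "short_exceptional D R \<longleftrightarrow> exceptional D R \<and> \<not> long_exceptional D R"

definition path_vertices :: "('v, 'e) framed_dag \<Rightarrow> 'e list \<Rightarrow> 'v set" where
  "path_vertices D p = tail (graph D) ` set p \<union> head (graph D) ` set p"

definition lies_on :: "('v, 'e) framed_dag \<Rightarrow> 'e list \<Rightarrow> 'e list \<Rightarrow> bool" where
  "lies_on D R p \<longleftrightarrow>
     set R \<inter> arcs (inner_graph D) \<subseteq> set p \<and>
     path_vertices D R \<inter> inner_vertices D \<subseteq> path_vertices D p"

text \<open>
  The list \<open>q\<close> is a maximal common subpath \<open>[u, v]\<close> with \<open>u = head a = head a'\<close> and
  \<open>v = tail b = tail b'\<close>; it is empty when \<open>u = v\<close>, and then the two equations on end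
  points ensure that both routes pass through the same vertex. The strict label inequalities
  imply \<open>a \<noteq> a'\<close> and \<open>b \<noteq> b'\<close>.
\<close>

definition conflict :: "('v, 'e) framed_dag \<Rightarrow> 'e list \<Rightarrow> 'e list \<Rightarrow> bool" where
  "conflict D R S \<longleftrightarrow>
     (\<exists>q a b a' b'. sublist (a # q @ [b]) R \<and> sublist (a' # q @ [b']) S \<and>
        head (graph D) a = head (graph D) a' \<and> tail (graph D) b = tail (graph D) b' \<and>
        (lab D a < lab D a' \<and> lab D b > lab D b' \<or>
         lab D a > lab D a' \<and> lab D b < lab D b'))"

definition coherent :: "('v, 'e) framed_dag \<Rightarrow> 'e list \<Rightarrow> 'e list \<Rightarrow> bool" where
  "coherent D R S \<longleftrightarrow> \<not> conflict D R S"

definition clique :: "('v, 'e) framed_dag \<Rightarrow> 'e list set \<Rightarrow> bool" where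
  "clique D M \<longleftrightarrow> (\<forall>R\<in>M. route D R) \<and> (\<forall>R\<in>M. \<forall>S\<in>M. coherent D R S)"

definition maximal_clique :: "('v, 'e) framed_dag \<Rightarrow> 'e list set \<Rightarrow> bool" where
  "maximal_clique D M \<longleftrightarrow> clique D M \<and> (\<forall>M'. clique D M' \<and> M \<subseteq> M' \<longrightarrow> M' = M)"


section \<open>The g-polytope and its DKK triangulation\<close>

definition turns :: "('v, 'e) framed_dag \<Rightarrow> 'e list \<Rightarrow> 'v \<Rightarrow> nat \<Rightarrow> nat \<Rightarrow> bool" where
  "turns D R v l l' \<longleftrightarrow>
     (\<exists>a b. sublist [a, b] R \<and> head (graph D) a = v \<and> lab D a = l \<and> lab D b = l')"

text \<open>
  Vectors indexed by the inner vertices live in \<open>real ^ 'n\<close>, where \<open>w\<close> is a bijection from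
  the index type \<open>'n\<close> onto the inner vertices.
\<close>

definition gvec :: "('v, 'e) framed_dag \<Rightarrow> ('n::finite \<Rightarrow> 'v) \<Rightarrow> 'e list \<Rightarrow> real ^ 'n" where
  "gvec D w R =
     (\<chi> i. if turns D R (w i) 1 2 then -1 else if turns D R (w i) 2 1 then 1 else 0)"

definition g_polytope :: "('v, 'e) framed_dag \<Rightarrow> ('n::finite \<Rightarrow> 'v) \<Rightarrow> (real ^ 'n) set" where
  "g_polytope D w = convex hull (gvec D w ` {R. route D R})"

text \<open>Triangulations and subdivisions are given by their sets of maximal cells.\<close>

definition dkk_triangulation ::
  "('v, 'e) framed_dag \<Rightarrow> ('n::finite \<Rightarrow> 'v) \<Rightarrow> (real ^ 'n) set set" where
  "dkk_triangulation D w = {convex hull (gvec D w ` M) | M. maximal_clique D M}"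


section \<open>Pulling\<close>

definition refined_by :: "'a set set \<Rightarrow> 'a set set \<Rightarrow> bool" where
  "refined_by \<S> \<T> \<longleftrightarrow> (\<forall>T\<in>\<T>. \<exists>S\<in>\<S>. T \<subseteq> S)"

definition pull :: "'a::euclidean_space set set \<Rightarrow> 'a \<Rightarrow> 'a set set" where
  "pull \<S> x =
     {S \<in> \<S>. x \<notin> S} \<union>
     {convex hull (insert x F) | S F. S \<in> \<S> \<and> x \<in> S \<and> F facet_of S \<and> x \<notin> F}"

text \<open>
  A sequence of routes starting with the origin is represented by the list \<open>Rs\<close> of the routes
  after the origin.
\<close>

definition pull_routes ::
  "('v, 'e) framed_dag \<Rightarrow> ('n::finite \<Rightarrow> 'v) \<Rightarrow> 'e list list \<Rightarrow> (real ^ 'n) set set" where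
  "pull_routes D w Rs = foldl pull {g_polytope D w} (0 # map (gvec D w) Rs)"

definition pull_coherent ::
  "('v, 'e) framed_dag \<Rightarrow> ('n::finite \<Rightarrow> 'v) \<Rightarrow> 'e list list \<Rightarrow> bool" where
  "pull_coherent D w Rs \<longleftrightarrow> refined_by (pull_routes D w Rs) (dkk_triangulation D w)"

definition yields_dkk ::
  "('v, 'e) framed_dag \<Rightarrow> ('n::finite \<Rightarrow> 'v) \<Rightarrow> 'e list list \<Rightarrow> bool" where
  "yields_dkk D w Rs \<longleftrightarrow> pull_routes D w Rs = dkk_triangulation D w"

definition visited_routes ::
  "('v, 'e) framed_dag \<Rightarrow> 'e list list \<Rightarrow> 'e list set" where
  "visited_routes D Rs = set Rs \<union> {R. exceptional D R}"

text \<open>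
  In a pulling sequence no route repeats an earlier point (exceptional routes are the origin), and
  the pulling is carried to completion: every route has been pulled, or the result is already a
  triangulation. Without completeness the sequence consisting of the origin alone would be a
  (vacuous) sequence of DKK pull steps, although pulling at the origin need not triangulate.
\<close>

definition pulling_sequence ::
  "('v, 'e) framed_dag \<Rightarrow> ('n::finite \<Rightarrow> 'v) \<Rightarrow> 'e list list \<Rightarrow> bool" where
  "pulling_sequence D w Rs \<longleftrightarrow>
     (\<forall>R\<in>set Rs. route D R \<and> \<not> exceptional D R) \<and> distinct Rs \<and>
     ({R. route D R} \<subseteq> visited_routes D Rs \<or> triangulation (pull_routes D w Rs))"


section \<open>The DAGs Path(k) and Cycle(k) with the lab framing\<close>

datatype shape = Path (lens: "nat list") | Cycle (lens: "nat list")

fun valid_shape :: "shape \<Rightarrow> bool" where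
  "valid_shape (Path ks) \<longleftrightarrow> ks \<noteq> [] \<and> (\<forall>k\<in>set ks. 0 < k)"
| "valid_shape (Cycle ks) \<longleftrightarrow> ks \<noteq> [] \<and> even (length ks) \<and> (\<forall>k\<in>set ks. 0 < k)"

fun num_inner :: "shape \<Rightarrow> nat" where
  "num_inner (Path ks) = sum_list ks + 1"
| "num_inner (Cycle ks) = sum_list ks"

text \<open>
  The inner edge \<open>i\<close>, for \<open>i\<close> from 1 to \<open>sum_list (lens s)\<close>, joins vertex \<open>i\<close> to
  \<open>next_vertex s i\<close> and belongs to the inner route numbered \<open>leg_index s i\<close> (from 1).
\<close>

fun next_vertex :: "shape \<Rightarrow> nat \<Rightarrow> nat" where
  "next_vertex (Path ks) i = i + 1"
| "next_vertex (Cycle ks) i = i mod sum_list ks + 1"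

definition leg_index :: "shape \<Rightarrow> nat \<Rightarrow> nat" where
  "leg_index s i = (LEAST j. i \<le> sum_list (take j (lens s)))"

definition inner_tail :: "shape \<Rightarrow> nat \<Rightarrow> nat" where
  "inner_tail s i = (if odd (leg_index s i) then i else next_vertex s i)"

definition inner_head :: "shape \<Rightarrow> nat \<Rightarrow> nat" where
  "inner_head s i = (if odd (leg_index s i) then next_vertex s i else i)"

definition inner_label :: "shape \<Rightarrow> nat \<Rightarrow> nat" where
  "inner_label s i = (if odd (leg_index s i) then 2 else 1)"

datatype vertex = Source | Sink | Inner nat

text \<open>
  \<open>SourceEdge i l\<close> and \<open>SinkEdge i l\<close> are the source and sink edges at the inner vertex
  \<open>i\<close> with label \<open>l\<close>. Inner edges entering the same vertex have distinct labels, as have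
  inner edges leaving the same vertex, so fullness and the framing condition require exactly one
  source (sink) edge for each label not used by an inner edge entering (leaving) \<open>i\<close>.
\<close>

datatype edge = SourceEdge nat nat | SinkEdge nat nat | InnerEdge nat

definition dag_edges :: "shape \<Rightarrow> edge set" where
  "dag_edges s =
     InnerEdge ` {1..sum_list (lens s)} \<union>
     {SourceEdge v l | v l. v \<in> {1..num_inner s} \<and> l \<in> {1, 2} \<and>
        \<not> (\<exists>i\<in>{1..sum_list (lens s)}. inner_head s i = v \<and> inner_label s i = l)} \<union>
     {SinkEdge v l | v l. v \<in> {1..num_inner s} \<and> l \<in> {1, 2} \<and>
        \<not> (\<exists>i\<in>{1..sum_list (lens s)}. inner_tail s i = v \<and> inner_label s i = l)}"

fun edge_tail :: "shape \<Rightarrow> edge \<Rightarrow> vertex" where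
  "edge_tail s (SourceEdge v l) = Source"
| "edge_tail s (SinkEdge v l) = Inner v"
| "edge_tail s (InnerEdge i) = Inner (inner_tail s i)"

fun edge_head :: "shape \<Rightarrow> edge \<Rightarrow> vertex" where
  "edge_head s (SourceEdge v l) = Inner v"
| "edge_head s (SinkEdge v l) = Sink"
| "edge_head s (InnerEdge i) = Inner (inner_head s i)"

fun edge_label :: "shape \<Rightarrow> edge \<Rightarrow> nat" where
  "edge_label s (SourceEdge v l) = l"
| "edge_label s (SinkEdge v l) = l"
| "edge_label s (InnerEdge i) = inner_label s i"

definition dag :: "shape \<Rightarrow> (vertex, edge) framed_dag" where
  "dag s =
     \<lparr> graph = \<lparr> verts = {Source, Sink} \<union> Inner ` {1..num_inner s}, arcs = dag_edges s,
                 tail = edge_tail s, head = edge_head s \<rparr>,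
       src = Source, snk = Sink, lab = edge_label s \<rparr>"


section \<open>The coherence diagram and DKK pull steps\<close>

text \<open>
  Position of the name of a source or sink edge in the order
  \<open>1\<^sup>- < 1 < 1\<^sup>+ < 2\<^sup>- < 2 < 2\<^sup>+ < \<dots>\<close>: the names \<open>v\<^sup>-\<close>, \<open>v\<close>, \<open>v\<^sup>+\<close> have ranks
  \<open>3 * v\<close>, \<open>3 * v + 1\<close>, \<open>3 * v + 2\<close>. The value on inner edges is irrelevant.
\<close>

definition on_short :: "shape \<Rightarrow> edge \<Rightarrow> bool" where
  "on_short s e \<longleftrightarrow> (\<exists>R. short_exceptional (dag s) R \<and> e \<in> set R)"

fun name_rank :: "shape \<Rightarrow> edge \<Rightarrow> nat" where
  "name_rank s (SourceEdge v l) =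
     3 * v + (if on_short s (SourceEdge v l) then 1 else if l = 2 then 0 else 2)"
| "name_rank s (SinkEdge v l) =
     3 * v + (if on_short s (SinkEdge v l) then 1 else if l = 1 then 0 else 2)"
| "name_rank s (InnerEdge i) = 0"

text \<open>
  The last inner route of \<open>Cycle ks\<close>, which starts at vertex 1 and runs
  \<open>1 \<rightarrow> n \<rightarrow> n - 1 \<rightarrow> \<dots>\<close>.
\<close>

definition last_leg :: "nat list \<Rightarrow> edge list" where
  "last_leg ks = map InnerEdge (rev [sum_list (butlast ks) + 1 ..< sum_list ks + 1])"

fun in_bottom_row :: "shape \<Rightarrow> edge list \<Rightarrow> bool" where
  "in_bottom_row (Path ks) R \<longleftrightarrow> False"
| "in_bottom_row (Cycle ks) R \<longleftrightarrow>
     edge_head (Cycle ks) (hd R) = Inner 1 \<and> lies_on (dag (Cycle ks)) R (last_leg ks)"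

text \<open>
  Ranks are less than \<open>3 * (num_inner s + 1)\<close>. Adding this number moves the bottom rows below
  all others, and moves the boxes outside the bottom rows to the east of those in the bottom rows.
  A row together with its continuation consists of the boxes of routes with a common source edge.
\<close>

definition vertical_pos :: "shape \<Rightarrow> edge list \<Rightarrow> nat" where
  "vertical_pos s R =
     name_rank s (hd R) + (if in_bottom_row s R then 3 * (num_inner s + 1) else 0)"

definition horizontal_pos :: "shape \<Rightarrow> edge list \<Rightarrow> nat" where
  "horizontal_pos s R =
     name_rank s (last R) + (if in_bottom_row s R then 0 else 3 * (num_inner s + 1))"

definition north :: "shape \<Rightarrow> edge list \<Rightarrow> edge list set" where
  "north s R =
     {Q. route (dag s) Q \<and> last Q = last R \<and> vertical_pos s Q < vertical_pos s R}"

definition south :: "shape \<Rightarrow> edge list \<Rightarrow> edge list set" where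
  "south s R =
     {Q. route (dag s) Q \<and> last Q = last R \<and> vertical_pos s Q > vertical_pos s R}"

definition east :: "shape \<Rightarrow> edge list \<Rightarrow> edge list set" where
  "east s R =
     {Q. route (dag s) Q \<and> hd Q = hd R \<and> horizontal_pos s Q > horizontal_pos s R}"

definition west :: "shape \<Rightarrow> edge list \<Rightarrow> edge list set" where
  "west s R =
     {Q. route (dag s) Q \<and> hd Q = hd R \<and> horizontal_pos s Q < horizontal_pos s R}"

definition dkk_pull_step ::
  "shape \<Rightarrow> ('n::finite \<Rightarrow> vertex) \<Rightarrow> edge list list \<Rightarrow> edge list \<Rightarrow> bool" where
  "dkk_pull_step s w Rs R \<longleftrightarrow>
     pull_coherent (dag s) w Rs \<and> route (dag s) R \<and> R \<notin> visited_routes (dag s) Rs \<and>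
     (west s R \<subseteq> visited_routes (dag s) Rs \<or> north s R \<subseteq> visited_routes (dag s) Rs) \<and>
     (east s R \<subseteq> visited_routes (dag s) Rs \<or> south s R \<subseteq> visited_routes (dag s) Rs)"

definition consists_of_dkk_pull_steps ::
  "shape \<Rightarrow> ('n::finite \<Rightarrow> vertex) \<Rightarrow> edge list list \<Rightarrow> bool" where
  "consists_of_dkk_pull_steps s w Rs \<longleftrightarrow>
     (\<forall>i<length Rs. dkk_pull_step s w (take i Rs) (Rs ! i))"

end

theory Submission
  imports Defs
begin

text \<open>
  Every route runs along one leg, and its g-vector is \<open>e\<^sub>q - e\<^sub>p\<close> for the lowest position \<open>p\<close> and the
  highest position \<open>q\<close> of the leg at which it turns, one of which may be absent. Two routes are
  incoherent iff, as intervals, they overlap without being nested, or they meet head to tail at the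
  common end of two legs. A clique is therefore a bracket matching of the negative with the positive
  coordinates, leg by leg, so each vector is a nonnegative combination of a unique clique; a clique
  spans a face of \<open>P\<close> by an explicit supporting functional.

  If \<open>R, Q\<close> are incoherent and \<open>g(R) + g(Q) = g(X) + g(Y)\<close> with \<open>X, Y\<close> coherent, the segments \<open>RQ\<close> and
  \<open>XY\<close> cross in their midpoints, so they lie in the same faces. Pulling at \<open>R\<close> destroys the edge \<open>XY\<close>
  unless \<open>X\<close> or \<open>Y\<close> was pulled before; and once one of them is pulled, no cell contains both \<open>R\<close> and \<open>Q\<close>.
  Hence a sequence is pull-coherent iff each of its members \<open>R\<close> comes after \<open>X\<close> or \<open>Y\<close> for all such
  \<open>Q\<close>. The pairs \<open>X, Y\<close> arising for a given \<open>R\<close> are those of W(R) \<open>\<times>\<close> N(R) and E(R) \<open>\<times>\<close> S(R), up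
  to exceptional routes, and a product of two sets is covered by hitting one of its factors.
\<close>

section \<open>Faces and pullings\<close>

text \<open>The delicate passage is from legality to DKK pull steps. A step has to hit every pair
  \<open>X, Y\<close> with one box in each factor, but such a pair need not be coherent: when two
  legs share both ends, \<open>X\<close> and \<open>Y\<close> can meet head to tail at the second
  common end, and then g(X) + g(Y) = 0. This pair spans no edge of the triangulation, so pulling
  \<open>R\<close> breaks nothing there and legality of the single step asks for nothing. The
  missing visit is recovered from the history of the whole sequence, by two exchanges through a
  vertex strictly inside one of the two legs; two legs of one edge each offer no such vertex.

  The passage from legality to the triangulation needs a bound on what a cell can contain. After the
  pull at the origin every cell lies in a pyramid from the origin over a face that avoids it, so
  sums g(R) + g(Q) that vanish or reduce to a single route never come from two vertices of one cell.
  Only four-term relations remain, and these are the ones that legality controls.\<close>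

lemma face_of_midpoint:
  assumes "F face_of S" "a \<in> S" "b \<in> S" "(1/2) *\<^sub>R (a + b) \<in> F"
  shows "a \<in> F \<and> b \<in> F"
proof (cases "a = b")
  case True
  then show ?thesis using assms(4) by (simp add: scaleR_2[symmetric])
next
  case False
  have "(1/2) *\<^sub>R (a + b) \<in> open_segment a b"
    using midpoint_in_open_segment[of a b] False by (simp add: midpoint_def)
  then show ?thesis using assms by (meson face_ofD)
qed

lemma midpoint_in_convex:
  assumes "convex S" "a \<in> S" "b \<in> S"
  shows "(1/2) *\<^sub>R (a + b) \<in> S"
  using convexD[OF assms, of "1/2" "1/2"] by (simp add: scaleR_add_right)

text \<open>The combination lies in the open segment between \<open>y k\<close> and the normalised
  rest \<open>z\<close>, both points of \<open>S\<close>, so a face containing it contains both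
  ends. The cases \<open>u k = 1\<close> and \<open>z = y k\<close>, in which the segment
  degenerates, are separate.\<close>

lemma face_of_convex_sum:
  fixes y :: "'i \<Rightarrow> 'b::real_vector"
  assumes "F face_of S" "convex S" "finite J" "\<And>i. i \<in> J \<Longrightarrow> y i \<in> S" "\<And>i. i \<in> J \<Longrightarrow> 0 \<le> u i"
    "sum u J = 1" "(\<Sum>i\<in>J. u i *\<^sub>R y i) \<in> F" "k \<in> J" "0 < u k"
  shows "y k \<in> F"
proof (cases "u k = 1")
  case True
  have "sum u (J - {k}) = 0"
    using assms True by (simp add: sum_diff1)
  then have "u i = 0" if "i \<in> J - {k}" for i
    using sum_nonneg_eq_0_iff[of "J - {k}" u] that assms by auto
  then have "(\<Sum>i\<in>J - {k}. u i *\<^sub>R y i) = 0" by (intro sum.neutral) auto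
  then have "(\<Sum>i\<in>J. u i *\<^sub>R y i) = y k"
    using assms True by (simp add: sum.remove[of J k])
  then show ?thesis using assms by simp
next
  case False
  define s where "s = sum u (J - {k})"
  have s: "s = 1 - u k" using assms by (simp add: s_def sum_diff1)
  have "s \<ge> 0" unfolding s_def using assms by (intro sum_nonneg) auto
  with False s have "s > 0" by simp
  define z where "z = (\<Sum>i\<in>J - {k}. (u i / s) *\<^sub>R y i)"
  have z: "z \<in> S" unfolding z_def
  proof (rule convex_sum)
    show "(\<Sum>i\<in>J - {k}. u i / s) = 1" using \<open>s > 0\<close> by (simp add: sum_divide_distrib[symmetric] s_def)
  qed (use assms \<open>s > 0\<close> in auto)
  have "s *\<^sub>R z = (\<Sum>i\<in>J - {k}. u i *\<^sub>R y i)"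
    using \<open>s > 0\<close> by (simp add: z_def scaleR_sum_right)
  then have eq: "(\<Sum>i\<in>J. u i *\<^sub>R y i) = (1 - u k) *\<^sub>R z + u k *\<^sub>R y k"
    using assms s by (simp add: sum.remove[of J k])
  show ?thesis
  proof (cases "z = y k")
    case True
    then have "(1 - u k) *\<^sub>R z + u k *\<^sub>R y k = y k" by (simp add: algebra_simps)
    then show ?thesis using assms eq by simp
  next
    case ne: False
    have "(1 - u k) *\<^sub>R z + u k *\<^sub>R y k \<in> open_segment z (y k)"
      unfolding in_segment using ne \<open>s > 0\<close> s assms(9) by (intro conjI exI[of _ "u k"]) simp_all
    moreover have "y k \<in> S" "(1 - u k) *\<^sub>R z + u k *\<^sub>R y k \<in> F" using assms eq by auto
    ultimately show ?thesis using face_ofD[OF assms(1)] z by blast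
  qed
qed

text \<open>Follow the ray from \<open>x\<close> through \<open>z\<close> to its last point in
  \<open>S\<close>. A facet that contains this exit point and misses \<open>x\<close> has
  \<open>z\<close> in its pyramid.\<close>

lemma facet_seen_from_point:
  fixes S :: "'b::euclidean_space set"
  assumes "polytope S" "x \<in> S" "z \<in> S" "z \<noteq> x"
  obtains F where "F facet_of S" "x \<notin> F" "z \<in> convex hull (insert x F)"
proof -
  have poly: "polyhedron S" and comp: "compact S" and conv: "convex S"
    using assms by (auto simp: polytope_imp_polyhedron polytope_imp_compact polytope_imp_convex)
  define q where "q t = x + t *\<^sub>R (z - x)" for t :: real
  define T where "T = {t. q t \<in> S}"
  have cq: "continuous_on UNIV q" unfolding q_def by (intro continuous_intros)
  have "closed T" unfolding T_def
    using closed_vimage[OF compact_imp_closed[OF comp] cq] by (simp add: vimage_def)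
  moreover have bdT: "bounded T"
  proof -
    obtain B where B: "\<And>y. y \<in> S \<Longrightarrow> norm y \<le> B" using compact_imp_bounded[OF comp] by (auto simp: bounded_iff)
    have "norm t \<le> (B + norm x) / norm (z - x)" if "t \<in> T" for t
    proof -
      have "norm t * norm (z - x) \<le> norm (q t) + norm x"
        unfolding q_def norm_scaleR[symmetric] using norm_triangle_ineq4[of "x + t *\<^sub>R (z - x)" x] by simp
      also have "\<dots> \<le> B + norm x" using B that by (simp add: T_def)
      finally show ?thesis using assms by (simp add: field_simps)
    qed
    then show ?thesis by (auto simp: bounded_iff)
  qed
  ultimately have "compact T" by (simp add: compact_eq_bounded_closed)
  moreover have one: "1 \<in> T" using assms by (simp add: T_def q_def)
  ultimately obtain t where t: "t \<in> T" and tmax: "\<And>t'. t' \<in> T \<Longrightarrow> t' \<le> t"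
    using compact_attains_sup[of T] by blast
  have t1: "t \<ge> 1" using tmax one by simp
  obtain HH where HH: "finite HH" "S = \<Inter> HH" "\<forall>h \<in> HH. \<exists>a b. a \<noteq> 0 \<and> h = {x. a \<bullet> x \<le> b}"
    using poly unfolding polyhedron_def by blast
  \<comment> \<open>Some bounding half-space must stop the ray at \<open>q t\<close>. Otherwise each
    of the finitely many half-spaces still contains \<open>q t'\<close> for \<open>t'\<close>
    slightly above \<open>t\<close>, against the choice of \<open>t\<close>.\<close>
  have "\<exists>a b. S \<subseteq> {x. a \<bullet> x \<le> b} \<and> a \<bullet> (z - x) > 0 \<and> a \<bullet> q t = b"
  proof (rule ccontr)
    assume no: "\<not> ?thesis"
    have "\<forall>h\<in>HH. eventually (\<lambda>t'. q t' \<in> h) (at_right t)"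
    proof
      fix h assume h: "h \<in> HH"
      then obtain a b where ab: "h = {x. a \<bullet> x \<le> b}" using HH by blast
      have sub: "S \<subseteq> h" using h HH by auto
      have qt: "a \<bullet> q t \<le> b" using t sub ab by (auto simp: T_def)
      have exp: "a \<bullet> q t' = a \<bullet> q t + (t' - t) * (a \<bullet> (z - x))" for t'
        by (simp add: q_def inner_add_right algebra_simps)
      show "eventually (\<lambda>t'. q t' \<in> h) (at_right t)"
      proof (cases "a \<bullet> (z - x) > 0")
        case True
        then have lt: "a \<bullet> q t < b" using no sub ab qt by force
        have "isCont (\<lambda>t'. a \<bullet> q t') t" unfolding q_def by (intro continuous_intros)
        then have "((\<lambda>t'. a \<bullet> q t') \<longlongrightarrow> a \<bullet> q t) (at_right t)"
          by (meson continuous_at_imp_continuous_within continuous_within)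
        then have "eventually (\<lambda>t'. a \<bullet> q t' < b) (at_right t)"
          using lt order_tendstoD(2) by blast
        then show ?thesis by eventually_elim (simp add: ab)
      next
        case False
        have "eventually (\<lambda>t'. t' > t) (at_right t)" by (simp add: eventually_at_right_less)
        then show ?thesis
        proof eventually_elim
          case (elim t')
          then have "(t' - t) * (a \<bullet> (z - x)) \<le> 0" using False by (simp add: mult_nonneg_nonpos)
          then show ?case using exp[of t'] qt ab by simp
        qed
      qed
    qed
    then have "eventually (\<lambda>t'. \<forall>h\<in>HH. q t' \<in> h) (at_right t)"
      using HH(1) by (simp add: eventually_ball_finite)
    moreover have "eventually (\<lambda>t'. t' > t) (at_right t)" by (simp add: eventually_at_right_less)
    ultimately have "eventually (\<lambda>t'. t' > t \<and> q t' \<in> S) (at_right t)"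
      by eventually_elim (use HH(2) in auto)
    then obtain t' where "t' > t" "q t' \<in> S"
      using eventually_happens trivial_limit_at_right_real by blast
    then show False using tmax[of t'] by (simp add: T_def)
  qed
  then obtain a b where ab: "S \<subseteq> {x. a \<bullet> x \<le> b}" "a \<bullet> (z - x) > 0" "a \<bullet> q t = b" by blast
  define G where "G = S \<inter> {x. a \<bullet> x = b}"
  have G: "G face_of S" unfolding G_def
    by (rule face_of_Int_supporting_hyperplane_le[OF conv]) (use ab in auto)
  have xG: "a \<bullet> x < b"
  proof -
    have "a \<bullet> q t = a \<bullet> x + t * (a \<bullet> (z - x))" by (simp add: q_def inner_add_right)
    moreover have "t * (a \<bullet> (z - x)) > 0" using t1 ab by (intro mult_pos_pos) auto
    ultimately show ?thesis using ab by simp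
  qed
  have qG: "q t \<in> G" using t ab by (simp add: G_def T_def)
  have "x \<notin> G" using xG by (simp add: G_def)
  then have ne: "G \<noteq> {}" "G \<noteq> S" using qG assms by auto
  \<comment> \<open>\<open>G\<close> itself may have small dimension; as a proper face it is the
    intersection of the facets above it, and one of these misses \<open>x\<close>.\<close>
  have Ginter: "G = \<Inter>{F. F facet_of S \<and> G \<subseteq> F}" by (rule face_of_polyhedron[OF poly G ne])
  obtain F where F: "F facet_of S" "G \<subseteq> F" "x \<notin> F"
    using Ginter \<open>x \<notin> G\<close> by blast
  have "z = (1 - 1/t) *\<^sub>R x + (1/t) *\<^sub>R q t"
    using t1 by (simp add: q_def algebra_simps)
  moreover have "x \<in> convex hull (insert x F)" "q t \<in> convex hull (insert x F)"
    using qG F by (auto intro: hull_inc)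
  ultimately have "z \<in> convex hull (insert x F)"
    using convexD[OF convex_convex_hull, of x "insert x F" "q t" "1 - 1/t" "1/t"] t1 by auto
  with F that show ?thesis by blast
qed

lemma facets_seen_from_point_cover:
  fixes S :: "'b::euclidean_space set"
  assumes "polytope S" "x \<in> S" "aff_dim S > 0"
  shows "S \<subseteq> \<Union>{convex hull (insert x F) | F. F facet_of S \<and> x \<notin> F}"
proof
  fix z assume z: "z \<in> S"
  have "S \<noteq> {x}" using assms(3) by auto
  then obtain z' where z': "z' \<in> S" "z' \<noteq> x" using assms(2) by blast
  show "z \<in> \<Union>{convex hull (insert x F) | F. F facet_of S \<and> x \<notin> F}"
  proof (cases "z = x")
    case True
    \<comment> \<open>The apex lies in every pyramid, so any second point of \<open>S\<close> will
      do; positive dimension supplies one.\<close>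
    from facet_seen_from_point[OF assms(1,2) z'] obtain F where "F facet_of S" "x \<notin> F" by metis
    moreover have "z \<in> convex hull (insert x F)" using True by (simp add: hull_inc)
    ultimately show ?thesis by blast
  next
    case False
    from facet_seen_from_point[OF assms(1,2) z False] obtain F
      where "F facet_of S" "x \<notin> F" "z \<in> convex hull insert x F" by metis
    then show ?thesis by blast
  qed
qed

lemma pull_cases:
  assumes "T \<in> pull \<S> x"
  obtains "T \<in> \<S>" "x \<notin> T"
  | S F where "S \<in> \<S>" "x \<in> S" "F facet_of S" "x \<notin> F" "T = convex hull (insert x F)"
  using assms unfolding pull_def by auto

lemma foldl_pull_subset:
  assumes "\<And>S. S \<in> \<S> \<Longrightarrow> convex S" "T \<in> foldl pull \<S> xs"
  shows "convex T \<and> (\<exists>S\<in>\<S>. T \<subseteq> S)"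
  using assms(2)
proof (induction xs arbitrary: T rule: rev_induct)
  case Nil
  then show ?case using assms(1) by auto
next
  case (snoc x xs)
  then have "T \<in> pull (foldl pull \<S> xs) x" by simp
  then show ?case
  proof (cases rule: pull_cases)
    case 1
    then show ?thesis using snoc.IH by auto
  next
    case (2 S F)
    have "convex S" "\<exists>S'\<in>\<S>. S \<subseteq> S'" using snoc.IH[OF 2(1)] by auto
    moreover have "T \<subseteq> S"
      unfolding 2(5) using 2 \<open>convex S\<close> facet_of_imp_subset[of F S] by (intro hull_minimal) auto
    ultimately show ?thesis using 2 by blast
  qed
qed

section \<open>Pulling the polytope of a fan of cliques\<close>

text \<open>The axioms abstract a complete simplicial fan: by \<open>cover\<close> and
  \<open>unique\<close> each vector lies in the cone of a clique with unique coefficients, by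
  \<open>supported\<close> each clique lies on a hyperplane bounding the polytope, and by
  \<open>exposed\<close> each generator is a vertex. \<open>I\<close> stands for the routes that are
  not exceptional; the common image 0 of the others is added by hand.\<close>

locale clique_fan =
  fixes I :: "'a set" and g :: "'a \<Rightarrow> 'b::euclidean_space" and coh :: "'a \<Rightarrow> 'a \<Rightarrow> bool"
  assumes finite_I: "finite I"
    and coh_refl: "i \<in> I \<Longrightarrow> coh i i"
    and coh_sym: "coh i j \<Longrightarrow> coh j i"
    and exposed: "i \<in> I \<Longrightarrow> \<exists>f. 0 < f \<bullet> g i \<and> (\<forall>k\<in>I. k \<noteq> i \<longrightarrow> f \<bullet> g k < f \<bullet> g i)"
    and supported: "K \<subseteq> I \<Longrightarrow> (\<And>i j. i \<in> K \<Longrightarrow> j \<in> K \<Longrightarrow> coh i j) \<Longrightarrow>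
      \<exists>f. (\<forall>i\<in>I. f \<bullet> g i \<le> 1) \<and> (\<forall>i\<in>K. f \<bullet> g i = 1)"
    and cover: "\<exists>c. (\<forall>i\<in>I. 0 \<le> c i) \<and> (\<forall>i\<in>I. \<forall>j\<in>I. 0 < c i \<longrightarrow> 0 < c j \<longrightarrow> coh i j) \<and>
      (\<Sum>i\<in>I. c i *\<^sub>R g i) = x"
    and unique: "(\<And>i. i \<in> I \<Longrightarrow> 0 \<le> c i) \<Longrightarrow> (\<And>i. i \<in> I \<Longrightarrow> 0 \<le> d i) \<Longrightarrow>
      (\<And>i j. i \<in> I \<Longrightarrow> j \<in> I \<Longrightarrow> 0 < c i \<Longrightarrow> 0 < c j \<Longrightarrow> coh i j) \<Longrightarrow>
      (\<And>i j. i \<in> I \<Longrightarrow> j \<in> I \<Longrightarrow> 0 < d i \<Longrightarrow> 0 < d j \<Longrightarrow> coh i j) \<Longrightarrow>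
      (\<Sum>i\<in>I. c i *\<^sub>R g i) = (\<Sum>i\<in>I. d i *\<^sub>R g i) \<Longrightarrow> i \<in> I \<Longrightarrow> c i = d i"
    and resolve: "i \<in> I \<Longrightarrow> j \<in> I \<Longrightarrow> \<not> coh i j \<Longrightarrow>
      g i + g j = 0 \<or> (\<exists>k\<in>I. g i + g j = g k) \<or>
      (\<exists>k\<in>I. \<exists>l\<in>I. coh k l \<and> g i + g j = g k + g l)"
begin

definition cliq :: "'a set \<Rightarrow> bool" where
  "cliq K \<longleftrightarrow> K \<subseteq> I \<and> (\<forall>i\<in>K. \<forall>j\<in>K. coh i j)"

definition max_cliq :: "'a set \<Rightarrow> bool" where
  "max_cliq K \<longleftrightarrow> cliq K \<and> (\<forall>K'. cliq K' \<and> K \<subseteq> K' \<longrightarrow> K' = K)"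

definition rep :: "('a \<Rightarrow> real) \<Rightarrow> 'b \<Rightarrow> bool" where
  "rep c x \<longleftrightarrow> (\<forall>i\<in>I. 0 \<le> c i) \<and> cliq {i\<in>I. 0 < c i} \<and> (\<Sum>i\<in>I. c i *\<^sub>R g i) = x"

definition points :: "'b set" where "points = insert 0 (g ` I)"

definition simplex_of :: "'a set \<Rightarrow> 'b set" where
  "simplex_of K = convex hull (insert 0 (g ` K))"

definition fan_cells :: "'b set set" where
  "fan_cells = {simplex_of K | K. max_cliq K}"

definition cells :: "'a list \<Rightarrow> 'b set set" where
  "cells V = foldl pull {convex hull points} (0 # map g V)"

text \<open>Geometrically: no edge of the fan triangulation with both ends unpulled is crossed at
  its midpoint by a segment from \<open>g i\<close> to an incoherent \<open>g j\<close>.\<close>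

definition legal :: "'a set \<Rightarrow> 'a \<Rightarrow> bool" where
  "legal V i \<longleftrightarrow> (\<forall>j\<in>I. \<forall>k\<in>I. \<forall>l\<in>I. \<not> coh i j \<longrightarrow> coh k l \<longrightarrow> g i + g j = g k + g l \<longrightarrow> k \<in> V \<or> l \<in> V)"

definition legal_seq :: "'a list \<Rightarrow> bool" where
  "legal_seq V \<longleftrightarrow> (\<forall>n<length V. legal (set (take n V)) (V ! n))"

section \<open>Clique representations and vertices of the polytope\<close>

lemma rep_exists: "\<exists>c. rep c x"
  using cover[of x] unfolding rep_def cliq_def by (smt (verit) mem_Collect_eq subsetI)

lemma rep_unique: "rep c x \<Longrightarrow> rep d x \<Longrightarrow> i \<in> I \<Longrightarrow> c i = d i"
  by (rule unique) (auto simp: rep_def cliq_def)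

lemma points_finite: "finite points"
  by (simp add: points_def finite_I)

lemma g_ne_0: "i \<in> I \<Longrightarrow> g i \<noteq> 0"
  using exposed by fastforce

lemma g_inj: "i \<in> I \<Longrightarrow> j \<in> I \<Longrightarrow> g i = g j \<Longrightarrow> i = j"
  using exposed by (metis order_less_irrefl)

lemma exists_max_cliq:
  assumes "cliq K" shows "\<exists>M. max_cliq M \<and> K \<subseteq> M"
proof -
  have "finite {M. cliq M \<and> K \<subseteq> M}"
    by (rule finite_subset[of _ "Pow I"]) (auto simp: cliq_def finite_I)
  moreover have "{M. cliq M \<and> K \<subseteq> M} \<noteq> {}" using assms by blast
  ultimately obtain M where M: "M \<in> {M. cliq M \<and> K \<subseteq> M}"
    "\<forall>M'\<in>{M. cliq M \<and> K \<subseteq> M}. M \<subseteq> M' \<longrightarrow> M = M'"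
    by (meson finite_has_maximal)
  then show ?thesis unfolding max_cliq_def by (metis mem_Collect_eq order_trans)
qed

text \<open>The functional supporting the clique of \<open>c\<close> is at most 1 on the polytope,
  and its value at \<open>x\<close> is exactly the sum of the coefficients.\<close>

lemma rep_sum_le:
  assumes "rep c x" "x \<in> convex hull points"
  shows "(\<Sum>i\<in>I. c i) \<le> 1"
proof -
  let ?K = "{i\<in>I. 0 < c i}"
  obtain f where f: "\<And>i. i \<in> I \<Longrightarrow> f \<bullet> g i \<le> 1" "\<And>i. i \<in> ?K \<Longrightarrow> f \<bullet> g i = 1"
    using supported[of ?K] assms unfolding rep_def cliq_def by (smt (verit))
  have "convex hull points \<subseteq> {x. f \<bullet> x \<le> 1}"
    using f(1) by (intro hull_minimal) (auto simp: points_def convex_halfspace_le)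
  then have "f \<bullet> x \<le> 1" using assms by auto
  also have "f \<bullet> x = (\<Sum>i\<in>I. c i * (f \<bullet> g i))"
    using assms unfolding rep_def by (auto simp: inner_sum_right)
  also have "\<dots> = (\<Sum>i\<in>I. c i)"
    using f(2) assms unfolding rep_def by (intro sum.cong) (auto simp: less_le)
  finally show ?thesis .
qed

lemma span_points: "span (g ` I) = UNIV"
proof -
  have "x \<in> span (g ` I)" for x
  proof -
    obtain c where "rep c x" using rep_exists by blast
    then have "x = (\<Sum>i\<in>I. c i *\<^sub>R g i)" by (simp add: rep_def)
    then show ?thesis by (simp add: span_sum span_scale span_base)
  qed
  then show ?thesis by blast
qed

lemma aff_dim_points: "aff_dim (convex hull points) = DIM('b)"
proof -
  have "aff_dim points = dim points"
    by (rule aff_dim_zero) (simp add: points_def hull_inc)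
  also have "dim points = dim (span (g ` I))" unfolding points_def by (metis dim_span span_insert_0)
  finally show ?thesis by (simp add: span_points aff_dim_convex_hull)
qed

lemma extreme_point_polytope:
  assumes "i \<in> I" shows "g i extreme_point_of (convex hull points)"
proof -
  obtain f where f: "0 < f \<bullet> g i" "\<And>k. k \<in> I \<Longrightarrow> k \<noteq> i \<Longrightarrow> f \<bullet> g k < f \<bullet> g i"
    using exposed[OF assms] by blast
  let ?S = "points - {g i}"
  have "convex hull ?S \<subseteq> {x. f \<bullet> x < f \<bullet> g i}"
  proof (rule hull_minimal)
    show "?S \<subseteq> {x. f \<bullet> x < f \<bullet> g i}" using f by (auto simp: points_def)
  qed (simp add: convex_halfspace_lt)
  then have "g i \<notin> convex hull ?S" by auto
  moreover have "finite ?S" using points_finite by simp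
  ultimately have "g i extreme_point_of (convex hull insert (g i) ?S)"
    by (rule extreme_point_of_convex_hull_insert[rotated])
  moreover have "insert (g i) ?S = points" using assms by (auto simp: points_def)
  ultimately show ?thesis by simp
qed

text \<open>The invariant kept by all pulls after the one at the origin. The face \<open>B\<close>
  is fixed by that first pull and is what later excludes linear relations through 0 inside a
  cell.\<close>

definition proper_cell :: "'b set \<Rightarrow> bool" where
  "proper_cell S \<longleftrightarrow> (\<exists>X\<subseteq>points. S = convex hull X) \<and> aff_dim S = DIM('b) \<and>
    (\<exists>B. B face_of (convex hull points) \<and> 0 \<notin> B \<and> S \<subseteq> convex hull (insert 0 B))"

lemma proper_cell_convex: "proper_cell S \<Longrightarrow> convex S"
  unfolding proper_cell_def by auto

lemma proper_cell_polytope: "proper_cell S \<Longrightarrow> polytope S"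
  unfolding proper_cell_def polytope_def using points_finite by (metis finite_subset)

lemma face_hull_points:
  assumes "X \<subseteq> points" "F face_of (convex hull X)"
  obtains Y where "Y \<subseteq> X" "F = convex hull Y"
proof -
  have "compact X" using assms points_finite finite_imp_compact finite_subset by metis
  then show ?thesis using face_of_convex_hull_subset assms that by metis
qed

lemma zero_extreme:
  assumes "B face_of (convex hull points)" "0 \<notin> B"
  shows "0 extreme_point_of (convex hull (insert 0 B))"
proof -
  obtain Y where Y: "Y \<subseteq> points" "B = convex hull Y" using face_hull_points assms by blast
  have "finite Y" using Y points_finite finite_subset by blast
  then have "0 extreme_point_of (convex hull (insert 0 Y))"
    using extreme_point_of_convex_hull_insert assms Y by blast
  then show ?thesis using hull_insert[of convex 0 Y] Y by metis
qed

lemma extreme_point_mono: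
  "x extreme_point_of T \<Longrightarrow> x \<in> S \<Longrightarrow> S \<subseteq> T \<Longrightarrow> x extreme_point_of S"
  unfolding extreme_point_of_def by blast

lemma proper_cell_subset: "proper_cell S \<Longrightarrow> S \<subseteq> convex hull points"
  unfolding proper_cell_def using hull_mono by blast

lemma proper_cell_extreme:
  assumes "proper_cell S" "x \<in> points" "x \<in> S"
  shows "x extreme_point_of S"
proof (cases "x = 0")
  case True
  obtain B where "B face_of (convex hull points)" "0 \<notin> B" "S \<subseteq> convex hull (insert 0 B)"
    using assms unfolding proper_cell_def by blast
  then show ?thesis using zero_extreme extreme_point_mono assms True by blast
next
  case False
  then obtain i where "i \<in> I" "x = g i" using assms by (auto simp: points_def)
  then show ?thesis using extreme_point_polytope extreme_point_mono proper_cell_subset assms by metis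
qed

text \<open>Without 0 all vertices of the cell would be vertices of the pyramid other than its apex,
  hence lie in \<open>B\<close>, whose dimension is too small.\<close>

lemma proper_cell_zero:
  assumes "proper_cell S" shows "0 \<in> S"
proof (rule ccontr)
  assume "0 \<notin> S"
  obtain B X where B: "B face_of (convex hull points)" "0 \<notin> B" "S \<subseteq> convex hull (insert 0 B)"
    and X: "X \<subseteq> points" "S = convex hull X" and dim: "aff_dim S = DIM('b)"
    using assms unfolding proper_cell_def by blast
  have "X \<subseteq> B"
  proof
    fix x assume x: "x \<in> X"
    then have xS: "x \<in> S" using X by (simp add: hull_inc)
    with \<open>0 \<notin> S\<close> x X obtain i where i: "i \<in> I" "x = g i" by (auto simp: points_def)
    have "convex hull (insert 0 B) \<subseteq> convex hull points"
      using B face_of_imp_subset[OF B(1)] by (intro hull_minimal) (auto simp: points_def hull_inc)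
    then have "x extreme_point_of (convex hull (insert 0 B))"
      using extreme_point_mono[OF extreme_point_polytope[OF i(1)]] B(3) xS i by blast
    then show "x \<in> B" using extreme_point_of_convex_hull g_ne_0 i by blast
  qed
  then have "S \<subseteq> B" using X B face_of_imp_convex hull_minimal by metis
  then have "aff_dim S \<le> aff_dim B" by (rule aff_dim_subset)
  also have "aff_dim B < aff_dim (convex hull points)"
    using B by (intro face_of_aff_dim_lt) (auto simp: points_def hull_inc)
  finally show False using dim aff_dim_points by simp
qed

text \<open>The vertices \<open>g i\<close> and \<open>g j\<close> lie in \<open>B\<close>, so their
  midpoint does. If their sum were 0 or \<open>g k\<close>, then \<open>B\<close> would contain 0,
  in the second case because the midpoint is also that of 0 and \<open>g k\<close>.\<close>

lemma proper_cell_no_short_sum: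
  assumes S: "proper_cell S" and ij: "i \<in> I" "j \<in> I" "g i \<in> S" "g j \<in> S"
  shows "g i + g j \<noteq> 0" "k \<in> I \<Longrightarrow> g i + g j \<noteq> g k"
proof -
  obtain B where B: "B face_of (convex hull points)" "0 \<notin> B" "S \<subseteq> convex hull (insert 0 B)"
    using S unfolding proper_cell_def by blast
  have sub: "convex hull (insert 0 B) \<subseteq> convex hull points"
    using B face_of_imp_subset[OF B(1)] by (intro hull_minimal) (auto simp: points_def hull_inc)
  have inB: "g i \<in> B" if "i \<in> I" "g i \<in> S" for i
  proof -
    have "g i extreme_point_of (convex hull (insert 0 B))"
      using extreme_point_mono[OF extreme_point_polytope[OF that(1)]] B(3) sub that by blast
    then show ?thesis using extreme_point_of_convex_hull g_ne_0 that by blast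
  qed
  have mid: "(1/2) *\<^sub>R (g i + g j) \<in> B"
    using inB ij B(1) by (intro midpoint_in_convex) (auto simp: face_of_imp_convex)
  then show "g i + g j \<noteq> 0" using B(2) by auto
  show "g i + g j \<noteq> g k" if "k \<in> I"
  proof
    assume "g i + g j = g k"
    then have "(1/2) *\<^sub>R (0 + g k) \<in> B" using mid by simp
    moreover have "0 \<in> convex hull points" "g k \<in> convex hull points"
      using that by (auto simp: points_def hull_inc)
    ultimately show False using face_of_midpoint[OF B(1)] B(2) by blast
  qed
qed

lemma pyramid:
  assumes X: "X \<subseteq> points" "S = convex hull X" and dim: "aff_dim S = DIM('b)"
    and F: "F facet_of S" "x \<in> S" "x \<notin> F" "x \<in> points" and T: "T = convex hull (insert x F)"
  shows "\<exists>X\<subseteq>points. T = convex hull X" "aff_dim T = DIM('b)" "T \<subseteq> S" "F face_of T"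
proof -
  have FS: "F face_of S" using F facet_of_imp_face_of by blast
  obtain Y where Y: "Y \<subseteq> X" "F = convex hull Y"
    using face_hull_points[OF X(1)] FS X(2) by blast
  show "\<exists>X\<subseteq>points. T = convex hull X"
    using Y X F T hull_insert[of convex x Y] by (intro exI[of _ "insert x Y"]) auto
  have convS: "convex S" using X by simp
  show sub: "T \<subseteq> S" unfolding T
    using F face_of_imp_subset[OF FS] by (intro hull_minimal) (auto simp: convS)
  show "F face_of T"
    by (rule face_of_subset[OF FS _ sub]) (auto simp: T hull_inc)
  have "x \<notin> affine hull F"
    using F face_of_imp_eq_affine_Int[OF convS FS] by blast
  then have "aff_dim (insert x F) = aff_dim F + 1" by (simp add: aff_dim_insert)
  then show "aff_dim T = DIM('b)"
    using F dim by (simp add: T aff_dim_convex_hull facet_of_def)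
qed

section \<open>Cells and their edges during a pulling\<close>

lemma cells_Nil:
  assumes "S \<in> cells []"
  obtains F where "F facet_of (convex hull points)" "0 \<notin> F" "S = convex hull (insert 0 F)"
proof -
  have "0 \<in> convex hull points" by (simp add: points_def hull_inc)
  then show ?thesis using assms that unfolding cells_def pull_def by auto
qed

lemma cells_snoc: "cells (V @ [i]) = pull (cells V) (g i)"
  by (simp add: cells_def)

lemma cells_proper:
  assumes "set V \<subseteq> I" "S \<in> cells V"
  shows "proper_cell S"
  using assms
proof (induction V arbitrary: S rule: rev_induct)
  case Nil
  from Nil(2) obtain F where F: "F facet_of (convex hull points)" "0 \<notin> F" "S = convex hull (insert 0 F)"
    by (rule cells_Nil)
  have "0 \<in> convex hull points" by (simp add: points_def hull_inc)
  note P = pyramid[OF order_refl refl aff_dim_points F(1) this F(2) _ F(3)]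
  show ?case unfolding proper_cell_def
    using P F facet_of_imp_face_of[OF F(1)] by (auto simp: points_def)
next
  case (snoc i V)
  from snoc.prems have "S \<in> pull (cells V) (g i)" by (simp add: cells_snoc)
  then show ?case
  proof (cases rule: pull_cases)
    case 1 then show ?thesis using snoc by simp
  next
    case (2 S' F)
    then have S': "proper_cell S'" using snoc by simp
    then obtain X B where X: "X \<subseteq> points" "S' = convex hull X" "aff_dim S' = DIM('b)"
      and B: "B face_of (convex hull points)" "0 \<notin> B" "S' \<subseteq> convex hull (insert 0 B)"
      unfolding proper_cell_def by blast
    have "g i \<in> points" using snoc.prems by (simp add: points_def)
    note P = pyramid[OF X 2(3,2,4) this 2(5)]
    show ?thesis unfolding proper_cell_def using P B by blast
  qed
qed

text \<open>The last clause of the second case drives the edge arguments below: members of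
  \<open>points\<close> in a cell are extreme there, so besides its apex a pyramid contains only
  those of its base.\<close>

lemma cells_pull_cases:
  assumes "set V \<subseteq> I" "i \<in> I" "T \<in> cells (V @ [i])"
  obtains "T \<in> cells V" "g i \<notin> T"
  | S F where "S \<in> cells V" "g i \<in> S" "F facet_of S" "F face_of S" "g i \<notin> F" "T = convex hull (insert (g i) F)"
    "T \<subseteq> S" "F face_of T" "\<And>x. x \<in> points \<Longrightarrow> x \<in> T \<Longrightarrow> x = g i \<or> x \<in> F"
proof -
  have "T \<in> pull (cells V) (g i)" using assms by (simp add: cells_snoc)
  then show ?thesis
  proof (cases rule: pull_cases)
    case 1 then show ?thesis using that(1) by blast
  next
    case (2 S F)
    have S: "proper_cell S" using cells_proper assms 2 by blast
    have T: "proper_cell T" using cells_proper[of "V @ [i]"] assms by simp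
    from S obtain X where X: "X \<subseteq> points" "S = convex hull X" "aff_dim S = DIM('b)"
      unfolding proper_cell_def by blast
    have "g i \<in> points" using assms by (simp add: points_def)
    note P = pyramid[OF X 2(3,2,4) this 2(5)]
    show ?thesis
    proof (rule that(2)[OF 2(1,2,3) _ 2(4,5) P(3,4)])
      show "F face_of S" using 2 facet_of_imp_face_of by blast
      show "x = g i \<or> x \<in> F" if "x \<in> points" "x \<in> T" for x
      proof -
        have "x extreme_point_of (convex hull (insert (g i) F))" using proper_cell_extreme[OF T that] 2(5) by simp
        then show ?thesis using extreme_point_of_convex_hull by blast
      qed
    qed
  qed
qed

text \<open>A facet containing the edge contains its midpoint, hence every segment through the midpoint;
  so pulling at other points does not separate the edge from the segment.\<close>

lemma unpulled_edge:
  assumes "set V \<subseteq> I" "a \<in> I" "b \<in> I" "c \<in> I" "d \<in> I" "g a + g b = g c + g d"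
    "S \<in> cells V" "c \<notin> set V" "d \<notin> set V" "g c \<in> S" "g d \<in> S"
  shows "g a \<in> S \<and> g b \<in> S"
  using assms(1,7-)
proof (induction V arbitrary: S rule: rev_induct)
  case Nil
  from Nil(2) obtain F where F: "F facet_of (convex hull points)" "0 \<notin> F" "S = convex hull (insert 0 F)"
    by (rule cells_Nil)
  have pr: "proper_cell S" using cells_proper Nil by blast
  have inF: "x \<in> F" if "x \<in> g ` I" "x \<in> S" for x
  proof -
    have "x extreme_point_of S" by (rule proper_cell_extreme[OF pr]) (use that in \<open>auto simp: points_def\<close>)
    then have "x \<in> insert 0 F" using extreme_point_of_convex_hull F(3) by blast
    then show ?thesis using that g_ne_0 by auto
  qed
  have FP: "F face_of (convex hull points)" using F facet_of_imp_face_of by blast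
  have "(1/2) *\<^sub>R (g c + g d) \<in> F"
    using inF Nil assms face_of_imp_convex[OF FP] by (intro midpoint_in_convex) auto
  then have "(1/2) *\<^sub>R (g a + g b) \<in> F" using assms by simp
  moreover have "g a \<in> convex hull points" "g b \<in> convex hull points"
    using assms by (auto simp: points_def hull_inc)
  ultimately have "g a \<in> F \<and> g b \<in> F" using face_of_midpoint[OF FP] by blast
  then show ?case using F(3) by (simp add: hull_inc)
next
  case (snoc i V)
  have "set V \<subseteq> I" "i \<in> I" using snoc.prems by auto
  from this snoc.prems(2) show ?case
  proof (cases rule: cells_pull_cases)
    case 1 then show ?thesis using snoc by auto
  next
    case (2 S' F)
    have ne: "g c \<noteq> g i" "g d \<noteq> g i" using g_inj snoc.prems \<open>i \<in> I\<close> assms by (metis in_set_conv_decomp)+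
    have cd: "g c \<in> F" "g d \<in> F" using 2(9)[of "g c"] 2(9)[of "g d"] ne snoc.prems assms
      by (auto simp: points_def)
    have "g a \<in> S' \<and> g b \<in> S'"
      using snoc.IH[OF \<open>set V \<subseteq> I\<close> 2(1)] snoc.prems cd face_of_imp_subset[OF 2(4)] by auto
    moreover have "(1/2) *\<^sub>R (g c + g d) \<in> F"
      using cd face_of_imp_convex[OF 2(4)] by (intro midpoint_in_convex) auto
    then have "(1/2) *\<^sub>R (g a + g b) \<in> F" using assms by simp
    ultimately have "g a \<in> F \<and> g b \<in> F" using face_of_midpoint[OF 2(4)] by blast
    then show ?thesis using 2(6) by (simp add: hull_inc)
  qed
qed

text \<open>A kept cell with the edge \<open>c d\<close> would contain \<open>g i\<close> by
  \<open>unpulled_edge\<close>; a new one would have the edge in its base \<open>F\<close>, and then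
  the common midpoint forces the apex \<open>g i\<close> into \<open>F\<close>.\<close>

lemma pulled_crossing_edge:
  assumes "set V \<subseteq> I" "i \<in> I" "j \<in> I" "c \<in> I" "d \<in> I" "g i + g j = g c + g d"
    "c \<notin> set V" "d \<notin> set V" "c \<noteq> i" "d \<noteq> i" "S \<in> cells (V @ [i])" "g c \<in> S" "g d \<in> S"
  shows False
  using assms(1,2,11)
proof (cases rule: cells_pull_cases)
  case 1
  then show ?thesis using unpulled_edge[OF assms(1-6) 1(1)] assms by auto
next
  case (2 S' F)
  have ne: "g c \<noteq> g i" "g d \<noteq> g i" using g_inj assms by metis+
  have cd: "g c \<in> F" "g d \<in> F" using 2(9)[of "g c"] 2(9)[of "g d"] ne assms by (auto simp: points_def)
  have "g i \<in> S' \<and> g j \<in> S'"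
    using unpulled_edge[OF assms(1-6) 2(1)] assms cd face_of_imp_subset[OF 2(4)] by auto
  moreover have "(1/2) *\<^sub>R (g c + g d) \<in> F"
    using cd face_of_imp_convex[OF 2(4)] by (intro midpoint_in_convex) auto
  then have "(1/2) *\<^sub>R (g i + g j) \<in> F" using assms by simp
  ultimately show False using face_of_midpoint[OF 2(4)] 2(5) by blast
qed

section \<open>Refinement by the fan and legal sequences\<close>

lemma fan_cell_refl: "K \<subseteq> I \<Longrightarrow> i \<in> K \<Longrightarrow> g i \<in> simplex_of K"
  by (simp add: simplex_of_def hull_inc)

text \<open>If one index were common to both pairs, cancelling it would identify the other two by
  injectivity of \<open>g\<close>, and one pair would be both coherent and incoherent.\<close>

lemma resolved_distinct:
  assumes "i \<in> I" "j \<in> I" "k \<in> I" "l \<in> I" "\<not> coh i j" "coh k l" "g i + g j = g k + g l"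
  shows "k \<noteq> i" "l \<noteq> i" "k \<noteq> j" "l \<noteq> j"
proof -
  have "j = l" if "k = i" using g_inj that assms by simp
  moreover have "j = k" if "l = i" using g_inj that assms by simp
  moreover have "i = l" if "k = j" using g_inj that assms by (simp add: add.commute)
  moreover have "i = k" if "l = j" using g_inj that assms by (simp add: add.commute)
  ultimately show "k \<noteq> i" "l \<noteq> i" "k \<noteq> j" "l \<noteq> j" using assms coh_sym by metis+
qed

lemma cells_append_subset:
  assumes "set V \<subseteq> I" "S \<in> cells (V @ W)"
  shows "\<exists>S'\<in>cells V. S \<subseteq> S'"
proof -
  have "cells (V @ W) = foldl pull (cells V) (map g W)" by (simp add: cells_def)
  then show ?thesis using foldl_pull_subset[of "cells V" S "map g W"] assms cells_proper proper_cell_convex by auto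
qed

text \<open>The edge \<open>k l\<close> extends to a maximal clique, whose simplex lies in one cell
  of the final subdivision and thus in one cell just after step \<open>n\<close>. If both ends were
  still unpulled, the pull at step \<open>n\<close> would have destroyed it.\<close>

theorem refined_imp_legal:
  assumes V: "set V \<subseteq> I" and ref: "refined_by (cells V) fan_cells"
  shows "legal_seq V"
  unfolding legal_seq_def legal_def
proof (intro allI impI ballI)
  fix n j k l
  assume n: "n < length V" and I: "j \<in> I" "k \<in> I" "l \<in> I"
    and inc: "\<not> coh (V ! n) j" and coh: "coh k l" and eq: "g (V ! n) + g j = g k + g l"
  show "k \<in> set (take n V) \<or> l \<in> set (take n V)"
  proof (rule ccontr)
    assume no: "\<not> (k \<in> set (take n V) \<or> l \<in> set (take n V))"
    have "cliq {k, l}" using coh I coh_refl coh_sym by (auto simp: cliq_def)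
    then obtain M where M: "max_cliq M" "{k, l} \<subseteq> M" using exists_max_cliq by blast
    then obtain S where S: "S \<in> cells V" "simplex_of M \<subseteq> S"
      using ref unfolding refined_by_def fan_cells_def by blast
    have Vn: "V ! n \<in> I" using n V by auto
    have "M \<subseteq> I" using M unfolding max_cliq_def cliq_def by blast
    then have kl: "g k \<in> S" "g l \<in> S" using fan_cell_refl[of M] M(2) S(2) by auto
    have tk: "set (take n V) \<subseteq> I" "set (take (Suc n) V) \<subseteq> I" using V set_take_subset by fast+
    have "S \<in> cells (take (Suc n) V @ drop (Suc n) V)" using S by simp
    then obtain S' where S': "S' \<in> cells (take (Suc n) V)" "S \<subseteq> S'" using cells_append_subset[OF tk(2)] by blast
    then have "S' \<in> cells (take n V @ [V ! n])" using n by (simp add: take_Suc_conv_app_nth)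
    with pulled_crossing_edge[OF tk(1) Vn I eq _ _ _ _ this] no
      resolved_distinct[OF Vn I inc coh eq] kl S'(2)
    show False by auto
  qed
qed

lemma legal_seq_snoc: "legal_seq (V @ [i]) \<longleftrightarrow> legal_seq V \<and> legal (set V) i"
  unfolding legal_seq_def by (auto simp: less_Suc_eq nth_append)

lemma legal_seq_prefix: "legal_seq (V @ W) \<Longrightarrow> legal_seq V"
  by (induction W rule: rev_induct) (auto simp: legal_seq_snoc simp flip: append_assoc)

lemma legal_seq_mem:
  assumes "legal_seq V" "i \<in> set V" "j \<in> I" "k \<in> I" "l \<in> I" "\<not> coh i j" "coh k l" "g i + g j = g k + g l"
  shows "k \<in> set V \<or> l \<in> set V"
proof -
  obtain n where n: "n < length V" "V ! n = i" using assms by (meson in_set_conv_nth)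
  then have "legal (set (take n V)) i" using assms unfolding legal_seq_def by blast
  then have "k \<in> set (take n V) \<or> l \<in> set (take n V)" using assms unfolding legal_def by blast
  then show ?thesis using in_set_takeD by metis
qed

text \<open>Here the roles are exchanged. When the first of \<open>k\<close>, \<open>l\<close> is
  pulled, neither \<open>i\<close> nor \<open>j\<close> has been pulled, since legality would have
  demanded \<open>k\<close> or \<open>l\<close> before it; so this pull breaks the segment from
  \<open>g i\<close> to \<open>g j\<close>.\<close>

lemma separated:
  assumes "set V \<subseteq> I" "legal_seq V" "i \<in> I" "j \<in> I" "k \<in> I" "l \<in> I" "\<not> coh i j" "coh k l"
    "g i + g j = g k + g l" "k \<in> set V \<or> l \<in> set V" "S \<in> cells V" "g i \<in> S" "g j \<in> S"
  shows False
  using assms(1,2,10-13)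
proof (induction V arbitrary: S rule: rev_induct)
  case Nil
  then show ?case by simp
next
  case (snoc x V)
  have V: "set V \<subseteq> I" "x \<in> I" and leg: "legal_seq V" using snoc.prems by (auto simp: legal_seq_snoc)
  obtain S' where "S' \<in> cells V" "S \<subseteq> S'" using cells_append_subset[OF V(1)] snoc.prems by blast
  then have new: "k \<notin> set V" "l \<notin> set V" using snoc.IH[OF V(1) leg, of S'] snoc.prems by blast+
  then have x: "x = k \<or> x = l" using snoc.prems by auto
  have old: "i \<notin> set V" "j \<notin> set V"
    using legal_seq_mem[OF leg, of i j k l] legal_seq_mem[OF leg, of j i k l] new assms coh_sym
    by (auto simp: add.commute)
  have ne: "k \<noteq> i" "l \<noteq> i" "k \<noteq> j" "l \<noteq> j" using resolved_distinct assms by metis+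
  have pc: "x \<noteq> i" "x \<noteq> j" "(x = k \<and> g k + g l = g i + g j) \<or> (x = l \<and> g l + g k = g i + g j)"
    using x ne assms by (auto simp: add.commute)
  then show ?case
    using pulled_crossing_edge[OF V(1), of k l i j S] pulled_crossing_edge[OF V(1), of l k i j S]
      snoc.prems old ne assms by metis
qed

lemma legal_coherent:
  assumes "set V \<subseteq> I" "legal_seq V" "legal (set V) i" "i \<in> I" "j \<in> I" "S \<in> cells V" "g i \<in> S" "g j \<in> S"
  shows "coh i j"
proof (rule ccontr)
  assume inc: "\<not> coh i j"
  have "proper_cell S" using cells_proper assms by blast
  then obtain k l where kl: "k \<in> I" "l \<in> I" "coh k l" "g i + g j = g k + g l"
    using resolve[OF assms(4,5) inc] proper_cell_no_short_sum[of S i j] assms by blast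
  then have "k \<in> set V \<or> l \<in> set V" using assms inc unfolding legal_def by blast
  then show False using separated assms kl inc by blast
qed

text \<open>Padding \<open>c\<close> with the origin at weight \<open>1 - sum c I\<close> (the index
  \<open>None\<close>) turns the representation into a convex combination of points of
  \<open>S\<close>; every point of positive weight then lies in the face.\<close>

lemma support_in_face:
  assumes F: "F face_of S" and S: "convex S" "S \<subseteq> convex hull points" "0 \<in> S"
    and y: "y \<in> F" "rep c y" and supp: "\<And>i. i \<in> I \<Longrightarrow> 0 < c i \<Longrightarrow> g i \<in> S" and i: "i \<in> I" "0 < c i"
  shows "g i \<in> F"
proof -
  let ?K = "{i\<in>I. 0 < c i}"
  let ?J = "insert None (Some ` ?K)"
  let ?u = "\<lambda>m. case m of None \<Rightarrow> 1 - sum c I | Some i \<Rightarrow> c i"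
  let ?y = "\<lambda>m. case m of None \<Rightarrow> 0 | Some i \<Rightarrow> g i"
  have "y \<in> convex hull points" using y face_of_imp_subset[OF F] S by blast
  then have le: "sum c I \<le> 1" using rep_sum_le y by blast
  have c0: "0 \<le> c k" if "k \<in> I" for k using y that by (simp add: rep_def)
  then have cK: "c k = 0" if "k \<in> I - ?K" for k using that by force
  have finK: "finite ?K" using finite_I by simp
  have sK: "sum c ?K = sum c I" using cK finite_I by (intro sum.mono_neutral_left) auto
  have "(\<Sum>k\<in>?K. c k *\<^sub>R g k) = (\<Sum>k\<in>I. c k *\<^sub>R g k)" using cK finite_I by (intro sum.mono_neutral_left) auto
  then have yK: "(\<Sum>k\<in>?K. c k *\<^sub>R g k) = y" using y by (simp add: rep_def)
  have "?y (Some i) \<in> F"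
  proof (rule face_of_convex_sum[OF F S(1), of ?J ?y ?u])
    show "finite ?J" using finK by simp
    show "?y m \<in> S" if "m \<in> ?J" for m using that S supp by auto
    show "0 \<le> ?u m" if "m \<in> ?J" for m using that le by auto
    show "sum ?u ?J = 1" using finK sK by (simp add: sum.reindex)
    show "(\<Sum>m\<in>?J. ?u m *\<^sub>R ?y m) \<in> F" using finK yK y by (simp add: sum.reindex)
  qed (use i in auto)
  then show ?thesis by simp
qed

text \<open>In a pyramid, \<open>z\<close> combines the apex \<open>g x\<close> with a base point
  \<open>y\<close>. The clique of \<open>y\<close> lies in the base by
  \<open>support_in_face\<close> and is coherent with \<open>x\<close> because both lie in the old
  cell. So adding \<open>x\<close> to it gives a clique representation of \<open>z\<close>, which by
  uniqueness is the given one.\<close>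

lemma support_in_cell:
  assumes "set V \<subseteq> I" "legal_seq V" "S \<in> cells V" "z \<in> S" "rep c z" "i \<in> I" "0 < c i"
  shows "g i \<in> S"
  using assms
proof (induction V arbitrary: S z c i rule: rev_induct)
  case Nil
  from Nil(3) obtain F where F: "F facet_of (convex hull points)" "0 \<notin> F" "S = convex hull (insert 0 F)"
    by (rule cells_Nil)
  have FP: "F face_of (convex hull points)" using F facet_of_imp_face_of by blast
  have "F \<noteq> {}" using F by (simp add: facet_of_def)
  then obtain y u where y: "y \<in> F" "0 \<le> u" "u \<le> 1" "z = u *\<^sub>R y"
    using Nil(4) F(3) face_of_imp_convex[OF FP] hull_same[of convex F]
    by (auto simp: convex_hull_insert) (metis add_increasing2 add.commute order_refl le_add_same_cancel1)
  obtain d where d: "rep d y" using rep_exists by blast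
  have "rep (\<lambda>i. u * d i) z"
    using d y(2) unfolding rep_def y(4) cliq_def
    by (auto simp: scaleR_sum_right zero_less_mult_iff)
  then have "c i = u * d i" using rep_unique Nil by blast
  then have "0 < d i" using Nil(7) y(2) by (simp add: zero_less_mult_iff)
  then have "g i \<in> F"
    using support_in_face[OF FP _ _ _ y(1) d] Nil(6) by (auto simp: points_def hull_inc)
  then show ?case using F by (simp add: hull_inc)
next
  case (snoc x V)
  have V: "set V \<subseteq> I" "x \<in> I" and leg: "legal_seq V" "legal (set V) x"
    using snoc.prems by (auto simp: legal_seq_snoc)
  from V snoc.prems(3) show ?case
  proof (cases rule: cells_pull_cases)
    case 1
    then show ?thesis using snoc V leg by blast
  next
    case (2 S' F)
    have pc: "proper_cell S'" using cells_proper V 2 by blast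
    have "F \<noteq> {}" using 2 by (simp add: facet_of_def)
    then obtain y u where y: "y \<in> F" "0 \<le> u" "u \<le> 1" "z = (1 - u) *\<^sub>R g x + u *\<^sub>R y"
      using snoc.prems(4) 2(6) face_of_imp_convex[OF 2(4)] hull_same[of convex F]
      by (auto simp: convex_hull_insert) (metis add_diff_cancel_right' le_add_same_cancel2)
    have yS: "y \<in> S'" using y face_of_imp_subset[OF 2(4)] by blast
    obtain d where d: "rep d y" using rep_exists by blast
    have dS: "g k \<in> S'" if "k \<in> I" "0 < d k" for k
      using snoc.IH[OF V(1) leg(1) 2(1) yS d that] .
    have dF: "g k \<in> F" if "k \<in> I" "0 < d k" for k
      using support_in_face[OF 2(4) proper_cell_convex[OF pc] proper_cell_subset[OF pc]
          proper_cell_zero[OF pc] y(1) d dS that] .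
    have cx: "coh x k" if "k \<in> I" "0 < d k" for k
      using legal_coherent[OF V(1) leg V(2) that(1) 2(1,2)] dS that by blast
    define e where "e k = (if k = x then 1 - u else 0) + u * d k" for k
    have d0: "0 \<le> d k" if "k \<in> I" for k using d that by (simp add: rep_def)
    have epos: "k = x \<or> 0 < d k" if "k \<in> I" "0 < e k" for k
      using that y(2) d0 by (auto simp: e_def zero_less_mult_iff split: if_splits)
    have "rep e z" unfolding rep_def cliq_def
    proof (intro conjI ballI)
      show "0 \<le> e k" if "k \<in> I" for k using that d0 y by (simp add: e_def)
      show "coh k l" if "k \<in> {i\<in>I. 0 < e i}" "l \<in> {i\<in>I. 0 < e i}" for k l
      proof -
        have "coh k l" if "0 < d k" "0 < d l"
          using d that \<open>k \<in> _\<close> \<open>l \<in> _\<close> by (auto simp: rep_def cliq_def)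
        then show ?thesis using epos[of k] epos[of l] that cx coh_sym coh_refl V by blast
      qed
      have "(\<Sum>k\<in>I. e k *\<^sub>R g k) = (\<Sum>k\<in>I. (if k = x then (1 - u) *\<^sub>R g x else 0)) + u *\<^sub>R (\<Sum>k\<in>I. d k *\<^sub>R g k)"
        unfolding scaleR_sum_right sum.distrib[symmetric] e_def
        by (intro sum.cong) (auto simp: algebra_simps)
      then show "(\<Sum>k\<in>I. e k *\<^sub>R g k) = z"
        using finite_I V d y(4) by (simp add: rep_def)
    qed auto
    then have "c i = e i" using rep_unique snoc.prems by blast
    then have "i = x \<or> 0 < d i" using epos snoc.prems by simp
    then show ?thesis using dF snoc.prems 2(6) by (auto simp: hull_inc)
  qed
qed

section \<open>From legal sequences to the fan triangulation\<close>

lemma cells_cover: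
  assumes "set V \<subseteq> I" shows "convex hull points \<subseteq> \<Union>(cells V)"
  using assms
proof (induction V rule: rev_induct)
  case Nil
  have "convex hull points \<subseteq> \<Union>{convex hull (insert 0 F) | F. F facet_of (convex hull points) \<and> 0 \<notin> F}"
  proof (rule facets_seen_from_point_cover)
    show "polytope (convex hull points)" unfolding polytope_def using points_finite by blast
    show "0 \<in> convex hull points" by (simp add: points_def hull_inc)
  qed (simp add: aff_dim_points)
  also have "\<dots> \<subseteq> \<Union>(cells [])"
    by (auto simp: cells_def pull_def points_def hull_inc)
  finally show ?case .
next
  case (snoc i V)
  have "S \<subseteq> \<Union>(cells (V @ [i]))" if S: "S \<in> cells V" for S
  proof (cases "g i \<in> S")
    case True
    have pc: "proper_cell S" using cells_proper[of V S] snoc.prems S by simp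
    then have "S \<subseteq> \<Union>{convex hull (insert (g i) F) | F. F facet_of S \<and> g i \<notin> F}"
      using True by (intro facets_seen_from_point_cover) (auto simp: proper_cell_polytope proper_cell_def)
    also have "\<dots> \<subseteq> \<Union>(cells (V @ [i]))" unfolding cells_snoc pull_def using S True by blast
    finally show ?thesis .
  next
    case False
    then show ?thesis using S unfolding cells_snoc pull_def by blast
  qed
  then have "\<Union>(cells V) \<subseteq> \<Union>(cells (V @ [i]))" by blast
  moreover have "convex hull points \<subseteq> \<Union>(cells V)" using snoc by simp
  ultimately show ?case by blast
qed

text \<open>A cell containing a point with positive weight on every member of \<open>M\<close>
  contains all of \<open>M\<close> by \<open>support_in_cell\<close>.\<close>

lemma max_cliq_in_cell:
  assumes V: "set V \<subseteq> I" "legal_seq V" and M: "max_cliq M"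
  shows "\<exists>S\<in>cells V. simplex_of M \<subseteq> S"
proof -
  have MI: "M \<subseteq> I" "cliq M" using M by (auto simp: max_cliq_def cliq_def)
  then have finM: "finite M" using finite_I finite_subset by blast
  \<comment> \<open>One more part than members leaves a positive weight for the origin and covers
    \<open>M = {}\<close>.\<close>
  define t where "t = 1 / (1 + real (card M))"
  define c where "c i = (if i \<in> M then t else 0)" for i
  define z where "z = (\<Sum>i\<in>I. c i *\<^sub>R g i)"
  have t: "t > 0" "real (card M) * t \<le> 1" by (auto simp: t_def field_simps)
  have M_eq: "{i \<in> I. 0 < c i} = M" using MI t by (auto simp: c_def)
  have rz: "rep c z" unfolding rep_def M_eq using MI t by (auto simp: c_def z_def)
  have zM: "z = (\<Sum>i\<in>M. t *\<^sub>R g i)" unfolding z_def c_def using MI finite_I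
    by (simp add: if_distrib[where f = "\<lambda>r. r *\<^sub>R _"] sum.inter_restrict[symmetric] Int_absorb1 cong: if_cong)
  have "z = (1 - real (card M) * t) *\<^sub>R 0 + (\<Sum>i\<in>M. t *\<^sub>R g i)" using zM by simp
  have "(\<Sum>m\<in>insert None (Some ` M). (case m of None \<Rightarrow> 1 - real (card M) * t | Some i \<Rightarrow> t) *\<^sub>R
      (case m of None \<Rightarrow> 0 | Some i \<Rightarrow> g i)) \<in> convex hull points"
    using MI finM t
    by (intro convex_sum) (auto simp: sum.reindex points_def hull_inc)
  then have "z \<in> convex hull points" using finM zM by (simp add: sum.reindex)
  then obtain S where S: "S \<in> cells V" "z \<in> S" using cells_cover V by blast
  have "g i \<in> S" if "i \<in> M" for i
    using support_in_cell[OF V S rz] that MI t by (auto simp: c_def)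
  moreover have "0 \<in> S" "convex S" using cells_proper[OF V(1) S(1)] proper_cell_zero proper_cell_convex by auto
  ultimately have "simplex_of M \<subseteq> S" unfolding simplex_of_def by (intro hull_minimal) auto
  then show ?thesis using S by blast
qed

theorem legal_imp_refined: "set V \<subseteq> I \<Longrightarrow> legal_seq V \<Longrightarrow> refined_by (cells V) fan_cells"
  unfolding refined_by_def fan_cells_def using max_cliq_in_cell by blast

lemma simplex_of_inj:
  assumes "M \<subseteq> I" "N \<subseteq> I" "simplex_of M \<subseteq> simplex_of N"
  shows "M \<subseteq> N"
proof
  fix i assume i: "i \<in> M"
  then have "g i \<in> simplex_of N" "i \<in> I" using assms fan_cell_refl by blast+
  moreover have "simplex_of N \<subseteq> convex hull points"
    unfolding simplex_of_def points_def using assms by (intro hull_mono) auto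
  ultimately have "g i extreme_point_of (simplex_of N)"
    using extreme_point_mono extreme_point_polytope by blast
  then have "g i \<in> insert 0 (g ` N)" unfolding simplex_of_def by (rule extreme_point_of_convex_hull)
  then show "i \<in> N" using \<open>i \<in> I\<close> g_ne_0 g_inj assms by (metis image_iff insertE subsetD)
qed

text \<open>Full dimension makes the vectors of \<open>J\<close> span. A further member
  \<open>t\<close> of a larger clique would then satisfy a linear relation with \<open>J\<close>,
  and moving the negative coefficients to the side of \<open>t\<close> gives two different clique
  representations of one vector.\<close>

lemma proper_cell_cliq:
  assumes S: "proper_cell S" and J: "J = {i \<in> I. g i \<in> S}" and "cliq J"
  shows "S = simplex_of J" "max_cliq J"
proof -
  obtain X where X: "X \<subseteq> points" "S = convex hull X" using S unfolding proper_cell_def by blast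
  have "X \<subseteq> insert 0 (g ` J)" using X by (auto simp: J points_def hull_inc)
  then have "S \<subseteq> simplex_of J" unfolding simplex_of_def X by (rule hull_mono)
  moreover have "simplex_of J \<subseteq> S" unfolding simplex_of_def
    using proper_cell_zero[OF S] proper_cell_convex[OF S] by (intro hull_minimal) (auto simp: J)
  ultimately show SJ: "S = simplex_of J" by blast
  have "dim (insert 0 (g ` J)) = DIM('b)"
  proof -
    have "aff_dim S = aff_dim (insert 0 (g ` J))" by (simp add: SJ simplex_of_def aff_dim_convex_hull)
    also have "\<dots> = dim (insert 0 (g ` J))" by (rule aff_dim_zero) (simp add: hull_inc)
    finally show ?thesis using S unfolding proper_cell_def by simp
  qed
  then have span: "span (g ` J) = UNIV" by (metis dim_eq_full span_insert_0)
  have "t \<in> J" if K: "cliq K" "J \<subseteq> K" "t \<in> K" for K t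
  proof (rule ccontr)
    assume t: "t \<notin> J"
    have KI: "K \<subseteq> I" "J \<subseteq> I" "finite J" using K finite_I by (auto simp: cliq_def J)
    have "g t \<in> span (g ` J)" using span by simp
    then obtain a where "g t = (\<Sum>x\<in>g ` J. a x *\<^sub>R x)" using span_finite[of "g ` J"] KI by auto
    also have "\<dots> = (\<Sum>j\<in>J. a (g j) *\<^sub>R g j)"
      using g_inj KI by (subst sum.reindex) (auto simp: inj_on_def)
    finally have gt: "g t = (\<Sum>j\<in>J. a (g j) *\<^sub>R g j)" .
    define c where "c i = (if i = t then 1 else if i \<in> J then max 0 (- a (g i)) else 0)" for i
    define d where "d i = (if i \<in> J then max 0 (a (g i)) else 0)" for i
    have tI: "t \<in> I" using K KI by blast
    have "c t = d t"
    proof (rule unique[of c d])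
      show "coh i j" if "i \<in> I" "j \<in> I" "0 < c i" "0 < c j" for i j
      proof -
        have "i \<in> K" "j \<in> K" using that K by (auto simp: c_def split: if_splits)
        then show ?thesis using K by (auto simp: cliq_def)
      qed
      show "coh i j" if "i \<in> I" "j \<in> I" "0 < d i" "0 < d j" for i j
      proof -
        have "i \<in> K" "j \<in> K" using that K by (auto simp: d_def split: if_splits)
        then show ?thesis using K by (auto simp: cliq_def)
      qed
      have "(\<Sum>i\<in>I. c i *\<^sub>R g i) = (\<Sum>i\<in>I. (if i = t then g t else 0)) +
          (\<Sum>i\<in>I. if i \<in> J then max 0 (- a (g i)) *\<^sub>R g i else 0)"
        unfolding sum.distrib[symmetric] c_def using t by (intro sum.cong) auto
      also have "\<dots> = g t + (\<Sum>i\<in>J. max 0 (- a (g i)) *\<^sub>R g i)"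
        using finite_I tI KI by (simp add: sum.inter_restrict[symmetric] Int_absorb1)
      also have "\<dots> = (\<Sum>i\<in>J. max 0 (a (g i)) *\<^sub>R g i)"
        unfolding gt sum.distrib[symmetric] scaleR_left_distrib[symmetric]
        by (intro sum.cong) (auto simp: max_def)
      also have "\<dots> = (\<Sum>i\<in>I. d i *\<^sub>R g i)"
        unfolding d_def using finite_I KI
        by (simp add: if_distrib[where f = "\<lambda>r. r *\<^sub>R _"] sum.inter_restrict[symmetric] Int_absorb1 cong: if_cong)
      finally show "(\<Sum>i\<in>I. c i *\<^sub>R g i) = (\<Sum>i\<in>I. d i *\<^sub>R g i)" .
    qed (auto simp: c_def d_def tI)
    then show False using t by (simp add: c_def d_def)
  qed
  then show "max_cliq J" using \<open>cliq J\<close> unfolding max_cliq_def by blast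
qed

text \<open>An incoherent pair in a cell has a coherent resolution \<open>k, l\<close>. If
  everything has been pulled, \<open>separated\<close> forbids the pair. If the cells are simplices,
  the segment of the pair is a face of the cell, yet its midpoint is represented by
  \<open>k, l\<close> inside the cell, so \<open>g k\<close> would be an end of that
  segment.\<close>

theorem legal_complete_imp_fan_cells:
  assumes V: "set V \<subseteq> I" "legal_seq V" and complete: "I \<subseteq> set V \<or> triangulation (cells V)"
  shows "cells V = fan_cells"
proof -
  have cl: "cliq {i \<in> I. g i \<in> S}" if S: "S \<in> cells V" for S
    unfolding cliq_def
  proof (intro conjI ballI)
    fix i j assume "i \<in> {i \<in> I. g i \<in> S}" "j \<in> {i \<in> I. g i \<in> S}"
    then have ij: "i \<in> I" "j \<in> I" "g i \<in> S" "g j \<in> S" by auto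
    have pc: "proper_cell S" using cells_proper V S by blast
    show "coh i j"
    proof (rule ccontr)
      assume inc: "\<not> coh i j"
      then obtain k l where kl: "k \<in> I" "l \<in> I" "coh k l" "g i + g j = g k + g l"
        using resolve[OF ij(1,2)] proper_cell_no_short_sum[OF pc ij] by blast
      show False
      proof (cases "I \<subseteq> set V")
        case True
        then have "k \<in> set V \<or> l \<in> set V" using kl by blast
        then show False using separated[OF V ij(1,2) kl(1,2) inc kl(3,4) _ S ij(3,4)] by blast
      next
        case False
        then obtain n where "n simplex S" using complete S unfolding triangulation_def by blast
        then obtain C where C: "\<not> affine_dependent C" "S = convex hull C"
          unfolding simplex_def by blast
        have ext: "x \<in> C" if "x \<in> points" "x \<in> S" for x
          using proper_cell_extreme[OF pc that] C extreme_point_of_convex_hull by blast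
        have gi: "g i \<in> C" "g j \<in> C" using ext ij by (auto simp: points_def)
        let ?m = "(1/2) *\<^sub>R (g i + g j)"
        have fc: "convex hull {g i, g j} face_of S"
          unfolding C(2) face_of_convex_hull_affine_independent[OF C(1)]
          using gi by (intro exI[of _ "{g i, g j}"]) simp
        have mS: "?m \<in> S" using ij proper_cell_convex[OF pc] by (intro midpoint_in_convex)
        have mc: "?m \<in> convex hull {g i, g j}" by (intro midpoint_in_convex) (auto simp: hull_inc)
        \<comment> \<open>The two halves add up to 1 when \<open>k = l\<close>.\<close>
        define c where "c x = (if x = k then 1/2 else 0) + (if x = l then 1/2 else 0 :: real)" for x
        have "(\<Sum>x\<in>I. c x *\<^sub>R g x) = (\<Sum>x\<in>I. if x = k then (1/2) *\<^sub>R g k else 0) +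
          (\<Sum>x\<in>I. if x = l then (1/2) *\<^sub>R g l else 0)"
          unfolding sum.distrib[symmetric] c_def by (intro sum.cong) (auto simp: algebra_simps)
        also have "\<dots> = (1/2) *\<^sub>R (g k + g l)" using kl finite_I by (simp add: scaleR_add_right)
        finally have "rep c ?m" unfolding rep_def cliq_def kl(4)
          using kl coh_refl coh_sym by (auto simp: c_def split: if_splits)
        then have klS: "g k \<in> S" "g l \<in> S"
          using support_in_cell[OF V S mS, of c] kl by (auto simp: c_def)
        have "(1/2) *\<^sub>R (g k + g l) \<in> convex hull {g i, g j}" using mc kl(4) by simp
        then have "g k \<in> convex hull {g i, g j}"
          using face_of_midpoint[OF fc klS] by blast
        moreover have "g k extreme_point_of S" using proper_cell_extreme[OF pc _ klS(1)] kl by (simp add: points_def)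
        ultimately have "g k extreme_point_of (convex hull {g i, g j})"
          using extreme_point_mono face_of_imp_subset[OF fc] by blast
        then have "g k \<in> {g i, g j}" by (rule extreme_point_of_convex_hull)
        then have "k = i \<or> k = j" using g_inj kl ij by blast
        then show False using resolved_distinct[OF ij(1,2) kl(1,2) inc kl(3,4)] by blast
      qed
    qed
  qed auto
  have inF: "S = simplex_of {i \<in> I. g i \<in> S} \<and> max_cliq {i \<in> I. g i \<in> S}" if "S \<in> cells V" for S
    using proper_cell_cliq[OF cells_proper[OF V(1) that] refl cl[OF that]] by blast
  show ?thesis
  proof
    show "cells V \<subseteq> fan_cells" unfolding fan_cells_def using inF by blast
    show "fan_cells \<subseteq> cells V"
    proof
      fix T assume "T \<in> fan_cells"
      then obtain M where M: "max_cliq M" "T = simplex_of M" unfolding fan_cells_def by blast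
      obtain S where S: "S \<in> cells V" "simplex_of M \<subseteq> S" using max_cliq_in_cell[OF V M(1)] by blast
      let ?J = "{i \<in> I. g i \<in> S}"
      have J: "S = simplex_of ?J" "max_cliq ?J" using inF[OF S(1)] by blast+
      have "M \<subseteq> ?J" using simplex_of_inj[of M ?J] S(2) J(1) M J(2)
        by (metis cliq_def max_cliq_def)
      then have "?J = M" using M J unfolding max_cliq_def by blast
      then show "T \<in> cells V" using J S M by simp
    qed
  qed
qed

text \<open>A resolution \<open>x, y\<close> that is not itself coherent still behaves like one if two further
  exchanges link it to the history of the sequence.\<close>

lemma legal_seq_linked:
  assumes leg: "legal_seq V" and I: "z \<in> I" "w \<in> I" "s \<in> I" "t \<in> I" "x \<in> I" "y \<in> I"
    and z: "z \<in> set V" "\<not> coh z s" "coh y w" "g z + g s = g y + g w"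
    and w: "\<not> coh w t" "coh z x" "g w + g t = g z + g x"
  shows "x \<in> set V \<or> y \<in> set V"
proof (rule ccontr)
  assume no: "\<not> ?thesis"
  obtain V1 V2 where V: "V = V1 @ z # V2" "z \<notin> set V1" using z(1) split_list_first by metis
  have "legal_seq (V1 @ [z])" using leg V legal_seq_prefix[of "V1 @ [z]" V2] by simp
  then have l1: "legal_seq V1" "legal (set V1) z" by (auto simp: legal_seq_snoc)
  \<comment> \<open>Legality of \<open>z\<close> puts \<open>w\<close> before the first
    \<open>z\<close>, as \<open>y\<close> is never pulled. Legality of \<open>w\<close> then
    requires \<open>z\<close> or \<open>x\<close> still earlier, and both are impossible.\<close>
  then have "w \<in> set V1" using z no I V unfolding legal_def by auto
  then show False using legal_seq_mem[OF l1(1) _ I(4) I(1) I(5) w] V no by auto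
qed

end

section \<open>Arcs on legs\<close>

text \<open>A route of \<open>Path\<close> or \<open>Cycle\<close> is coded by a triple \<open>(j, p, q)\<close>: its leg \<open>j\<close>, whose inner
  vertices are the positions \<open>lo j, \<dots>, hi j\<close>, and the lowest and highest position at which it turns;
  \<open>p = lo j - 1\<close> and \<open>q = hi j + 1\<close> stand for the absence of such a turn. The g-vector is then
  \<open>e\<^sub>q - e\<^sub>p\<close>, for either direction of the leg.\<close>

locale arc_system =
  fixes L :: "nat set" and lo hi vtx :: "nat \<Rightarrow> nat" and okt okh :: "nat \<Rightarrow> nat \<Rightarrow> bool"
    and N :: "nat set" and ax :: "nat \<Rightarrow> 'n::finite"
  assumes finite_L: "finite L"
    and lo_pos: "j \<in> L \<Longrightarrow> 0 < lo j"
    and okt: "okt j p \<Longrightarrow> j \<in> L \<and> lo j \<le> p \<and> p \<le> hi j \<and> vtx p \<in> N"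
    and okh: "okh j q \<Longrightarrow> j \<in> L \<and> lo j \<le> q \<and> q \<le> hi j \<and> vtx q \<in> N"
    and tail_unique: "okt j p \<Longrightarrow> okt j' p' \<Longrightarrow> vtx p = vtx p' \<Longrightarrow> j = j' \<and> p = p'"
    and head_unique: "okh j q \<Longrightarrow> okh j' q' \<Longrightarrow> vtx q = vtx q' \<Longrightarrow> j = j' \<and> q = q'"
    and head_tail: "okh j q \<Longrightarrow> okt j' p \<Longrightarrow> vtx q = vtx p \<Longrightarrow>
      if j = j' then q = p else q = hi j \<and> p = lo j'"
    and tail_exists: "v \<in> N \<Longrightarrow> \<exists>j p. okt j p \<and> vtx p = v"
    and head_exists: "v \<in> N \<Longrightarrow> \<exists>j q. okh j q \<and> vtx q = v"
    and ax: "bij_betw ax N UNIV"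
begin

text \<open>\<open>okt\<close> and \<open>okh\<close> single out where a vertex may be a tail or a
  head. At a junction of two legs a vertex is a head only as the high end of one and a tail only as
  the low end of the other, so each coordinate has one tail place and one head place.\<close>

definition arcs :: "(nat \<times> nat \<times> nat) set" where
  "arcs = {(j, p, q). j \<in> L \<and> (p = lo j - 1 \<or> okt j p) \<and> (q = hi j + 1 \<or> okh j q) \<and>
     p < q \<and> \<not> (p = lo j - 1 \<and> q = hi j + 1)}"

fun hv tv :: "nat \<times> nat \<times> nat \<Rightarrow> nat option" where
  "hv (j, p, q) = (if q \<le> hi j then Some (vtx q) else None)"
| "tv (j, p, q) = (if lo j \<le> p then Some (vtx p) else None)"

definition ev :: "nat option \<Rightarrow> real ^ 'n" where
  "ev u = (case u of None \<Rightarrow> 0 | Some v \<Rightarrow> axis (ax v) 1)"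

definition gv :: "nat \<times> nat \<times> nat \<Rightarrow> real ^ 'n" where
  "gv c = ev (hv c) - ev (tv c)"

text \<open>On one leg the contact \<open>p' = q\<close> counts as a crossing as well: head and tail
  cancel at that vertex.\<close>

fun cross :: "nat \<times> nat \<times> nat \<Rightarrow> nat \<times> nat \<times> nat \<Rightarrow> bool" where
  "cross (j, p, q) (j', p', q') \<longleftrightarrow>
     (if j = j' then p < p' \<and> p' \<le> q \<and> q < q' \<or> p' < p \<and> p \<le> q' \<and> q' < q
      else hv (j, p, q) = tv (j', p', q') \<and> hv (j, p, q) \<noteq> None \<or>
           hv (j', p', q') = tv (j, p, q) \<and> tv (j, p, q) \<noteq> None)"

definition coh :: "nat \<times> nat \<times> nat \<Rightarrow> nat \<times> nat \<times> nat \<Rightarrow> bool" where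
  "coh c d \<longleftrightarrow> \<not> cross c d"

section \<open>Ends of arcs and supporting functionals\<close>

lemma cross_sym: "cross c d \<Longrightarrow> cross d c"
  by (cases c; cases d) (auto split: if_splits)

lemma arcsE:
  assumes "(j, p, q) \<in> arcs"
  shows "j \<in> L" "p < q" "lo j \<le> p \<Longrightarrow> okt j p" "q \<le> hi j \<Longrightarrow> okh j q" "p < lo j \<Longrightarrow> p = lo j - 1"
    "hi j < q \<Longrightarrow> q = hi j + 1" "lo j \<le> p \<or> q \<le> hi j" "lo j - 1 \<le> p" "q \<le> hi j + 1" "p \<le> hi j" "lo j \<le> q"
proof -
  show "j \<in> L" "p < q" using assms by (auto simp: arcs_def)
  then have "0 < lo j" using lo_pos by blast
  then show "lo j \<le> p \<Longrightarrow> okt j p" "q \<le> hi j \<Longrightarrow> okh j q" "p < lo j \<Longrightarrow> p = lo j - 1"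
    "hi j < q \<Longrightarrow> q = hi j + 1" "lo j \<le> p \<or> q \<le> hi j" "lo j - 1 \<le> p" "q \<le> hi j + 1" "p \<le> hi j" "lo j \<le> q"
    using assms okt okh by (auto simp: arcs_def dest!: okt okh)
qed

lemma arcsI:
  assumes "j \<in> L" "p = lo j - 1 \<or> okt j p" "q = hi j + 1 \<or> okh j q" "p < q" "lo j \<le> p \<or> q \<le> hi j"
  shows "(j, p, q) \<in> arcs"
  using assms lo_pos[of j] by (auto simp: arcs_def)

lemma finite_arcs: "finite arcs"
proof -
  let ?m = "Max (hi ` L) + 1"
  have "arcs \<subseteq> L \<times> {..?m} \<times> {..?m}"
  proof
    fix c assume c: "c \<in> arcs"
    obtain j p q where [simp]: "c = (j, p, q)" by (cases c)
    have "hi j \<le> Max (hi ` L)" using arcsE[of j p q] c finite_L by (intro Max_ge) auto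
    then show "c \<in> L \<times> {..?m} \<times> {..?m}" using arcsE[of j p q] c by auto
  qed
  then show ?thesis using finite_L finite_subset by blast
qed

lemma tvE:
  assumes "c \<in> arcs" "tv c = Some v"
  obtains j p q where "c = (j, p, q)" "okt j p" "vtx p = v" "lo j \<le> p"
  using assms arcsE by (cases c) (auto split: if_splits)

lemma hvE:
  assumes "c \<in> arcs" "hv c = Some v"
  obtains j p q where "c = (j, p, q)" "okh j q" "vtx q = v" "q \<le> hi j"
  using assms arcsE by (cases c) (auto split: if_splits)

lemma hv_tv_N: "c \<in> arcs \<Longrightarrow> hv c = Some v \<or> tv c = Some v \<Longrightarrow> v \<in> N"
  using okt okh hvE[of c v] tvE[of c v] by metis

lemma hv_ne_tv:
  assumes "c \<in> arcs" shows "hv c \<noteq> tv c"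
proof -
  obtain j p q where c: "c = (j, p, q)" by (cases c)
  show ?thesis using arcsE[OF assms[unfolded c]] head_tail[of j q j p] unfolding c by auto
qed

lemma arc_eqI:
  assumes "c \<in> arcs" "d \<in> arcs" "hv c = hv d" "tv c = tv d"
  shows "c = d"
proof -
  obtain j p q j' p' q' where cd: "c = (j, p, q)" "d = (j', p', q')" by (cases c; cases d)
  note C = arcsE[OF assms(1)[unfolded cd]] and D = arcsE[OF assms(2)[unfolded cd]]
  have "j = j'"
    using C(3,4,7) D(3,4) assms(3,4) tail_unique head_unique unfolding cd
    by (auto split: if_splits)
  then show ?thesis
    using C D assms(3,4) tail_unique[of j p j p'] head_unique[of j q j q'] unfolding cd
    by (auto split: if_splits)
qed

lemma touch_cross:
  assumes "c \<in> arcs" "d \<in> arcs" "hv c = Some v" "tv d = Some v"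
  shows "cross c d"
proof -
  obtain j p q where c: "c = (j, p, q)" "okh j q" "vtx q = v" "q \<le> hi j" using hvE assms by metis
  obtain j' p' q' where d: "d = (j', p', q')" "okt j' p'" "vtx p' = v" "lo j' \<le> p'" using tvE assms by metis
  show ?thesis
  proof (cases "j = j'")
    case True
    then have "q = p'" using head_tail c d by metis
    then show ?thesis using True arcsE[of j p q] arcsE[of j' p' q'] assms c d by auto
  next
    case False
    then show ?thesis using assms c d by simp
  qed
qed

text \<open>A potential on the vertices and on the extra point \<open>None\<close>, made into a
  functional on vectors that lack the \<open>None\<close> coordinate. Only differences of the
  potential matter, so it is normalised to vanish at \<open>None\<close>.\<close>

definition fnl :: "(nat option \<Rightarrow> real) \<Rightarrow> real ^ 'n" where
  "fnl \<phi> = (\<chi> i. \<phi> (Some (inv_into N ax i)) - \<phi> None)"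

lemma fnl_gv:
  assumes "c \<in> arcs" shows "fnl \<phi> \<bullet> gv c = \<phi> (hv c) - \<phi> (tv c)"
proof -
  have "fnl \<phi> \<bullet> ev u = \<phi> u - \<phi> None" if "\<And>v. u = Some v \<Longrightarrow> v \<in> N" for u
    using that ax by (cases u) (auto simp: ev_def fnl_def inner_axis bij_betw_def inv_into_f_f)
  then show ?thesis using hv_tv_N[OF assms] by (auto simp: gv_def inner_diff_right)
qed

lemma gv_nth:
  assumes "c \<in> arcs" "v \<in> N"
  shows "gv c $ ax v = of_bool (hv c = Some v) - of_bool (tv c = Some v)"
proof -
  have "ev u $ ax v = of_bool (u = Some v)" if "\<And>v. u = Some v \<Longrightarrow> v \<in> N" for u
    using that assms ax by (cases u) (auto simp: ev_def axis_def bij_betw_def inj_on_def)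
  then show ?thesis using hv_tv_N[OF assms(1)] by (auto simp: gv_def)
qed

text \<open>The functional is the inner product with the arc in the embedding of all arcs as roots of
  type A, where \<open>None\<close> is an additional coordinate.\<close>

lemma arcs_exposed:
  assumes "c \<in> arcs"
  shows "\<exists>f. 0 < f \<bullet> gv c \<and> (\<forall>k\<in>arcs. k \<noteq> c \<longrightarrow> f \<bullet> gv k < f \<bullet> gv c)"
proof -
  let ?\<phi> = "\<lambda>u. of_bool (u = hv c) - of_bool (u = tv c) :: real"
  have "fnl ?\<phi> \<bullet> gv c = 2" using fnl_gv[OF assms, of ?\<phi>] hv_ne_tv[OF assms] by auto
  moreover have "fnl ?\<phi> \<bullet> gv k < 2" if "k \<in> arcs" "k \<noteq> c" for k
  proof -
    have "hv k \<noteq> hv c \<or> tv k \<noteq> tv c" using arc_eqI that assms by blast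
    then show ?thesis using fnl_gv[OF that(1), of ?\<phi>] hv_ne_tv[OF assms] by auto
  qed
  ultimately show ?thesis by (intro exI[of _ "fnl ?\<phi>"]) auto
qed

text \<open>The functional takes the values 0 and 1 at tails and heads of \<open>K\<close>, lowered by 1 on each leg from
  its first unmatched tail onward.\<close>

lemma arcs_supported:
  assumes K: "K \<subseteq> arcs" "\<And>c d. c \<in> K \<Longrightarrow> d \<in> K \<Longrightarrow> coh c d"
  shows "\<exists>f. (\<forall>c\<in>arcs. f \<bullet> gv c \<le> 1) \<and> (\<forall>c\<in>K. f \<bullet> gv c = 1)"
proof -
  define blocked where "blocked j x \<longleftrightarrow> (\<exists>u. (j, u, hi j + 1) \<in> K \<and> u \<le> x)" for j x
  define up where "up v \<longleftrightarrow> (\<exists>j p q. (j, p, q) \<in> K \<and> okh j q \<and> vtx q = v \<and> \<not> blocked j q)" for v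
  define down where "down v \<longleftrightarrow> (\<exists>j p q. (j, p, q) \<in> K \<and> okt j p \<and> vtx p = v \<and> blocked j p)" for v
  let ?\<phi> = "\<lambda>u. case u of None \<Rightarrow> 0 | Some v \<Rightarrow> (if up v then 1 else if down v then -1 else (0 :: real))"
  have nocross: "\<not> cross c d" if "c \<in> K" "d \<in> K" for c d using K(2) that by (auto simp: coh_def)
  have notouch: False if "c \<in> K" "d \<in> K" "hv c = Some v" "tv d = Some v" for c d v
    using touch_cross[of c d v] nocross that K by blast
  have le: "fnl ?\<phi> \<bullet> gv c \<le> 1" if c: "c \<in> arcs" for c
  proof -
    obtain j p q where [simp]: "c = (j, p, q)" by (cases c)
    note C = arcsE[OF c[simplified]]
    \<comment> \<open>The potential takes values in -1, 0, 1, so only an unblocked head above a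
      blocked tail could give 2. Blocking persists upward along a leg.\<close>
    have "\<not> (up (vtx q) \<and> down (vtx p))" if "q \<le> hi j" "lo j \<le> p"
    proof
      assume "up (vtx q) \<and> down (vtx p)"
      then obtain j1 p1 q1 j2 p2 q2 where
        1: "okh j1 q1" "vtx q1 = vtx q" "\<not> blocked j1 q1" and
        2: "okt j2 p2" "vtx p2 = vtx p" "blocked j2 p2" unfolding up_def down_def by blast
      have "j1 = j" "q1 = q" using head_unique[OF 1(1) C(4)[OF that(1)] 1(2)] by auto
      moreover have "j2 = j" "p2 = p" using tail_unique[OF 2(1) C(3)[OF that(2)] 2(2)] by auto
      ultimately have "\<not> blocked j q" "blocked j p" using 1 2 by auto
      then show False using C(2) unfolding blocked_def by (meson le_trans less_imp_le)
    qed
    then show ?thesis using fnl_gv[OF c, of ?\<phi>] by auto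
  qed
  have eq: "fnl ?\<phi> \<bullet> gv c = 1" if cK: "c \<in> K" for c
  proof -
    obtain j p q where c: "c = (j, p, q)" by (cases c)
    have cA: "(j, p, q) \<in> arcs" using cK K c by auto
    note C = arcsE[OF cA]
    have up_iff: "up (vtx q) \<longleftrightarrow> \<not> blocked j q" "\<not> down (vtx q)" if "q \<le> hi j"
    proof -
      show "up (vtx q) \<longleftrightarrow> \<not> blocked j q"
        using head_unique[OF C(4)[OF that]] cK c C(4)[OF that] unfolding up_def by metis
      show "\<not> down (vtx q)"
      proof
        assume "down (vtx q)"
        then obtain j' p' q' where d: "(j', p', q') \<in> K" "okt j' p'" "vtx p' = vtx q" unfolding down_def by blast
        show False using notouch[OF cK d(1), of "vtx q"] c that d okt[OF d(2)] by auto
      qed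
    qed
    have down_iff: "down (vtx p) \<longleftrightarrow> blocked j p" "\<not> up (vtx p)" if "lo j \<le> p"
    proof -
      show "down (vtx p) \<longleftrightarrow> blocked j p"
        using tail_unique[OF C(3)[OF that]] cK c C(3)[OF that] unfolding down_def by metis
      show "\<not> up (vtx p)"
      proof
        assume "up (vtx p)"
        then obtain j' p' q' where d: "(j', p', q') \<in> K" "okh j' q'" "vtx q' = vtx p" unfolding up_def by blast
        show False using notouch[OF d(1) cK, of "vtx p"] c that d okh[OF d(2)] by auto
      qed
    qed
    have bmono: "blocked j p \<Longrightarrow> blocked j q"
      using C(2) unfolding blocked_def by (meson le_trans less_imp_le)
    \<comment> \<open>A tail \<open>u\<close> of \<open>K\<close> that blocks \<open>q\<close> but
      lies above \<open>p\<close> would start an arc crossing \<open>(j, p, q)\<close>. With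
      \<open>bmono\<close>, the ends of a matched arc are both blocked or both not, and the
      difference is 1 either way.\<close>
    have bl: "blocked j p" if bq: "blocked j q" "q \<le> hi j"
    proof -
      obtain u where u: "(j, u, hi j + 1) \<in> K" "u \<le> q" using bq(1) unfolding blocked_def by blast
      have "\<not> cross (j, p, q) (j, u, hi j + 1)" using nocross[OF cK u(1)] c by simp
      then have "u \<le> p" using u(2) that(2) by simp
      then show ?thesis using u(1) unfolding blocked_def by blast
    qed
    \<comment> \<open>An unmatched tail blocks itself and gets -1 against 0 at \<open>None\<close>;
      by \<open>fin\<close> and \<open>bl\<close> an unmatched head is unblocked and gets 1 against
      0.\<close>
    have inf: "blocked j p" if "hi j < q" using cK c C(6)[OF that] unfolding blocked_def by auto
    have fin: "\<not> blocked j p" if "p < lo j"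
    proof
      assume "blocked j p"
      then obtain u where u: "(j, u, hi j + 1) \<in> K" "u \<le> p" unfolding blocked_def by blast
      then have "(j, u, hi j + 1) \<in> arcs" using K by blast
      from arcsE(7)[OF this] show False using u that by simp
    qed
    have "fnl ?\<phi> \<bullet> gv (j, p, q) = ?\<phi> (hv (j, p, q)) - ?\<phi> (tv (j, p, q))" by (rule fnl_gv[OF cA])
    also have "\<dots> = 1"
      using up_iff down_iff bmono bl inf fin C(7) by (auto simp: not_le)
    finally show ?thesis unfolding c .
  qed
  show ?thesis using le eq by blast
qed

text \<open>Sign compatibility. Arcs compatible with one \<open>x\<close> never meet head to tail,
  so they can cross only by overlapping.\<close>

definition sc :: "real ^ 'n \<Rightarrow> nat \<times> nat \<times> nat \<Rightarrow> bool" where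
  "sc x c \<longleftrightarrow> (\<forall>v. hv c = Some v \<longrightarrow> 0 < x $ ax v) \<and> (\<forall>v. tv c = Some v \<longrightarrow> x $ ax v < 0)"

text \<open>The greedy step of bracket matching: an innermost matched pair if there is one, and an
  unmatched vertex otherwise.\<close>

lemma greedy_arc:
  assumes "x \<noteq> 0"
  shows "\<exists>c\<in>arcs. sc x c \<and> (\<forall>d\<in>arcs. sc x d \<longrightarrow> coh c d)"
proof -
  let ?A = "{(j, p, q). (j, p, q) \<in> arcs \<and> sc x (j, p, q) \<and> lo j \<le> p \<and> q \<le> hi j}"
  have notouch: "\<not> (hv c = tv d \<and> hv c \<noteq> None)" if "sc x c" "sc x d" for c d
    using that unfolding sc_def by (metis not_None_eq order_less_asym)
  show ?thesis
  proof (cases "?A = {}")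
    case False
    define len :: "nat \<times> nat \<times> nat \<Rightarrow> nat" where "len = (\<lambda>(j, p, q). q - p)"
    from False obtain c0 where "c0 \<in> ?A" by blast
    from ex_has_least_nat[of "\<lambda>c. c \<in> ?A", OF this, of len]
    obtain c where c: "c \<in> ?A" and least: "\<And>d. d \<in> ?A \<Longrightarrow> len c \<le> len d" by blast
    obtain j p q where cj: "c = (j, p, q)" by (cases c)
    have cA: "(j, p, q) \<in> arcs" "sc x (j, p, q)" "lo j \<le> p" "q \<le> hi j" using c cj by auto
    note C = arcsE[OF cA(1)]
    have "\<not> cross c d" if d: "d \<in> arcs" "sc x d" for d
    proof
      assume cr: "cross c d"
      obtain j' p' q' where dj: "d = (j', p', q')" by (cases d)
      note D = arcsE[OF d(1)[unfolded dj]]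
      from cr cj dj consider "j' = j" "p < p'" "p' \<le> q" "q < q'" | "j' = j" "p' < p" "p \<le> q'" "q' < q"
        using notouch[OF cA(2) d(2)] notouch[OF d(2) cA(2)] by (auto split: if_splits)
      then show False
      proof cases
        case 1
        then have p': "lo j \<le> p'" using cA by simp
        have "p' \<noteq> q" using notouch[OF cA(2) d(2)] dj p' cA 1 by auto
        \<comment> \<open>The tail of \<open>d\<close> inside \<open>c\<close>, matched with the
          head of \<open>c\<close>, would be a shorter pair.\<close>
        then have "(j, p', q) \<in> ?A" using 1 D C p' cA d(2) dj by (auto intro!: arcsI simp: sc_def)
        from least[OF this] show False using cj 1 \<open>p' \<noteq> q\<close> by (auto simp: len_def)
      next
        case 2
        then have q': "q' \<le> hi j" using cA by simp
        have "p \<noteq> q'" using notouch[OF d(2) cA(2)] dj q' cA 2 by auto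
        then have "(j, p, q') \<in> ?A" using 2 D C q' cA d(2) dj by (auto intro!: arcsI simp: sc_def)
        from least[OF this] show False using cj 2 \<open>p \<noteq> q'\<close> by (auto simp: len_def)
      qed
    qed
    then show ?thesis using cA cj by (auto simp: coh_def)
  next
    case True
    then have none: False if "(j, p, q) \<in> arcs" "sc x (j, p, q)" "lo j \<le> p" "q \<le> hi j" for j p q
      using that by blast
    have "\<exists>i. x $ i \<noteq> 0" using assms by (simp add: vec_eq_iff)
    then obtain v where v: "v \<in> N" "x $ ax v \<noteq> 0" using ax by (metis bij_betw_def imageE UNIV_I)
    consider "0 < x $ ax v" | "x $ ax v < 0" using v by linarith
    then show ?thesis
    proof cases
      case 1
      obtain j q where q: "okh j q" "vtx q = v" using head_exists v by blast
      let ?c = "(j, lo j - 1, q)"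
      note Q = okh[OF q(1)]
      have l0: "0 < lo j" using lo_pos Q by blast
      have cA: "?c \<in> arcs" using q Q l0 by (intro arcsI) auto
      have cs: "sc x ?c" using q 1 Q l0 by (auto simp: sc_def)
      have "\<not> cross ?c d" if d: "d \<in> arcs" "sc x d" for d
      proof
        assume cr: "cross ?c d"
        obtain j' p' q' where dj: "d = (j', p', q')" by (cases d)
        note D = arcsE[OF d(1)[unfolded dj]]
        from cr dj D have 2: "j' = j" "lo j \<le> p'" "p' \<le> q" "q < q'"
          using notouch[OF cs d(2)] notouch[OF d(2) cs] by (auto split: if_splits)
        have "p' \<noteq> q" using notouch[OF cs d(2)] dj 2 Q by auto
        \<comment> \<open>A crossing arc would provide a tail for the head \<open>q\<close>, but no
          matched pair exists in this case.\<close>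
        then have "(j, p', q) \<in> arcs" "sc x (j, p', q)"
          using 2 D Q q d(2) dj 1 by (auto intro!: arcsI simp: sc_def)
        then show False using none 2 Q by blast
      qed
      then show ?thesis using cA cs by (auto simp: coh_def)
    next
      case 2
      obtain j p where p: "okt j p" "vtx p = v" using tail_exists v by blast
      let ?c = "(j, p, hi j + 1)"
      note P = okt[OF p(1)]
      have cA: "?c \<in> arcs" using p P by (intro arcsI) auto
      have cs: "sc x ?c" using p 2 P by (auto simp: sc_def)
      have "\<not> cross ?c d" if d: "d \<in> arcs" "sc x d" for d
      proof
        assume cr: "cross ?c d"
        obtain j' p' q' where dj: "d = (j', p', q')" by (cases d)
        note D = arcsE[OF d(1)[unfolded dj]]
        from cr dj D have 3: "j' = j" "q' \<le> hi j" "p' < p" "p \<le> q'"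
          using notouch[OF cs d(2)] notouch[OF d(2) cs] by (auto split: if_splits)
        have "p \<noteq> q'" using notouch[OF d(2) cs] dj 3 P by auto
        then have "(j, p, q') \<in> arcs" "sc x (j, p, q')"
          using 3 D P p d(2) dj 2 by (auto intro!: arcsI simp: sc_def)
        then show False using none 3 P by blast
      qed
      then show ?thesis using cA cs by (auto simp: coh_def)
    qed
  qed
qed

section \<open>Existence and uniqueness of clique representations\<close>

lemma coh_sym: "coh c d \<Longrightarrow> coh d c"
  using cross_sym coh_def by blast

lemma coh_refl: "coh c c"
  by (cases c) (simp add: coh_def)

text \<open>Subtract the largest multiple of a greedy arc that reverses no sign. At least one
  coordinate vanishes, and arcs compatible with the remainder are compatible with \<open>x\<close>,
  hence coherent with the arc removed.\<close>

lemma arcs_cover_signed: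
  "\<exists>c. (\<forall>i\<in>arcs. 0 \<le> c i) \<and> (\<forall>i\<in>arcs. \<forall>j\<in>arcs. 0 < c i \<longrightarrow> 0 < c j \<longrightarrow> coh i j) \<and>
      (\<Sum>i\<in>arcs. c i *\<^sub>R gv i) = x \<and> (\<forall>i\<in>arcs. 0 < c i \<longrightarrow> sc x i)"
proof (induction "card {i. x $ i \<noteq> 0}" arbitrary: x rule: less_induct)
  case less
  show ?case
  proof (cases "x = 0")
    case True
    then show ?thesis by (intro exI[of _ "\<lambda>_. 0"]) auto
  next
    case False
    then obtain k where k: "k \<in> arcs" "sc x k" "\<And>d. d \<in> arcs \<Longrightarrow> sc x d \<Longrightarrow> coh k d"
      using greedy_arc by blast
    define E where "E = {v. hv k = Some v \<or> tv k = Some v}"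
    have "E = set_option (hv k) \<union> set_option (tv k)" by (auto simp: E_def)
    then have finE: "finite E" by simp
    have neE: "E \<noteq> {}" using hv_ne_tv[OF k(1)] unfolding E_def by (cases "hv k"; cases "tv k") auto
    define \<epsilon> where "\<epsilon> = Min ((\<lambda>v. \<bar>x $ ax v\<bar>) ` E)"
    have \<epsilon>le: "\<epsilon> \<le> \<bar>x $ ax v\<bar>" if "v \<in> E" for v unfolding \<epsilon>_def using finE that by simp
    have "\<epsilon> \<in> (\<lambda>v. \<bar>x $ ax v\<bar>) ` E" unfolding \<epsilon>_def by (rule Min_in) (use finE neE in auto)
    then obtain v0 where v0: "v0 \<in> E" "\<epsilon> = \<bar>x $ ax v0\<bar>" by blast
    have "\<epsilon> > 0" using v0 k(2) unfolding E_def sc_def by force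
    define y where "y = x - \<epsilon> *\<^sub>R gv k"
    have y: "y $ ax v = x $ ax v - \<epsilon> * (of_bool (hv k = Some v) - of_bool (tv k = Some v))" if "v \<in> N" for v
      using gv_nth[OF k(1) that] by (simp add: y_def)
    have sgn: "(0 < y $ ax v \<longrightarrow> 0 < x $ ax v) \<and> (y $ ax v < 0 \<longrightarrow> x $ ax v < 0)" if "v \<in> N" for v
    proof -
      consider "hv k = Some v" "tv k \<noteq> Some v" | "tv k = Some v" "hv k \<noteq> Some v" | "tv k \<noteq> Some v" "hv k \<noteq> Some v"
        using hv_ne_tv[OF k(1)] by metis
      then show ?thesis
      proof cases
        case 1
        then have "x $ ax v > 0" "\<epsilon> \<le> x $ ax v" using k(2) \<epsilon>le[of v] by (auto simp: sc_def E_def)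
        then show ?thesis using y[OF that] 1 by auto
      next
        case 2
        then have "x $ ax v < 0" "\<epsilon> \<le> - x $ ax v" using k(2) \<epsilon>le[of v] by (auto simp: sc_def E_def)
        then show ?thesis using y[OF that] 2 by auto
      next
        case 3
        then show ?thesis using y[OF that] by auto
      qed
    qed
    have sgi: "x $ i \<noteq> 0" if "y $ i \<noteq> 0" for i
    proof -
      obtain v where "v \<in> N" "i = ax v" using ax by (metis bij_betw_def imageE UNIV_I)
      then show ?thesis using sgn[of v] that by (metis linorder_neqE_linordered_idom order_less_irrefl)
    qed
    have v0N: "v0 \<in> N" using v0 hv_tv_N[OF k(1)] by (auto simp: E_def)
    have "y $ ax v0 = 0"
      using y[OF v0N] v0 k(2) hv_ne_tv[OF k(1)] by (auto simp: E_def sc_def)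
    moreover have "x $ ax v0 \<noteq> 0" using v0 \<open>\<epsilon> > 0\<close> by auto
    ultimately have "{i. y $ i \<noteq> 0} \<subset> {i. x $ i \<noteq> 0}" using sgi by blast
    then have "card {i. y $ i \<noteq> 0} < card {i. x $ i \<noteq> 0}" by (intro psubset_card_mono) auto
    from less[OF this] obtain c where c: "\<And>i. i \<in> arcs \<Longrightarrow> 0 \<le> c i"
      "\<And>i j. i \<in> arcs \<Longrightarrow> j \<in> arcs \<Longrightarrow> 0 < c i \<Longrightarrow> 0 < c j \<Longrightarrow> coh i j"
      "(\<Sum>i\<in>arcs. c i *\<^sub>R gv i) = y" "\<And>i. i \<in> arcs \<Longrightarrow> 0 < c i \<Longrightarrow> sc y i" by blast
    have cs: "sc x i" if "i \<in> arcs" "0 < c i" for i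
      using c(4)[OF that] sgn hv_tv_N[OF that(1)] unfolding sc_def by blast
    define d where "d i = c i + (if i = k then \<epsilon> else 0)" for i
    have dpos: "i = k \<or> 0 < c i" if "0 < d i" for i using that by (auto simp: d_def split: if_splits)
    have "(\<Sum>i\<in>arcs. d i *\<^sub>R gv i) = (\<Sum>i\<in>arcs. c i *\<^sub>R gv i) + (\<Sum>i\<in>arcs. if i = k then \<epsilon> *\<^sub>R gv k else 0)"
      unfolding d_def sum.distrib[symmetric] by (intro sum.cong) (auto simp: algebra_simps)
    also have "\<dots> = x" using c(3) k(1) finite_arcs by (simp add: y_def)
    finally have "(\<Sum>i\<in>arcs. d i *\<^sub>R gv i) = x" .
    moreover have "coh i j" if "i \<in> arcs" "j \<in> arcs" "0 < d i" "0 < d j" for i j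
      using dpos[OF that(3)] dpos[OF that(4)] c(2) k cs coh_sym coh_refl that by metis
    moreover have "sc x i" if "i \<in> arcs" "0 < d i" for i using dpos[OF that(2)] cs k that by blast
    moreover have "0 \<le> d i" if "i \<in> arcs" for i using c(1)[OF that] \<open>\<epsilon> > 0\<close> by (simp add: d_def)
    ultimately show ?thesis by (intro exI[of _ d]) blast
  qed
qed

text \<open>Arcs in contact cross, so the positive arcs of a clique never use a vertex both as head
  and as tail; a coordinate therefore determines its head mass and its tail mass separately.\<close>

lemma arcs_balanced:
  assumes c: "\<And>i. i \<in> arcs \<Longrightarrow> 0 \<le> c i" "\<And>i j. i \<in> arcs \<Longrightarrow> j \<in> arcs \<Longrightarrow> 0 < c i \<Longrightarrow> 0 < c j \<Longrightarrow> coh i j"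
    and d: "\<And>i. i \<in> arcs \<Longrightarrow> 0 \<le> d i" "\<And>i j. i \<in> arcs \<Longrightarrow> j \<in> arcs \<Longrightarrow> 0 < d i \<Longrightarrow> 0 < d j \<Longrightarrow> coh i j"
    and eq: "(\<Sum>i\<in>arcs. c i *\<^sub>R gv i) = (\<Sum>i\<in>arcs. d i *\<^sub>R gv i)" and v: "v \<in> N"
  shows "(\<Sum>i | i \<in> arcs \<and> hv i = Some v. c i) = (\<Sum>i | i \<in> arcs \<and> hv i = Some v. d i)"
    "(\<Sum>i | i \<in> arcs \<and> tv i = Some v. c i) = (\<Sum>i | i \<in> arcs \<and> tv i = Some v. d i)"
proof -
  let ?H = "{i \<in> arcs. hv i = Some v}" and ?T = "{i \<in> arcs. tv i = Some v}"
  have expand: "(\<Sum>i\<in>arcs. c i *\<^sub>R gv i) $ ax v = sum c ?H - sum c ?T" for c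
  proof -
    have "(\<Sum>i\<in>arcs. c i *\<^sub>R gv i) $ ax v = (\<Sum>i\<in>arcs. (if hv i = Some v then c i else 0) - (if tv i = Some v then c i else 0))"
      unfolding sum_component using gv_nth[OF _ v] by (intro sum.cong) auto
    then show ?thesis using finite_arcs by (simp add: sum_subtractf sum.inter_filter)
  qed
  have zero: "sum c ?H = 0 \<or> sum c ?T = 0"
    if c: "\<And>i. i \<in> arcs \<Longrightarrow> 0 \<le> c i" "\<And>i j. i \<in> arcs \<Longrightarrow> j \<in> arcs \<Longrightarrow> 0 < c i \<Longrightarrow> 0 < c j \<Longrightarrow> coh i j"
    for c :: "nat \<times> nat \<times> nat \<Rightarrow> real"
  proof (rule ccontr)
    assume "\<not> ?thesis"
    then obtain i j where ij: "i \<in> ?H" "c i \<noteq> 0" "j \<in> ?T" "c j \<noteq> 0"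
      by (metis (no_types, lifting) sum.neutral)
    then have "0 < c i" "0 < c j" using c(1) by (auto simp: less_le)
    then show False using ij touch_cross c(2) coh_def by blast
  qed
  have nn: "0 \<le> sum c ?H" "0 \<le> sum c ?T" "0 \<le> sum d ?H" "0 \<le> sum d ?T"
    using c(1) d(1) by (auto intro!: sum_nonneg)
  have diff: "sum c ?H - sum c ?T = sum d ?H - sum d ?T" using expand[of c] expand[of d] eq by simp
  have alg: "a = a' \<and> b = b'"
    if "a - b = a' - b'" "a = 0 \<or> b = 0" "a' = 0 \<or> b' = 0" "0 \<le> a" "0 \<le> b" "0 \<le> a'" "0 \<le> b'"
    for a b a' b' :: real
    using that by linarith
  have "sum c ?H = sum d ?H \<and> sum c ?T = sum d ?T"
    by (rule alg[OF diff zero[of c, OF c] zero[of d, OF d] nn])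
  then show "sum c ?H = sum d ?H" "sum c ?T = sum d ?T" by auto
qed

lemma sum_eq_exists_less:
  fixes c d :: "'i \<Rightarrow> real"
  assumes "finite A" "sum c A = sum d A" "k \<in> A" "d k < c k"
  shows "\<exists>i\<in>A. c i < d i"
proof (rule ccontr)
  assume "\<not> ?thesis"
  then have "\<forall>i\<in>A. d i \<le> c i" by (auto simp: not_less)
  then have "sum d A < sum c A" using assms by (intro sum_strict_mono_ex1) auto
  then show False using assms by simp
qed

text \<open>An innermost arc with different coefficients forces two crossing arcs in one of the cliques.\<close>

lemma arcs_unique:
  assumes c: "\<And>i. i \<in> arcs \<Longrightarrow> 0 \<le> c i" "\<And>i. i \<in> arcs \<Longrightarrow> 0 \<le> d i"
    "\<And>i j. i \<in> arcs \<Longrightarrow> j \<in> arcs \<Longrightarrow> 0 < c i \<Longrightarrow> 0 < c j \<Longrightarrow> coh i j"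
    "\<And>i j. i \<in> arcs \<Longrightarrow> j \<in> arcs \<Longrightarrow> 0 < d i \<Longrightarrow> 0 < d j \<Longrightarrow> coh i j"
    and eq: "(\<Sum>i\<in>arcs. c i *\<^sub>R gv i) = (\<Sum>i\<in>arcs. d i *\<^sub>R gv i)" and i: "i \<in> arcs"
  shows "c i = d i"
proof -
  \<comment> \<open>One-sided on purpose: it records nonnegativity of \<open>c\<close> and the
    clique condition for \<open>d\<close>, so the argument can be run once more with
    \<open>c\<close> and \<open>d\<close> exchanged.\<close>
  let ?Q = "\<lambda>c d. (\<forall>i\<in>arcs. 0 \<le> c i) \<and> (\<forall>i\<in>arcs. \<forall>j\<in>arcs. 0 < d i \<longrightarrow> 0 < d j \<longrightarrow> coh i j) \<and>
    (\<forall>v\<in>N. (\<Sum>i | i \<in> arcs \<and> hv i = Some v. c i) = (\<Sum>i | i \<in> arcs \<and> hv i = Some v. d i) \<and>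
      (\<Sum>i | i \<in> arcs \<and> tv i = Some v. c i) = (\<Sum>i | i \<in> arcs \<and> tv i = Some v. d i))"
  have Q: "?Q c d" "?Q d c" using c arcs_balanced[OF c(1,3,2,4) eq] by auto
  have head: "\<exists>i\<in>arcs. hv i = Some v \<and> c i < d i"
    if "?Q c d" "k \<in> arcs" "hv k = Some v" "d k < c k" for c d :: "nat \<times> nat \<times> nat \<Rightarrow> real" and k v
  proof -
    have "\<exists>i\<in>{i \<in> arcs. hv i = Some v}. c i < d i"
      by (rule sum_eq_exists_less[of _ c d k]) (use that finite_arcs hv_tv_N[of k v] in auto)
    then show ?thesis by blast
  qed
  have tail: "\<exists>i\<in>arcs. tv i = Some v \<and> c i < d i"
    if "?Q c d" "k \<in> arcs" "tv k = Some v" "d k < c k" for c d :: "nat \<times> nat \<times> nat \<Rightarrow> real" and k v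
  proof -
    have "\<exists>i\<in>{i \<in> arcs. tv i = Some v}. c i < d i"
      by (rule sum_eq_exists_less[of _ c d k]) (use that finite_arcs hv_tv_N[of k v] in auto)
    then show ?thesis by blast
  qed
  have fin: "c (j, p, q) = d (j, p, q)" if "(j, p, q) \<in> arcs" "lo j \<le> p" "q \<le> hi j" for j p q
    using that
  proof (induction "q - p" arbitrary: p q rule: less_induct)
    case less
    have step: False if Q: "?Q c d" "d (j, p, q) < c (j, p, q)"
      and IH: "\<And>p' q'. q' - p' < q - p \<Longrightarrow> (j, p', q') \<in> arcs \<Longrightarrow> lo j \<le> p' \<Longrightarrow> q' \<le> hi j \<Longrightarrow> c (j, p', q') = d (j, p', q')"
      for c d :: "nat \<times> nat \<times> nat \<Rightarrow> real"
    proof -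
      note C = arcsE[OF less.prems(1)]
      \<comment> \<open>The surplus of \<open>c\<close> at \<open>(j, p, q)\<close> is offset by an
        arc with the same tail and one with the same head on which \<open>d\<close> is larger. By
        induction neither is shorter, so one reaches above \<open>q\<close>, the other starts below
        \<open>p\<close>, and they cross within the clique of \<open>d\<close>.\<close>
      obtain k where k: "k \<in> arcs" "tv k = Some (vtx p)" "c k < d k"
        using tail[OF Q(1) less.prems(1) _ Q(2)] less.prems by auto
      obtain j1 p1 q1 where k1: "k = (j1, p1, q1)" "okt j1 p1" "vtx p1 = vtx p" using tvE[OF k(1,2)] by metis
      then have k2: "j1 = j" "p1 = p" using tail_unique[OF k1(2) C(3)] less.prems by auto
      note K = arcsE[OF k(1)[unfolded k1 k2]]
      have "q1 - p < q - p" if "q1 < q" using K that by linarith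
      then have "\<not> q1 < q" using IH[of q1 p] k k1 k2 less.prems C K by auto
      moreover have "q1 \<noteq> q" using k k1 k2 Q(2) by auto
      ultimately have q1: "q < q1" by simp
      obtain l where l: "l \<in> arcs" "hv l = Some (vtx q)" "c l < d l"
        using head[OF Q(1) less.prems(1) _ Q(2)] less.prems by auto
      obtain j2 p2 q2 where l1: "l = (j2, p2, q2)" "okh j2 q2" "vtx q2 = vtx q" using hvE[OF l(1,2)] by metis
      then have l2: "j2 = j" "q2 = q" using head_unique[OF l1(2) C(4)] less.prems by auto
      have "q - p2 < q - p" if "p < p2" using C that by linarith
      then have "\<not> p < p2" using IH[of q p2] l l1 l2 less.prems C arcsE[OF l(1)[unfolded l1 l2]] by auto
      moreover have "p2 \<noteq> p" using l l1 l2 Q(2) by auto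
      ultimately have p2: "p2 < p" by simp
      have "0 < d k" "0 < d l" using k l Q(1) by (smt (verit))+
      then have "coh k l" using Q(1) k l by blast
      then show False using k1 k2 l1 l2 q1 p2 C by (auto simp: coh_def)
    qed
    have "\<not> d (j, p, q) < c (j, p, q)" using step[OF Q(1)] less.hyps by blast
    moreover have "\<not> c (j, p, q) < d (j, p, q)" using step[OF Q(2)] less.hyps by metis
    ultimately show ?case by simp
  qed
  \<comment> \<open>With one end absent, balance at the other end gives an arc with different
    coefficients that shares this end. Being a different arc it has both ends, and that case is
    settled.\<close>
  have gen: False if Q: "?Q c d" "d i < c i"
    and fin: "\<And>j p q. (j, p, q) \<in> arcs \<Longrightarrow> lo j \<le> p \<Longrightarrow> q \<le> hi j \<Longrightarrow> c (j, p, q) = d (j, p, q)"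
    for c d :: "nat \<times> nat \<times> nat \<Rightarrow> real"
  proof -
    obtain j p q where ij: "i = (j, p, q)" by (cases i)
    note C = arcsE[OF i[unfolded ij]]
    consider "lo j \<le> p" "hi j < q" | "p < lo j" "q \<le> hi j" | "lo j \<le> p" "q \<le> hi j" using C(7) by linarith
    then show False
    proof cases
      case 1
      then obtain k where k: "k \<in> arcs" "tv k = tv i" "c k < d k"
        using tail[OF Q(1) i _ Q(2)] ij by auto
      have "hv i = None" using ij 1 by simp
      then have "hv k \<noteq> None" using arc_eqI[OF k(1) i] k Q by force
      then show False using fin k 1 ij by (cases k) (auto split: if_splits)
    next
      case 2
      then obtain k where k: "k \<in> arcs" "hv k = hv i" "c k < d k"
        using head[OF Q(1) i _ Q(2)] ij by auto
      have "tv i = None" using ij 2 by simp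
      then have "tv k \<noteq> None" using arc_eqI[OF k(1) i] k Q by force
      then show False using fin k 2 ij by (cases k) (auto split: if_splits)
    next
      case 3
      then show False using fin i ij Q(2) by auto
    qed
  qed
  have "\<not> d i < c i" using gen[OF Q(1)] fin by blast
  moreover have "\<not> c i < d i" using gen[OF Q(2)] fin by metis
  ultimately show ?thesis by simp
qed

end

section \<open>Pull steps in terms of arcs\<close>

context clique_fan
begin

text \<open>Both sides are clique representations of one vector. The coefficients count
  multiplicity, so \<open>k = l\<close> is covered.\<close>

lemma coherent_sum_unique:
  assumes "k \<in> I" "l \<in> I" "coh k l" "x \<in> I" "y \<in> I" "coh x y" "g k + g l = g x + g y"
  shows "{k, l} = {x, y}"
proof -
  let ?c = "\<lambda>k l i. of_bool (i = k) + of_bool (i = l) :: real"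
  have rep: "rep (?c k l) (g k + g l)" if "k \<in> I" "l \<in> I" "coh k l" for k l
  proof -
    have "(\<Sum>i\<in>I. ?c k l i *\<^sub>R g i) = (\<Sum>i\<in>I. if i = k then g k else 0) + (\<Sum>i\<in>I. if i = l then g l else 0)"
      unfolding sum.distrib[symmetric] by (intro sum.cong) (auto simp: algebra_simps)
    then show ?thesis using that finite_I coh_refl coh_sym by (auto simp: rep_def cliq_def)
  qed
  have eq: "?c k l i = ?c x y i" if "i \<in> I" for i
    using rep_unique[OF rep[OF assms(1-3)] _ that] rep[OF assms(4-6)] assms(7) by metis
  have "i \<in> {k, l} \<longleftrightarrow> i \<in> {x, y}" if "i \<in> I" for i
    using eq[OF that] by (auto simp: of_bool_def split: if_splits)
  then show ?thesis using assms by blast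
qed

text \<open>A functional supporting the clique takes the value 2 at the sum, but 0 at the origin and
  at most 1 at every generator.\<close>

lemma coherent_sum_not_short:
  assumes "k \<in> I" "l \<in> I" "coh k l"
  shows "g k + g l \<noteq> 0" "x \<in> I \<Longrightarrow> g k + g l \<noteq> g x"
proof -
  have "coh i j" if "i \<in> {k, l}" "j \<in> {k, l}" for i j
    using that assms coh_refl coh_sym by blast
  then obtain f where f: "\<And>i. i \<in> I \<Longrightarrow> f \<bullet> g i \<le> 1" "f \<bullet> g k = 1" "f \<bullet> g l = 1"
    using supported[of "{k, l}"] assms by auto
  then have "f \<bullet> (g k + g l) = 2" by (simp add: inner_add_right)
  then show "g k + g l \<noteq> 0" "x \<in> I \<Longrightarrow> g k + g l \<noteq> g x" using f(1)[of x] by auto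
qed

end

context arc_system
begin

definition adj :: "nat \<Rightarrow> nat \<Rightarrow> bool" where
  "adj j j' \<longleftrightarrow> j \<noteq> j' \<and> okh j (hi j) \<and> okt j' (lo j') \<and> vtx (hi j) = vtx (lo j')"

text \<open>For a route on an odd leg, \<open>narrow_high\<close>, \<open>widen_low\<close>, \<open>widen_high\<close> and \<open>narrow_low\<close> are the boxes to
  the west, north, east and south; on an even leg, to the north, west, south and east. If
  \<open>p = lo j - 1\<close>, some boxes of the neighbouring leg are missing in \<open>narrow_high\<close>, but then \<open>widen_low\<close> is
  empty; likewise for \<open>narrow_low\<close> and \<open>widen_high\<close>.\<close>

fun widen_high narrow_high widen_low narrow_low :: "nat \<times> nat \<times> nat \<Rightarrow> (nat \<times> nat \<times> nat) set" where
  "widen_high (j, p, q) = {(j, p, q') | q'. q < q' \<and> (j, p, q') \<in> arcs}"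
| "narrow_high (j, p, q) = {(j, p, q') | q'. q' < q \<and> (j, p, q') \<in> arcs} \<union>
     {(j', p', hi j' + 1) | j' p'. p = lo j \<and> adj j' j \<and> (j', p', hi j' + 1) \<in> arcs}"
| "widen_low (j, p, q) = {(j, p', q) | p'. p' < p \<and> (j, p', q) \<in> arcs}"
| "narrow_low (j, p, q) = {(j, p', q) | p'. p < p' \<and> (j, p', q) \<in> arcs} \<union>
     {(j', lo j' - 1, q') | j' q'. q = hi j \<and> adj j j' \<and> (j', lo j' - 1, q') \<in> arcs}"

definition step_ok :: "(nat \<times> nat \<times> nat) set \<Rightarrow> nat \<times> nat \<times> nat \<Rightarrow> bool" where
  "step_ok V c \<longleftrightarrow> (narrow_high c \<subseteq> V \<or> widen_low c \<subseteq> V) \<and> (widen_high c \<subseteq> V \<or> narrow_low c \<subseteq> V)"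

lemma arcsI':
  assumes "j \<in> L" "lo j \<le> p \<Longrightarrow> okt j p" "p < lo j \<Longrightarrow> p = lo j - 1" "q \<le> hi j \<Longrightarrow> okh j q"
    "hi j < q \<Longrightarrow> q = hi j + 1" "p < q" "lo j \<le> p \<or> q \<le> hi j"
  shows "(j, p, q) \<in> arcs"
  using assms by (cases "lo j \<le> p"; cases "q \<le> hi j") (auto intro!: arcsI simp: not_le)

text \<open>Overlapping arcs exchange their heads and become nested; arcs meeting head to tail at a
  junction drop the common vertex. A result may degenerate to the vector 0, as an arc with equal
  ends or with both ends absent.\<close>

lemma crossing_resolution:
  assumes cr: "cross c d" and cA: "c \<in> arcs" and dA: "d \<in> arcs"
  shows "\<exists>x y. gv c + gv d = gv x + gv y \<and> (x \<in> arcs \<or> gv x = 0) \<and> (y \<in> arcs \<or> gv y = 0) \<and>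
    (x \<in> arcs \<longrightarrow> y \<in> arcs \<longrightarrow> coh x y \<or> gv x + gv y = 0) \<and>
    (x \<in> arcs \<longrightarrow> y \<in> arcs \<longrightarrow>
      x \<in> narrow_high c \<and> y \<in> widen_low c \<or> x \<in> widen_high c \<and> y \<in> narrow_low c)"
proof -
  obtain j p q j' p' q' where cd: "c = (j, p, q)" "d = (j', p', q')" by (cases c; cases d)
  note C = arcsE[OF cA[unfolded cd]] and D = arcsE[OF dA[unfolded cd]]
  have zero: "gv (j, p, q) = 0" if "p < lo j" "hi j < q" for j p q using that by (simp add: gv_def)
  have zero': "gv (j, p, p) = 0" if "lo j \<le> p" "p \<le> hi j" for j p using that by (simp add: gv_def)
  have "p < p' \<and> p' \<le> q \<and> q < q' \<and> j' = j \<or> p' < p \<and> p \<le> q' \<and> q' < q \<and> j' = j \<or>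
     j \<noteq> j' \<and> hv c = tv d \<and> hv c \<noteq> None \<or> j \<noteq> j' \<and> hv d = tv c \<and> tv c \<noteq> None"
    using cr cd by (auto split: if_splits)
  then consider (1) "p < p'" "p' \<le> q" "q < q'" "j' = j" | (2) "p' < p" "p \<le> q'" "q' < q" "j' = j"
    | (3) "j \<noteq> j'" "hv c = tv d" "hv c \<noteq> None" | (4) "j \<noteq> j'" "hv d = tv c" "tv c \<noteq> None" by blast
  then show ?thesis
  proof cases
    case 1
    let ?x = "(j, p, q')" and ?y = "(j, p', q)"
    have "gv c + gv d = gv ?x + gv ?y" unfolding cd 1 gv_def by simp
    moreover have "?x \<in> arcs \<or> gv ?x = 0"
    proof (cases "lo j \<le> p \<or> q' \<le> hi j")
      case True then show ?thesis using 1 C D by - (rule disjI1, rule arcsI', auto)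
    next
      case False then show ?thesis using zero by simp
    qed
    moreover have "?y \<in> arcs \<or> gv ?y = 0"
    proof (cases "p' = q")
      case True then show ?thesis using zero'[of j q] 1 C D by auto
    next
      case False then show ?thesis using 1 C D by - (rule disjI1, rule arcsI', auto)
    qed
    moreover have "coh ?x ?y" using 1 by (simp add: coh_def)
    ultimately show ?thesis using 1 unfolding cd by (intro exI[of _ ?x] exI[of _ ?y]) auto
  next
    case 2
    let ?x = "(j, p, q')" and ?y = "(j, p', q)"
    have "gv c + gv d = gv ?x + gv ?y" unfolding cd 2 gv_def by simp
    moreover have "?y \<in> arcs \<or> gv ?y = 0"
    proof (cases "lo j \<le> p' \<or> q \<le> hi j")
      case True then show ?thesis using 2 C D by - (rule disjI1, rule arcsI', auto)
    next
      case False then show ?thesis using zero by simp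
    qed
    moreover have "?x \<in> arcs \<or> gv ?x = 0"
    proof (cases "p = q'")
      case True then show ?thesis using zero'[of j p] 2 C D by auto
    next
      case False then show ?thesis using 2 C D by - (rule disjI1, rule arcsI', auto)
    qed
    moreover have "coh ?x ?y" using 2 by (simp add: coh_def)
    ultimately show ?thesis using 2 unfolding cd by (intro exI[of _ ?x] exI[of _ ?y]) auto
  next
    case 3
    then have q: "q \<le> hi j" "lo j' \<le> p'" "vtx q = vtx p'" unfolding cd by (auto split: if_splits)
    then have e: "q = hi j" "p' = lo j'" using head_tail[OF C(4) D(3)] 3 by auto
    have adj: "adj j j'" using e q C D 3 by (auto simp: adj_def)
    have l0: "0 < lo j'" using lo_pos D by blast
    let ?x = "(j, p, hi j + 1)" and ?y = "(j', lo j' - 1, q')"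
    have "gv c + gv d = gv ?x + gv ?y" unfolding cd gv_def using e q l0 3(2)[unfolded cd] by (simp add: ev_def)
    moreover have "?x \<in> arcs \<or> gv ?x = 0"
    proof (cases "lo j \<le> p")
      case True then show ?thesis using C by - (rule disjI1, rule arcsI', auto)
    next
      case False then show ?thesis using zero by simp
    qed
    moreover have "?y \<in> arcs \<or> gv ?y = 0"
    proof (cases "q' \<le> hi j'")
      case True then show ?thesis using D l0 by - (rule disjI1, rule arcsI', auto)
    next
      case False then show ?thesis using zero l0 by simp
    qed
    \<comment> \<open>\<open>?x\<close> has no head and \<open>?y\<close> no tail, so they can meet
      only at the tail of \<open>?x\<close> and the head of \<open>?y\<close>, and then the vectors
      cancel. This happens when the two legs also share their other ends.\<close>
    moreover have "coh ?x ?y \<or> gv ?x + gv ?y = 0"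
    proof -
      have none: "hv ?x = None" "tv ?y = None" using l0 by auto
      show ?thesis
      proof (cases "hv ?y = tv ?x")
        case True then show ?thesis using none by (simp add: gv_def ev_def)
      next
        case False
        then have "\<not> cross ?x ?y" using 3(1) none by (simp only: cross.simps) simp
        then show ?thesis by (simp add: coh_def)
      qed
    qed
    moreover have "?x \<in> arcs \<longrightarrow> ?x \<in> widen_high c" unfolding cd using e by simp
    moreover have "?y \<in> arcs \<longrightarrow> ?y \<in> narrow_low c" unfolding cd using e adj by simp
    ultimately show ?thesis by (intro exI[of _ ?x] exI[of _ ?y]) simp
  next
    case 4
    then have q: "q' \<le> hi j'" "lo j \<le> p" "vtx q' = vtx p" unfolding cd by (auto split: if_splits)
    then have e: "q' = hi j'" "p = lo j" using head_tail[OF D(4) C(3)] 4 by auto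
    have adj: "adj j' j" using e q C D 4 by (auto simp: adj_def)
    have l0: "0 < lo j" using lo_pos C by blast
    let ?x = "(j', p', hi j' + 1)" and ?y = "(j, lo j - 1, q)"
    have "gv c + gv d = gv ?x + gv ?y" unfolding cd gv_def using e q l0 4(2)[unfolded cd] by (simp add: ev_def)
    moreover have "?x \<in> arcs \<or> gv ?x = 0"
    proof (cases "lo j' \<le> p'")
      case True then show ?thesis using D by - (rule disjI1, rule arcsI', auto)
    next
      case False then show ?thesis using zero by simp
    qed
    moreover have "?y \<in> arcs \<or> gv ?y = 0"
    proof (cases "q \<le> hi j")
      case True then show ?thesis using C l0 by - (rule disjI1, rule arcsI', auto)
    next
      case False then show ?thesis using zero l0 by simp
    qed
    moreover have "coh ?x ?y \<or> gv ?x + gv ?y = 0"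
    proof -
      have none: "hv ?x = None" "tv ?y = None" using l0 by auto
      show ?thesis
      proof (cases "hv ?y = tv ?x")
        case True then show ?thesis using none by (simp add: gv_def ev_def)
      next
        case False
        then have "\<not> cross ?x ?y" using 4(1) none by (simp only: cross.simps) simp
        then show ?thesis by (simp add: coh_def)
      qed
    qed
    moreover have "?x \<in> arcs \<longrightarrow> ?x \<in> narrow_high c" unfolding cd using e adj by simp
    moreover have "?y \<in> arcs \<longrightarrow> ?y \<in> widen_low c" unfolding cd using e l0 by simp
    ultimately show ?thesis by (intro exI[of _ ?x] exI[of _ ?y]) simp
  qed
qed

sublocale fan: clique_fan arcs gv coh
proof
  show "finite arcs" by (rule finite_arcs)
  show "coh i i" for i by (rule coh_refl)
  show "coh i j \<Longrightarrow> coh j i" for i j by (rule coh_sym)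
  show "\<exists>f. 0 < f \<bullet> gv i \<and> (\<forall>k\<in>arcs. k \<noteq> i \<longrightarrow> f \<bullet> gv k < f \<bullet> gv i)" if "i \<in> arcs" for i
    using arcs_exposed[OF that] .
  show "\<exists>f. (\<forall>i\<in>arcs. f \<bullet> gv i \<le> 1) \<and> (\<forall>i\<in>K. f \<bullet> gv i = 1)"
    if "K \<subseteq> arcs" "\<And>i j. i \<in> K \<Longrightarrow> j \<in> K \<Longrightarrow> coh i j" for K
    using arcs_supported[OF that] .
  show "\<exists>c. (\<forall>i\<in>arcs. 0 \<le> c i) \<and> (\<forall>i\<in>arcs. \<forall>j\<in>arcs. 0 < c i \<longrightarrow> 0 < c j \<longrightarrow> coh i j) \<and>
      (\<Sum>i\<in>arcs. c i *\<^sub>R gv i) = x" for x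
    using arcs_cover_signed[of x] by blast
  show "c i = d i" if "\<And>i. i \<in> arcs \<Longrightarrow> 0 \<le> c i" "\<And>i. i \<in> arcs \<Longrightarrow> 0 \<le> d i"
    "\<And>i j. i \<in> arcs \<Longrightarrow> j \<in> arcs \<Longrightarrow> 0 < c i \<Longrightarrow> 0 < c j \<Longrightarrow> coh i j"
    "\<And>i j. i \<in> arcs \<Longrightarrow> j \<in> arcs \<Longrightarrow> 0 < d i \<Longrightarrow> 0 < d j \<Longrightarrow> coh i j"
    "(\<Sum>i\<in>arcs. c i *\<^sub>R gv i) = (\<Sum>i\<in>arcs. d i *\<^sub>R gv i)" "i \<in> arcs" for c d i
    using arcs_unique[OF that] .
  show "gv i + gv j = 0 \<or> (\<exists>k\<in>arcs. gv i + gv j = gv k) \<or>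
      (\<exists>k\<in>arcs. \<exists>l\<in>arcs. coh k l \<and> gv i + gv j = gv k + gv l)"
    if ij: "i \<in> arcs" "j \<in> arcs" "\<not> coh i j" for i j
  proof -
    have cr: "cross i j" using ij by (simp add: coh_def)
    obtain x y where xy: "gv i + gv j = gv x + gv y" "x \<in> arcs \<or> gv x = 0" "y \<in> arcs \<or> gv y = 0"
      "x \<in> arcs \<longrightarrow> y \<in> arcs \<longrightarrow> coh x y \<or> gv x + gv y = 0"
      using crossing_resolution[OF cr ij(1,2)] by blast
    show ?thesis
    proof (cases "x \<in> arcs \<and> y \<in> arcs")
      case True
      then show ?thesis using xy by metis
    next
      case False
      then show ?thesis using xy by auto
    qed
  qed
qed

text \<open>By uniqueness the only coherent pair with the given sum is the one from
  \<open>crossing_resolution\<close>. It has one member in each of two sets of which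
  \<open>V\<close> contains at least one.\<close>

theorem step_ok_imp_legal:
  assumes "c \<in> arcs" "step_ok V c"
  shows "fan.legal V c"
  unfolding fan.legal_def
proof (intro ballI impI)
  fix d k l assume I: "d \<in> arcs" "k \<in> arcs" "l \<in> arcs" and inc: "\<not> coh c d" and kl: "coh k l" "gv c + gv d = gv k + gv l"
  have cr: "cross c d" using inc by (simp add: coh_def)
  obtain x y where xy: "gv c + gv d = gv x + gv y" "x \<in> arcs \<or> gv x = 0" "y \<in> arcs \<or> gv y = 0"
    "x \<in> arcs \<longrightarrow> y \<in> arcs \<longrightarrow> coh x y \<or> gv x + gv y = 0"
    "x \<in> arcs \<longrightarrow> y \<in> arcs \<longrightarrow>
      x \<in> narrow_high c \<and> y \<in> widen_low c \<or> x \<in> widen_high c \<and> y \<in> narrow_low c"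
    using crossing_resolution[OF cr assms(1) I(1)] by blast
  note short = fan.coherent_sum_not_short[OF I(2,3) kl(1)]
  have "gv x + gv y = gv k + gv l" using xy(1) kl(2) by simp
  then have A: "x \<in> arcs" "y \<in> arcs" "coh x y" using short xy(2-4) by (metis add.left_neutral add.right_neutral)+
  then have "{k, l} = {x, y}" using fan.coherent_sum_unique[OF I(2,3) kl(1) A] kl(2) xy(1) by simp
  moreover have "x \<in> V \<or> y \<in> V" using xy(5) A assms(2) unfolding step_ok_def by blast
  ultimately show "k \<in> V \<or> l \<in> V" by (metis doubleton_eq_iff)
qed

definition inside :: "nat \<Rightarrow> nat \<Rightarrow> bool" where
  "inside j i \<longleftrightarrow> lo j < i \<and> i < hi j \<and> okt j i \<and> okh j i"

lemma fan_legalD: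
  "fan.legal V c \<Longrightarrow> cross c d \<Longrightarrow> d \<in> arcs \<Longrightarrow> x \<in> arcs \<Longrightarrow> y \<in> arcs \<Longrightarrow> \<not> cross x y \<Longrightarrow>
    gv c + gv d = gv x + gv y \<Longrightarrow> x \<in> V \<or> y \<in> V"
  unfolding fan.legal_def coh_def by blast

text \<open>From unvisited \<open>x\<close> and \<open>y\<close> one reconstructs the arc that
  together with \<open>c\<close> resolves to them. Legality then leaves only the case that
  \<open>x\<close> and \<open>y\<close> themselves cross, which needs two legs with both ends in
  common.\<close>

lemma legal_narrow_high:
  assumes leg: "fan.legal V c" and c: "c = (j, p, q)" "c \<in> arcs"
    and x: "x \<in> narrow_high c" "x \<notin> V" and y: "y \<in> widen_low c" "y \<notin> V"
  shows "\<exists>j'. adj j' j \<and> adj j j' \<and> c = (j, lo j, hi j) \<and> x = (j', lo j', hi j' + 1) \<and> y = (j, lo j - 1, hi j)"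
proof -
  note C = arcsE[OF c(2)[unfolded c(1)]]
  obtain p' where p': "y = (j, p', q)" "p' < p" "(j, p', q) \<in> arcs" using y c by auto
  note Y = arcsE[OF p'(3)]
  have xA: "x \<in> arcs" using x c by auto
  consider q' where "x = (j, p, q')" "q' < q" | j' p'' where "x = (j', p'', hi j' + 1)" "p = lo j" "adj j' j"
    using x c by auto
  then show ?thesis
  proof cases
    case 1
    note X = arcsE[OF xA[unfolded 1]]
    have "(j, p', q') \<in> arcs" using 1 p' C X Y by (intro arcsI') auto
    moreover have "cross c (j, p', q')" using 1 p' c X by simp
    moreover have "gv c + gv (j, p', q') = gv x + gv y" unfolding c 1 p' gv_def by simp
    moreover have "\<not> cross x y" using 1 p' by simp
    ultimately have "x \<in> V \<or> y \<in> V" using fan_legalD[OF leg _ _ xA, of _ y] p' by blast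
    then show ?thesis using x y by blast
  next
    case 2
    note X = arcsE[OF xA[unfolded 2(1)]]
    have l0: "0 < lo j" using lo_pos C by blast
    have pp: "p' = lo j - 1" using Y(5) p'(2) 2 by simp
    have kt: "lo j' \<le> p''" "okt j' p''" using X by auto
    \<comment> \<open>The junction vertex is a tail on leg \<open>j\<close>, so it is none on
      \<open>j'\<close>. Hence \<open>x\<close>, given a head at the junction, is still an arc,
      namely \<open>?d\<close>.\<close>
    have "p'' \<noteq> hi j'"
      using tail_unique[of j' "hi j'" j "lo j"] 2(3) kt(2) unfolding adj_def by metis
    then have lt: "p'' < hi j'" using X by simp
    let ?d = "(j', p'', hi j')"
    have dA: "?d \<in> arcs" using kt lt 2(3) X by (intro arcsI) (auto simp: adj_def)
    have cr: "cross c ?d" using c 2 by (auto simp: adj_def)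
    have gs: "gv c + gv ?d = gv x + gv y"
      unfolding c 2(1) p' pp gv_def using 2 l0 by (auto simp: adj_def ev_def)
    have "cross x y" using fan_legalD[OF leg cr dA xA, of y] x y p' gs by blast
    then have "q \<le> hi j" "vtx q = vtx p''" using 2 p' pp l0 kt by (auto simp: adj_def split: if_splits)
    then have e: "q = hi j" "p'' = lo j'" using head_tail[OF C(4) kt(2)] 2(3) by (auto simp: adj_def)
    then have "adj j j'" using C(4) kt \<open>vtx q = vtx p''\<close> 2(3) by (auto simp: adj_def)
    then show ?thesis using e 2 c p' pp by auto
  qed
qed

text \<open>The mirror image, with low and high ends exchanged.\<close>

lemma legal_widen_high:
  assumes leg: "fan.legal V c" and c: "c = (j, p, q)" "c \<in> arcs"
    and x: "x \<in> widen_high c" "x \<notin> V" and y: "y \<in> narrow_low c" "y \<notin> V"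
  shows "\<exists>j'. adj j' j \<and> adj j j' \<and> c = (j, lo j, hi j) \<and> x = (j, lo j, hi j + 1) \<and> y = (j', lo j' - 1, hi j')"
proof -
  note C = arcsE[OF c(2)[unfolded c(1)]]
  obtain q' where q': "x = (j, p, q')" "q < q'" "(j, p, q') \<in> arcs" using x c by auto
  note X = arcsE[OF q'(3)]
  have yA: "y \<in> arcs" using y c by auto
  consider p' where "y = (j, p', q)" "p < p'" | j' q'' where "y = (j', lo j' - 1, q'')" "q = hi j" "adj j j'"
    using y c by auto
  then show ?thesis
  proof cases
    case 1
    note Y = arcsE[OF yA[unfolded 1]]
    have "(j, p', q') \<in> arcs" using 1 q' C X Y by (intro arcsI') auto
    moreover have "cross c (j, p', q')" using 1 q' c Y by simp
    moreover have "gv c + gv (j, p', q') = gv x + gv y" unfolding c 1 q' gv_def by simp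
    moreover have "\<not> cross x y" using 1 q' by simp
    ultimately have "x \<in> V \<or> y \<in> V" using fan_legalD[OF leg _ _ _ yA, of _ x] q' by blast
    then show ?thesis using x y by blast
  next
    case 2
    note Y = arcsE[OF yA[unfolded 2(1)]]
    have l0: "0 < lo j'" using lo_pos Y by blast
    have qq: "q' = hi j + 1" using X(6) q'(2) 2 by simp
    have kt: "q'' \<le> hi j'" "okh j' q''" using Y l0 by auto
    have "q'' \<noteq> lo j'"
      using head_unique[of j' "lo j'" j "hi j"] 2(3) kt(2) unfolding adj_def by metis
    then have lt: "lo j' < q''" using Y by simp
    let ?d = "(j', lo j', q'')"
    have dA: "?d \<in> arcs" using kt lt 2(3) Y by (intro arcsI) (auto simp: adj_def)
    have cr: "cross c ?d" using c 2 by (auto simp: adj_def)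
    have gs: "gv c + gv ?d = gv x + gv y"
      unfolding c 2(1) q' qq gv_def using 2 l0 by (auto simp: adj_def ev_def)
    have "cross x y" using fan_legalD[OF leg cr dA _ yA, of x] x y q' gs by blast
    then have "lo j \<le> p" "vtx q'' = vtx p" using 2 q' qq l0 kt by (auto simp: adj_def split: if_splits)
    then have e: "q'' = hi j'" "p = lo j" using head_tail[OF kt(2) C(3)] 2(3) by (auto simp: adj_def)
    then have "adj j' j" using C(3) kt \<open>vtx q'' = vtx p\<close> 2(3) by (auto simp: adj_def)
    then show ?thesis using e 2 c q' qq by auto
  qed
qed

lemma fan_linked:
  assumes "fan.legal_seq V" "set V \<subseteq> arcs" "z \<in> set V" "w \<in> arcs" "s \<in> arcs" "t \<in> arcs" "x \<in> arcs" "y \<in> arcs"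
    "cross z s" "\<not> cross y w" "gv z + gv s = gv y + gv w" "cross w t" "\<not> cross z x" "gv w + gv t = gv z + gv x"
  shows "x \<in> set V \<or> y \<in> set V"
  using fan.legal_seq_linked[of V z w s t x y] assms by (auto simp: coh_def)

text \<open>The hypothesis excludes \<open>Cycle(1,1)\<close>, where two legs with a common start and a common end
  have no further vertices.\<close>

theorem legal_imp_step_ok:
  assumes seq: "fan.legal_seq V" "set V \<subseteq> arcs" and leg: "fan.legal (set V) c" and cA: "c \<in> arcs"
    and ins: "\<And>j j'. adj j j' \<Longrightarrow> adj j' j \<Longrightarrow> \<exists>i. inside j i \<or> inside j' i"
  shows "step_ok (set V) c"
proof -
  obtain j p q where c: "c = (j, p, q)" by (cases c)
  have "narrow_high c \<subseteq> set V \<or> widen_low c \<subseteq> set V"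
  proof (rule ccontr)
    assume "\<not> ?thesis"
    then obtain x y where x: "x \<in> narrow_high c" "x \<notin> set V" and y: "y \<in> widen_low c" "y \<notin> set V" by blast
    obtain j' where S: "adj j' j" "adj j j'" "c = (j, lo j, hi j)" "x = (j', lo j', hi j' + 1)" "y = (j, lo j - 1, hi j)"
      using legal_narrow_high[OF leg c cA x y] by blast
    have xy: "x \<in> arcs" "y \<in> arcs" using x(1) y(1) c by auto
    \<comment> \<open>Since \<open>y\<close> is unvisited, legality of \<open>c\<close> leaves
      \<open>x\<close> as the only unvisited member of \<open>narrow_high c\<close>.\<close>
    have other: "z \<in> set V" if "z \<in> narrow_high c" "z \<noteq> x" for z
    proof (rule ccontr)
      assume "z \<notin> set V"
      from legal_narrow_high[OF leg c cA that(1) this y]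
      obtain j'' where "adj j'' j" "z = (j'', lo j'', hi j'' + 1)" by blast
      then show False using S that(2) head_unique[of j'' "hi j''" j' "hi j'"] unfolding adj_def by auto
    qed
    have J: "0 < lo j" "0 < lo j'" "lo j \<le> hi j" "lo j' \<le> hi j'" "j \<in> L" "j' \<in> L"
      using S(1,2) lo_pos okt okh unfolding adj_def by auto
    have V: "vtx (hi j) = vtx (lo j')" "vtx (hi j') = vtx (lo j)" "j \<noteq> j'"
      "okh j (hi j)" "okt j (lo j)" "okh j' (hi j')" "okt j' (lo j')"
      using S(1,2) unfolding adj_def by auto
    have lt: "lo j < hi j" "lo j' < hi j'"
      using arcsE(2)[OF cA[unfolded S(3)]] arcsE(2)[OF xy(1)[unfolded S(4)]] J
        head_unique[of j' "hi j'" j "hi j"] V by (auto simp: le_less)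
    obtain i where "inside j i \<or> inside j' i" using ins[OF S(2,1)] by blast
    then show False
    proof
      assume i: "inside j' i"
      \<comment> \<open>\<open>?z\<close> is \<open>x\<close> with its tail moved to
        \<open>i\<close>, so it has been visited. In terms of g-vectors the linking exchanges are
        \<open>?z + ?s = x + ?w\<close> and \<open>?w + c = ?z + y\<close>.\<close>
      let ?z = "(j', i, hi j' + 1)" and ?s = "(j', lo j', hi j')" and ?w = "(j', i, hi j')"
      have i': "lo j' < i" "i < hi j'" "okt j' i" using i by (auto simp: inside_def)
      have zA: "?z \<in> arcs" using i' J by (intro arcsI) auto
      then have zV: "?z \<in> set V" using S i' by (intro other) auto
      have ne: "vtx i \<noteq> vtx (lo j')" using tail_unique[of j' i j' "lo j'"] i' V by auto
      have sA: "?s \<in> arcs" "?w \<in> arcs" using i' J V lt by (auto intro!: arcsI)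
      have "y \<in> set V \<or> x \<in> set V"
      proof (rule fan_linked[OF seq zV sA(2,1) cA xy(2,1)])
        show "gv ?w + gv c = gv ?z + gv y"
          using S V J i' by (auto simp: gv_def ev_def)
      qed (use S V i' J lt ne in \<open>auto simp: gv_def ev_def\<close>)
      then show False using x y by blast
    next
      assume i: "inside j i"
      \<comment> \<open>Now \<open>?z\<close> is \<open>c\<close> with its head moved to
        \<open>i\<close>; the two exchanges have the same form.\<close>
      let ?z = "(j, lo j, i)" and ?s = "(j', lo j', hi j')" and ?w = "(j, lo j - 1, i)"
      have i': "lo j < i" "i < hi j" "okh j i" using i by (auto simp: inside_def)
      have zA: "?z \<in> arcs" "?w \<in> arcs" using i' J V by (auto intro!: arcsI)
      then have zV: "?z \<in> set V" using S i' V by (intro other) auto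
      have ne: "vtx i \<noteq> vtx (hi j)" using head_unique[of j i j "hi j"] i' V by auto
      have sA: "?s \<in> arcs" using i' J V lt by (auto intro!: arcsI)
      have "y \<in> set V \<or> x \<in> set V"
      proof (rule fan_linked[OF seq zV zA(2) sA cA xy(2,1)])
        show "gv ?z + gv ?s = gv x + gv ?w"
          using S V J i' by (auto simp: gv_def ev_def)
      qed (use S V i' J lt ne in \<open>auto simp: gv_def ev_def\<close>)
      then show False using x y by blast
    qed
  qed
  \<comment> \<open>The mirror image: \<open>x\<close> and \<open>y\<close> exchange their roles in
    the linking.\<close>
  moreover have "widen_high c \<subseteq> set V \<or> narrow_low c \<subseteq> set V"
  proof (rule ccontr)
    assume "\<not> ?thesis"
    then obtain x y where x: "x \<in> widen_high c" "x \<notin> set V" and y: "y \<in> narrow_low c" "y \<notin> set V" by blast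
    obtain j' where S: "adj j' j" "adj j j'" "c = (j, lo j, hi j)" "x = (j, lo j, hi j + 1)" "y = (j', lo j' - 1, hi j')"
      using legal_widen_high[OF leg c cA x y] by blast
    have xy: "x \<in> arcs" "y \<in> arcs" using x(1) y(1) c by auto
    have other: "z \<in> set V" if "z \<in> narrow_low c" "z \<noteq> y" for z
    proof (rule ccontr)
      assume "z \<notin> set V"
      from legal_widen_high[OF leg c cA x that(1) this]
      obtain j'' where "adj j'' j" "z = (j'', lo j'' - 1, hi j'')" by blast
      then show False using S that(2) head_unique[of j'' "hi j''" j' "hi j'"] unfolding adj_def by auto
    qed
    have J: "0 < lo j" "0 < lo j'" "lo j \<le> hi j" "lo j' \<le> hi j'" "j \<in> L" "j' \<in> L"
      using S(1,2) lo_pos okt okh unfolding adj_def by auto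
    have V: "vtx (hi j) = vtx (lo j')" "vtx (hi j') = vtx (lo j)" "j \<noteq> j'"
      "okh j (hi j)" "okt j (lo j)" "okh j' (hi j')" "okt j' (lo j')"
      using S(1,2) unfolding adj_def by auto
    have lt: "lo j < hi j" "lo j' < hi j'"
      using arcsE(2)[OF cA[unfolded S(3)]] J
        head_unique[of j' "hi j'" j "hi j"] V by (auto simp: le_less)
    obtain i where "inside j i \<or> inside j' i" using ins[OF S(2,1)] by blast
    then show False
    proof
      assume i: "inside j' i"
      let ?z = "(j', lo j' - 1, i)" and ?s = "(j', lo j', hi j')" and ?w = "(j', lo j', i)"
      have i': "lo j' < i" "i < hi j'" "okh j' i" using i by (auto simp: inside_def)
      have zA: "?z \<in> arcs" "?w \<in> arcs" using i' J V by (auto intro!: arcsI)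
      then have zV: "?z \<in> set V" using S i' by (intro other) auto
      have ne: "vtx i \<noteq> vtx (hi j')" using head_unique[of j' i j' "hi j'"] i' V by auto
      have sA: "?s \<in> arcs" using i' J V lt by (auto intro!: arcsI)
      have "x \<in> set V \<or> y \<in> set V"
      proof (rule fan_linked[OF seq zV zA(2) sA cA xy])
        show "gv ?w + gv c = gv ?z + gv x"
          using S V J i' by (auto simp: gv_def ev_def)
      qed (use S V i' J lt ne in \<open>auto simp: gv_def ev_def\<close>)
      then show False using x y by blast
    next
      assume i: "inside j i"
      let ?z = "(j, i, hi j)" and ?s = "(j', lo j', hi j')" and ?w = "(j, i, hi j + 1)"
      have i': "lo j < i" "i < hi j" "okt j i" using i by (auto simp: inside_def)
      have zA: "?z \<in> arcs" "?w \<in> arcs" using i' J V by (auto intro!: arcsI)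
      then have zV: "?z \<in> set V" using S i' V by (intro other) auto
      have ne: "vtx i \<noteq> vtx (lo j)" using tail_unique[of j i j "lo j"] i' V by auto
      have sA: "?s \<in> arcs" using i' J V lt by (auto intro!: arcsI)
      have "x \<in> set V \<or> y \<in> set V"
      proof (rule fan_linked[OF seq zV zA(2) sA cA xy])
        show "gv ?z + gv ?s = gv y + gv ?w"
          using S V J i' by (auto simp: gv_def ev_def)
      qed (use S V i' J lt ne in \<open>auto simp: gv_def ev_def\<close>)
      then show False using x y by blast
    qed
  qed
  ultimately show ?thesis unfolding step_ok_def by blast
qed

end

section \<open>The legs of Path and Cycle\<close>

locale framed_shape =
  fixes s :: shape and w :: "'n::finite \<Rightarrow> vertex"
  assumes valid: "valid_shape s" and w: "bij_betw w UNIV (inner_vertices (dag s))"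
begin

definition cyc :: bool where "cyc = (case s of Path _ \<Rightarrow> False | Cycle _ \<Rightarrow> True)"
definition E :: nat where "E = sum_list (lens s)"
definition r :: nat where "r = length (lens s)"
definition psum :: "nat \<Rightarrow> nat" where "psum i = sum_list (take i (lens s))"
text \<open>Consecutive legs share a position: \<open>hi j\<close> equals
  \<open>lo (Suc j)\<close>.\<close>

definition lo :: "nat \<Rightarrow> nat" where "lo j = psum (j - 1) + 1"
definition hi :: "nat \<Rightarrow> nat" where "hi j = psum j + 1"
text \<open>A cycle is cut open at vertex 1, which reappears as position \<open>E + 1\<close>, the
  high end of the last leg. So every leg stays an interval of positions.\<close>

definition vtx :: "nat \<Rightarrow> nat" where "vtx x = (if cyc \<and> x = E + 1 then 1 else x)"
definition L :: "nat set" where "L = {1..r}"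
definition N :: "nat set" where "N = {1..num_inner s}"
text \<open>A low turn at the high end of a leg would need a source or sink edge whose label is
  taken there by the adjacent inner edge of the next leg. Only the last leg of a path has no next
  one. Dually for \<open>okh\<close>.\<close>

definition okt :: "nat \<Rightarrow> nat \<Rightarrow> bool" where
  "okt j p \<longleftrightarrow> j \<in> L \<and> lo j \<le> p \<and> p \<le> hi j \<and> (p = hi j \<longrightarrow> \<not> cyc \<and> j = r)"
definition okh :: "nat \<Rightarrow> nat \<Rightarrow> bool" where
  "okh j q \<longleftrightarrow> j \<in> L \<and> lo j \<le> q \<and> q \<le> hi j \<and> (q = lo j \<longrightarrow> \<not> cyc \<and> j = 1)"
definition ax :: "nat \<Rightarrow> 'n" where "ax v = inv_into UNIV w (Inner v)"

section \<open>Positions, legs and junctions\<close>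

lemma lens_pos: "i < r \<Longrightarrow> 0 < lens s ! i"
  using valid unfolding r_def by (cases s) auto

lemma r_pos: "0 < r"
  using valid unfolding r_def by (cases s) auto

lemma cyc_even: "cyc \<Longrightarrow> even r"
  using valid unfolding r_def cyc_def by (cases s) auto

lemma cyc_r: "cyc \<Longrightarrow> 2 \<le> r"
  using cyc_even r_pos by presburger

lemma num_inner_eq: "num_inner s = (if cyc then E else E + 1)"
  unfolding cyc_def E_def by (cases s) auto

lemma psum_0: "psum 0 = 0" by (simp add: psum_def)

lemma psum_r: "psum r = E" by (simp add: psum_def r_def E_def)

lemma psum_Suc: "i < r \<Longrightarrow> psum (Suc i) = psum i + lens s ! i"
  by (simp add: psum_def r_def take_Suc_conv_app_nth)

lemma psum_mono: "i \<le> k \<Longrightarrow> psum i \<le> psum k"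
proof (induction k)
  case (Suc k)
  have "psum k \<le> psum (Suc k)"
  proof (cases "k < r")
    case True then show ?thesis by (simp add: psum_Suc)
  next
    case False then show ?thesis by (simp add: psum_def r_def)
  qed
  then show ?case using Suc by (cases "i = Suc k") auto
qed simp

lemma lo_less_hi: "j \<in> L \<Longrightarrow> lo j < hi j"
  using psum_Suc[of "j - 1"] lens_pos[of "j - 1"] by (auto simp: L_def lo_def hi_def)

lemma hi_diff: "j \<in> L \<Longrightarrow> hi j = lo j + lens s ! (j - 1)"
  using psum_Suc[of "j - 1"] by (auto simp: L_def lo_def hi_def)

lemma lo_ge_1: "1 \<le> lo j" by (simp add: lo_def)

lemma hi_le: "j \<in> L \<Longrightarrow> hi j \<le> E + 1"
  using psum_mono[of j r] psum_r by (auto simp: L_def hi_def)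

lemma hi_le_lo: "j < j' \<Longrightarrow> hi j \<le> lo j'"
  using psum_mono[of j "j' - 1"] by (auto simp: lo_def hi_def)

lemma lo_1: "lo 1 = 1" by (simp add: lo_def psum_0)

lemma hi_r: "hi r = E + 1" by (simp add: hi_def psum_r)

lemma leg_unique:
  assumes "lo j \<le> x" "x < hi j" "lo j' \<le> x" "x < hi j'" shows "j = j'"
  using hi_le_lo[of j j'] hi_le_lo[of j' j] assms by linarith

lemma leg_exists:
  assumes "1 \<le> x" "x \<le> E" shows "\<exists>j\<in>L. lo j \<le> x \<and> x < hi j"
proof -
  let ?j = "LEAST j. x \<le> psum j"
  have ex: "x \<le> psum r" using assms psum_r by simp
  then have j: "x \<le> psum ?j" by (rule LeastI)
  have jr: "?j \<le> r" using ex by (rule Least_le)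
  have j0: "?j \<noteq> 0" using j psum_0 assms by (metis not_one_le_zero le_zero_eq)
  then have "\<not> x \<le> psum (?j - 1)" using not_less_Least[of "?j - 1" "\<lambda>j. x \<le> psum j"] by simp
  then show ?thesis using j jr j0 by (intro bexI[of _ ?j]) (auto simp: lo_def hi_def L_def)
qed

lemma leg_index_eq:
  assumes "j \<in> L" "lo j \<le> x" "x < hi j" shows "leg_index s x = j"
  unfolding leg_index_def
proof (rule Least_equality)
  show "x \<le> sum_list (take j (lens s))" using assms by (simp add: hi_def psum_def)
  show "j \<le> k" if "x \<le> sum_list (take k (lens s))" for k
  proof (rule ccontr)
    assume "\<not> j \<le> k"
    then have "psum k \<le> psum (j - 1)" by (intro psum_mono) simp
    then show False using that assms by (simp add: lo_def psum_def)
  qed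
qed

lemma hi_eq_top: "j \<in> L \<Longrightarrow> hi j = E + 1 \<Longrightarrow> j = r"
  using hi_le_lo[of j r] lo_less_hi[of r] hi_r r_pos by (force simp: L_def)

lemma lo_eq_1: "j \<in> L \<Longrightarrow> lo j = 1 \<Longrightarrow> j = 1"
  using hi_le_lo[of 1 j] lo_less_hi[of 1] lo_1 r_pos by (force simp: L_def)

lemma okt_leg:
  assumes "okt j p" "okt j' p" shows "j = j'"
proof -
  have "p < hi j \<or> j = r" "p < hi j' \<or> j' = r" using assms by (auto simp: okt_def)
  moreover have "p = hi j \<Longrightarrow> \<not> p < hi j'" if "j = r" "j' \<in> L" for j j'
    using that hi_r hi_le by (metis linorder_not_le)
  ultimately show ?thesis using assms leg_unique[of j p j'] unfolding okt_def
    by (metis le_neq_implies_less)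
qed

lemma okh_leg:
  assumes "okh j q" "okh j' q" shows "j = j'"
proof -
  have *: "j = j'" if "lo j < q" "lo j' < q" using that assms leg_unique[of j "q - 1" j'] by (auto simp: okh_def)
  have **: "\<not> lo j' < q" if "q = lo j" "j = 1" for j j' using that lo_1 lo_ge_1[of j'] by simp
  show ?thesis using * ** assms unfolding okh_def by (metis le_neq_implies_less)
qed

lemma vtx_eq_cases: "vtx x = vtx y \<Longrightarrow> x = y \<or> cyc \<and> (x = E + 1 \<and> y = 1 \<or> y = E + 1 \<and> x = 1)"
  by (auto simp: vtx_def split: if_splits)

lemma vtx_inj_tail:
  assumes "okt j p" "okt j' p'" "vtx p = vtx p'" shows "p = p'"
proof -
  have le: "\<not> (cyc \<and> p = E + 1)" if "okt j p" for j p
    using that hi_le[of j] by (auto simp: okt_def)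
  show ?thesis using le[OF assms(1)] le[OF assms(2)] vtx_eq_cases[OF assms(3)] by blast
qed

lemma vtx_inj_head:
  assumes "okh j q" "okh j' q'" "vtx q = vtx q'" shows "q = q'"
proof -
  have gt: "\<not> (cyc \<and> q \<le> 1)" if "okh j q" for j q
    using that lo_ge_1[of j] by (auto simp: okh_def)
  show ?thesis using gt[OF assms(1)] gt[OF assms(2)] vtx_eq_cases[OF assms(3)] by auto
qed

lemma vtx_N: "j \<in> L \<Longrightarrow> lo j \<le> x \<Longrightarrow> x \<le> hi j \<Longrightarrow> vtx x \<in> N"
  using hi_le[of j] lo_ge_1[of j] lo_less_hi[of j] by (auto simp: N_def num_inner_eq vtx_def)

text \<open>Distinct positions of one vertex can only be 1 and \<open>E + 1\<close>, and a cycle has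
  at least two legs, so no leg contains both.\<close>

lemma vtx_inj_leg:
  assumes "j \<in> L" "lo j \<le> x" "x \<le> hi j" "lo j \<le> y" "y \<le> hi j" "vtx x = vtx y"
  shows "x = y"
proof -
  have "x \<le> E + 1" "y \<le> E + 1" "1 \<le> x" "1 \<le> y" using assms hi_le[of j] lo_ge_1[of j] by auto
  moreover have "\<not> (cyc \<and> lo j = 1 \<and> hi j = E + 1)"
    using hi_eq_top[OF assms(1)] lo_eq_1[OF assms(1)] cyc_r by auto
  moreover have "1 \<le> lo j" by (rule lo_ge_1)
  ultimately show ?thesis using assms(2-5) hi_le[OF assms(1)] vtx_eq_cases[OF assms(6)] by linarith
qed

text \<open>A head that is not at the high end is also an admissible tail position, and tail
  positions determine their leg. Dually for a tail that is not at the low end.\<close>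

lemma okh_okt_same:
  assumes "okh j q" "okt j' p" "vtx q = vtx p"
  shows "if j = j' then q = p else q = hi j \<and> p = lo j'"
proof (cases "j = j'")
  case True
  then show ?thesis using vtx_inj_leg[of j q p] assms by (auto simp: okh_def okt_def)
next
  case False
  have J: "j \<in> L" "j' \<in> L" using assms by (auto simp: okh_def okt_def)
  have 1: "okt j x" if "lo j \<le> x" "x < hi j" "j \<in> L" for j x using that by (simp add: okt_def)
  have 2: "okh j x" if "lo j < x" "x \<le> hi j" "j \<in> L" for j x using that by (simp add: okh_def)
  have "q = hi j"
  proof (rule ccontr)
    assume "q \<noteq> hi j"
    then have "okt j q" using 1[of j q] assms(1) by (auto simp: okh_def)
    then have "q = p" using vtx_inj_tail assms by blast
    then show False using okt_leg \<open>okt j q\<close> assms False by blast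
  qed
  moreover have "p = lo j'"
  proof (rule ccontr)
    assume "p \<noteq> lo j'"
    then have "okh j' p" using 2[of j' p] assms(2) by (auto simp: okt_def)
    then have "q = p" using vtx_inj_head assms by blast
    then show False using okh_leg \<open>okh j' p\<close> assms False by blast
  qed
  ultimately show ?thesis using False by simp
qed

lemma E_pos: "0 < E"
  using lo_less_hi[of r] hi_r lo_ge_1[of r] r_pos by (auto simp: L_def)

lemma inner_vertices_eq: "inner_vertices (dag s) = Inner ` N"
  by (auto simp: inner_vertices_def dag_def N_def)

sublocale A: arc_system L lo hi vtx okt okh N ax
proof
  show "finite L" by (simp add: L_def)
  show "0 < lo j" for j by (simp add: lo_def)
  show "j \<in> L \<and> lo j \<le> p \<and> p \<le> hi j \<and> vtx p \<in> N" if "okt j p" for j p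
    using that vtx_N by (auto simp: okt_def)
  show "j \<in> L \<and> lo j \<le> q \<and> q \<le> hi j \<and> vtx q \<in> N" if "okh j q" for j q
    using that vtx_N by (auto simp: okh_def)
  show "j = j' \<and> p = p'" if "okt j p" "okt j' p'" "vtx p = vtx p'" for j p j' p'
    using vtx_inj_tail[OF that] okt_leg that by auto
  show "j = j' \<and> q = q'" if "okh j q" "okh j' q'" "vtx q = vtx q'" for j q j' q'
    using vtx_inj_head[OF that] okh_leg that by auto
  show "if j = j' then q = p else q = hi j \<and> p = lo j'" if "okh j q" "okt j' p" "vtx q = vtx p" for j q j' p
    using okh_okt_same[OF that] .
  show "\<exists>j p. okt j p \<and> vtx p = v" if v: "v \<in> N" for v
  proof (cases "v \<le> E")
    case True
    then obtain j where "j \<in> L" "lo j \<le> v" "v < hi j" using leg_exists[of v] v by (auto simp: N_def)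
    then show ?thesis using True by (intro exI[of _ j] exI[of _ v]) (auto simp: okt_def vtx_def)
  next
    case False
    then have "\<not> cyc" "v = E + 1" using v by (auto simp: N_def num_inner_eq split: if_splits)
    then show ?thesis using hi_r lo_less_hi[of r] r_pos
      by (intro exI[of _ r] exI[of _ v]) (auto simp: okt_def vtx_def L_def)
  qed
  show "\<exists>j q. okh j q \<and> vtx q = v" if v: "v \<in> N" for v
  proof -
    have top: ?thesis if "2 \<le> q" "q \<le> E + 1" "vtx q = v" for q
    proof -
      have "1 \<le> q - 1" "q - 1 \<le> E" using that by linarith+
      then obtain j where "j \<in> L" "lo j \<le> q - 1" "q - 1 < hi j" using leg_exists[of "q - 1"] by blast
      then show ?thesis using that by (intro exI[of _ j] exI[of _ q]) (auto simp: okh_def)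
    qed
    consider "2 \<le> v" | "v = 1" "cyc" | "v = 1" "\<not> cyc" using v by (force simp: N_def)
    then show ?thesis
    proof cases
      case 1
      then show ?thesis using top[of v] v by (auto simp: N_def num_inner_eq vtx_def split: if_splits)
    next
      case 2
      then show ?thesis using top[of "E + 1"] E_pos by (auto simp: vtx_def)
    next
      case 3
      then show ?thesis using lo_1 lo_less_hi[of 1] r_pos
        by (intro exI[of _ 1] exI[of _ 1]) (auto simp: okh_def vtx_def L_def)
    qed
  qed
  have "bij_betw (inv_into UNIV w) (Inner ` N) UNIV"
    using bij_betw_inv_into[OF w] by (simp add: inner_vertices_eq)
  moreover have "bij_betw Inner N (Inner ` N)" by (simp add: bij_betw_def inj_on_def)
  ultimately show "bij_betw ax N UNIV"
    unfolding ax_def using bij_betw_trans[of Inner N "Inner ` N" "inv_into UNIV w" UNIV] by (simp add: comp_def)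
qed

lemma okt_low: "j \<in> L \<Longrightarrow> okt j (lo j)"
  using lo_less_hi[of j] by (simp add: okt_def)

lemma okh_high: "j \<in> L \<Longrightarrow> okh j (hi j)"
  using lo_less_hi[of j] by (simp add: okh_def)

lemma adj_iff:
  assumes "j \<in> L" "j' \<in> L"
  shows "A.adj j j' \<longleftrightarrow> j' = Suc j \<or> cyc \<and> j = r \<and> j' = 1"
proof
  assume a: "A.adj j j'"
  then have e: "vtx (hi j) = vtx (lo j')" "j \<noteq> j'" by (auto simp: A.adj_def)
  show "j' = Suc j \<or> cyc \<and> j = r \<and> j' = 1"
  proof (cases "cyc \<and> hi j = E + 1")
    case True
    then have "lo j' = 1" using e lo_ge_1[of j'] lo_less_hi[OF assms(2)] hi_le[OF assms(2)]
      by (auto simp: vtx_def split: if_splits)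
    then show ?thesis using hi_eq_top lo_eq_1 assms True by blast
  next
    case False
    have "lo j' \<le> E" using lo_less_hi[OF assms(2)] hi_le[OF assms(2)] by simp
    then have hl: "hi j = lo j'" using False e by (auto simp: vtx_def split: if_splits)
    then have "j < j'" using hi_le_lo[of j' j] lo_less_hi assms e(2) by (metis leD linorder_neqE_nat nat_less_le order.strict_trans)
    moreover have "\<not> Suc j < j'"
      using hi_le_lo[of "Suc j" j'] hi_le_lo[of j "Suc j"] lo_less_hi[of "Suc j"] hl assms by (force simp: L_def)
    ultimately show ?thesis by simp
  qed
next
  assume "j' = Suc j \<or> cyc \<and> j = r \<and> j' = 1"
  then show "A.adj j j'"
    using okh_high[OF assms(1)] okt_low[OF assms(2)] cyc_r assms lo_1 hi_r
    by (auto simp: A.adj_def vtx_def lo_def hi_def)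
qed

lemma adj_L: "A.adj j j' \<Longrightarrow> j \<in> L \<and> j' \<in> L"
  by (auto simp: A.adj_def dest: A.okt A.okh)

text \<open>Across the seam of a cycle this holds because the number of legs is even.\<close>

lemma adj_parity: "A.adj j j' \<Longrightarrow> odd j \<longleftrightarrow> even j'"
  using adj_iff[of j j'] adj_L[of j j'] cyc_even by auto

text \<open>Positions above the low end are heads, those below the high end are tails, and either
  kind determines its leg. So one of the two positions is a low end and one is a high end.\<close>

lemma share_vertex:
  assumes "j \<in> L" "j' \<in> L" "j \<noteq> j'" "lo j \<le> i" "i \<le> hi j" "lo j' \<le> i'" "i' \<le> hi j'" "vtx i = vtx i'"
  shows "i = hi j \<and> i' = lo j' \<and> A.adj j j' \<or> i = lo j \<and> i' = hi j' \<and> A.adj j' j"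
proof -
  have h: "okh j x" if "lo j < x" "x \<le> hi j" "j \<in> L" for j x using that by (simp add: okh_def)
  have t: "okt j x" if "lo j \<le> x" "x < hi j" "j \<in> L" for j x using that by (simp add: okt_def)
  have "i = lo j \<or> i' = lo j'"
    using A.head_unique[of j i j' i'] h[of j i] h[of j' i'] assms by (metis le_neq_implies_less)
  moreover have "i = hi j \<or> i' = hi j'"
    using A.tail_unique[of j i j' i'] t[of j i] t[of j' i'] assms by (metis le_neq_implies_less)
  moreover have "lo j < hi j" "lo j' < hi j'" using lo_less_hi assms by auto
  ultimately have "i = hi j \<and> i' = lo j' \<or> i = lo j \<and> i' = hi j'" by auto
  then show ?thesis using assms okh_high okt_low by (auto simp: A.adj_def)
qed

end

section \<open>Routes as coded arcs\<close>

context framed_shape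
begin

text \<open>An odd leg runs upward, so its low edge comes from the source; an even leg runs
  downward, so its low edge goes to the sink. Without a turn the edge has the label of the leg, with
  a turn the other label.\<close>

definition lowE :: "nat \<Rightarrow> nat \<Rightarrow> edge" where
  "lowE j p = (if odd j then SourceEdge (vtx (max p (lo j))) (if p < lo j then 2 else 1)
     else SinkEdge (vtx (max p (lo j))) (if p < lo j then 1 else 2))"

definition highE :: "nat \<Rightarrow> nat \<Rightarrow> edge" where
  "highE j q = (if odd j then SinkEdge (vtx (min q (hi j))) (if hi j < q then 2 else 1)
     else SourceEdge (vtx (min q (hi j))) (if hi j < q then 1 else 2))"

definition seg :: "nat \<Rightarrow> nat \<Rightarrow> edge list" where
  "seg u v = map InnerEdge [u..<v]"

fun up :: "nat \<times> nat \<times> nat \<Rightarrow> edge list" where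
  "up (j, p, q) = lowE j p # seg (max p (lo j)) (min q (hi j)) @ [highE j q]"

definition rt :: "nat \<times> nat \<times> nat \<Rightarrow> edge list" where
  "rt c = (if odd (fst c) then up c else rev (up c))"

definition low_pos :: "nat \<Rightarrow> nat \<Rightarrow> bool" where
  "low_pos j p \<longleftrightarrow> j \<in> L \<and> (p = lo j - 1 \<or> okt j p)"

definition high_pos :: "nat \<Rightarrow> nat \<Rightarrow> bool" where
  "high_pos j q \<longleftrightarrow> j \<in> L \<and> (q = hi j + 1 \<or> okh j q)"

text \<open>Unlike \<open>A.arcs\<close>, the codes include the exceptional routes:
  \<open>p = q\<close> for the short ones, both turns absent for the long ones.\<close>

definition codes :: "(nat \<times> nat \<times> nat) set" where
  "codes = {(j, p, q). low_pos j p \<and> high_pos j q \<and> p \<le> q}"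

fun exc :: "nat \<times> nat \<times> nat \<Rightarrow> bool" where
  "exc (j, p, q) \<longleftrightarrow> p = q \<or> p < lo j \<and> hi j < q"

section \<open>Edges of the DAG in terms of positions\<close>

lemma low_posD:
  assumes "low_pos j p"
  shows "j \<in> L" "lo j \<le> p \<Longrightarrow> okt j p" "p < lo j \<Longrightarrow> p = lo j - 1" "lo j - 1 \<le> p" "p \<le> hi j"
  using assms lo_ge_1[of j] lo_less_hi[of j] by (auto simp: low_pos_def okt_def)

lemma high_posD:
  assumes "high_pos j q"
  shows "j \<in> L" "q \<le> hi j \<Longrightarrow> okh j q" "hi j < q \<Longrightarrow> q = hi j + 1" "q \<le> hi j + 1" "lo j \<le> q"
  using assms lo_less_hi[of j] by (auto simp: high_pos_def okh_def)

lemma codesD: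
  assumes "(j, p, q) \<in> codes"
  shows "low_pos j p" "high_pos j q" "p \<le> q" "max p (lo j) \<le> min q (hi j)" "lo j \<le> max p (lo j)" "min q (hi j) \<le> hi j"
proof -
  show 1: "low_pos j p" "high_pos j q" "p \<le> q" using assms by (auto simp: codes_def)
  show "max p (lo j) \<le> min q (hi j)"
    using low_posD[OF 1(1)] high_posD[OF 1(2)] lo_less_hi[of j] 1(3) by auto
qed auto

lemma codes_arcs: "c \<in> codes \<and> \<not> exc c \<longleftrightarrow> c \<in> A.arcs"
proof -
  obtain j p q where c: "c = (j, p, q)" by (cases c)
  show ?thesis
  proof
    assume "c \<in> codes \<and> \<not> exc c"
    then have c': "(j, p, q) \<in> codes" "\<not> exc (j, p, q)" using c by auto
    then show "c \<in> A.arcs" unfolding c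
      using low_posD[of j p] high_posD[of j q] codesD[of j p q] by (intro A.arcsI') (auto simp: not_less)
  next
    assume a: "c \<in> A.arcs"
    note C = A.arcsE[OF a[unfolded c]]
    have "p = lo j - 1 \<or> okt j p" "q = hi j + 1 \<or> okh j q" using C(3-6) not_le by blast+
    then have "low_pos j p" "high_pos j q" using C(1) by (auto simp: low_pos_def high_pos_def)
    then show "c \<in> codes \<and> \<not> exc c" using C by (auto simp: c codes_def)
  qed
qed

lemma inner_pos:
  assumes "j \<in> L" "lo j \<le> i" "i < hi j"
  shows "leg_index s i = j" "1 \<le> i" "i \<le> E" "next_vertex s i = vtx (Suc i)" "vtx i = i"
    "inner_tail s i = (if odd j then vtx i else vtx (Suc i))"
    "inner_head s i = (if odd j then vtx (Suc i) else vtx i)"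
    "inner_label s i = (if odd j then 2 else 1)"
proof -
  show leg: "leg_index s i = j" by (rule leg_index_eq[OF assms])
  show i: "1 \<le> i" "i \<le> E" using assms lo_ge_1[of j] hi_le[of j] by auto
  have "next_vertex s i = (if cyc then i mod E + 1 else i + 1)"
    unfolding cyc_def E_def by (cases s) auto
  also have "\<dots> = vtx (Suc i)" using i by (cases "i = E") (auto simp: vtx_def)
  finally show nv: "next_vertex s i = vtx (Suc i)" .
  show v: "vtx i = i" using i by (simp add: vtx_def)
  show "inner_tail s i = (if odd j then vtx i else vtx (Suc i))"
    "inner_head s i = (if odd j then vtx (Suc i) else vtx i)"
    "inner_label s i = (if odd j then 2 else 1)"
    by (simp_all add: inner_tail_def inner_head_def inner_label_def leg nv v)
qed

lemma leg_of_edge: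
  assumes "1 \<le> i" "i \<le> E" obtains j where "j \<in> L" "lo j \<le> i" "i < hi j"
  using leg_exists[OF assms] by blast

lemma InnerEdge_mem: "InnerEdge i \<in> dag_edges s \<longleftrightarrow> 1 \<le> i \<and> i \<le> E"
  by (auto simp: dag_edges_def E_def)

text \<open>Translates the conditions on source and sink edges in \<open>dag_edges\<close>: inner
  edge \<open>i\<close> joins the positions \<open>i\<close> and \<open>Suc i\<close> of its leg,
  and its label and direction depend on the parity of the leg.\<close>

lemma inner_clash:
  shows "(\<exists>i\<in>{1..sum_list (lens s)}. inner_head s i = v \<and> inner_label s i = 1) \<longleftrightarrow>
      (\<exists>j i. j \<in> L \<and> even j \<and> lo j \<le> i \<and> i < hi j \<and> vtx i = v)"
    "(\<exists>i\<in>{1..sum_list (lens s)}. inner_head s i = v \<and> inner_label s i = 2) \<longleftrightarrow>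
      (\<exists>j i. j \<in> L \<and> odd j \<and> lo j < i \<and> i \<le> hi j \<and> vtx i = v)"
    "(\<exists>i\<in>{1..sum_list (lens s)}. inner_tail s i = v \<and> inner_label s i = 1) \<longleftrightarrow>
      (\<exists>j i. j \<in> L \<and> even j \<and> lo j < i \<and> i \<le> hi j \<and> vtx i = v)"
    "(\<exists>i\<in>{1..sum_list (lens s)}. inner_tail s i = v \<and> inner_label s i = 2) \<longleftrightarrow>
      (\<exists>j i. j \<in> L \<and> odd j \<and> lo j \<le> i \<and> i < hi j \<and> vtx i = v)"
proof -
  have ex: "(\<exists>i\<in>{1..sum_list (lens s)}. P i) \<longleftrightarrow> (\<exists>j i. j \<in> L \<and> lo j \<le> i \<and> i < hi j \<and> P i)" for P
  proof
    assume "\<exists>i\<in>{1..sum_list (lens s)}. P i"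
    then obtain i where i: "1 \<le> i" "i \<le> E" "P i" by (auto simp: E_def)
    obtain j where "j \<in> L" "lo j \<le> i" "i < hi j" by (rule leg_of_edge[OF i(1,2)])
    then show "\<exists>j i. j \<in> L \<and> lo j \<le> i \<and> i < hi j \<and> P i" using i by blast
  next
    assume "\<exists>j i. j \<in> L \<and> lo j \<le> i \<and> i < hi j \<and> P i"
    then obtain j i where "j \<in> L" "lo j \<le> i" "i < hi j" "P i" by blast
    then show "\<exists>i\<in>{1..sum_list (lens s)}. P i" using inner_pos(2,3)[of j i] by (auto simp: E_def)
  qed
  have shift: "(\<exists>i. lo j < i \<and> i \<le> hi j \<and> Q i) \<longleftrightarrow> (\<exists>i. lo j \<le> i \<and> i < hi j \<and> Q (Suc i))" for j Q
  proof
    assume "\<exists>i. lo j < i \<and> i \<le> hi j \<and> Q i"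
    then obtain i where "lo j < i" "i \<le> hi j" "Q i" by blast
    then show "\<exists>i. lo j \<le> i \<and> i < hi j \<and> Q (Suc i)" by (intro exI[of _ "i - 1"]) auto
  next
    assume "\<exists>i. lo j \<le> i \<and> i < hi j \<and> Q (Suc i)"
    then obtain i where "lo j \<le> i" "i < hi j" "Q (Suc i)" by blast
    then show "\<exists>i. lo j < i \<and> i \<le> hi j \<and> Q i" by (intro exI[of _ "Suc i"]) auto
  qed
  show "(\<exists>i\<in>{1..sum_list (lens s)}. inner_head s i = v \<and> inner_label s i = 1) \<longleftrightarrow>
      (\<exists>j i. j \<in> L \<and> even j \<and> lo j \<le> i \<and> i < hi j \<and> vtx i = v)"
    unfolding ex
    by (intro ex_cong1) (auto simp: inner_pos(7,8) split: if_splits)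
  show "(\<exists>i\<in>{1..sum_list (lens s)}. inner_head s i = v \<and> inner_label s i = 2) \<longleftrightarrow>
      (\<exists>j i. j \<in> L \<and> odd j \<and> lo j < i \<and> i \<le> hi j \<and> vtx i = v)"
  proof -
    have "inner_head s i = v \<and> inner_label s i = 2 \<longleftrightarrow> odd j \<and> vtx (Suc i) = v"
      if "j \<in> L" "lo j \<le> i" "i < hi j" for j i
      using inner_pos(7,8)[OF that] by auto
    then have "(\<exists>j i. j \<in> L \<and> lo j \<le> i \<and> i < hi j \<and> inner_head s i = v \<and> inner_label s i = 2) \<longleftrightarrow>
        (\<exists>j. j \<in> L \<and> odd j \<and> (\<exists>i. lo j \<le> i \<and> i < hi j \<and> vtx (Suc i) = v))" by metis
    then show ?thesis unfolding ex shift[of _ "\<lambda>i. vtx i = v", symmetric] by blast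
  qed
  show "(\<exists>i\<in>{1..sum_list (lens s)}. inner_tail s i = v \<and> inner_label s i = 1) \<longleftrightarrow>
      (\<exists>j i. j \<in> L \<and> even j \<and> lo j < i \<and> i \<le> hi j \<and> vtx i = v)"
  proof -
    have "inner_tail s i = v \<and> inner_label s i = 1 \<longleftrightarrow> even j \<and> vtx (Suc i) = v"
      if "j \<in> L" "lo j \<le> i" "i < hi j" for j i
      using inner_pos(6,8)[OF that] by auto
    then have "(\<exists>j i. j \<in> L \<and> lo j \<le> i \<and> i < hi j \<and> inner_tail s i = v \<and> inner_label s i = 1) \<longleftrightarrow>
        (\<exists>j. j \<in> L \<and> even j \<and> (\<exists>i. lo j \<le> i \<and> i < hi j \<and> vtx (Suc i) = v))" by metis
    then show ?thesis unfolding ex shift[of _ "\<lambda>i. vtx i = v", symmetric] by blast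
  qed
  show "(\<exists>i\<in>{1..sum_list (lens s)}. inner_tail s i = v \<and> inner_label s i = 2) \<longleftrightarrow>
      (\<exists>j i. j \<in> L \<and> odd j \<and> lo j \<le> i \<and> i < hi j \<and> vtx i = v)"
    unfolding ex
    by (intro ex_cong1) (auto simp: inner_pos(6,8) split: if_splits)
qed

lemma SourceEdge_mem:
  "SourceEdge v l \<in> dag_edges s \<longleftrightarrow> v \<in> N \<and>
     (l = 1 \<and> \<not> (\<exists>j i. j \<in> L \<and> even j \<and> lo j \<le> i \<and> i < hi j \<and> vtx i = v) \<or>
      l = 2 \<and> \<not> (\<exists>j i. j \<in> L \<and> odd j \<and> lo j < i \<and> i \<le> hi j \<and> vtx i = v))"
proof -
  have "SourceEdge v l \<in> dag_edges s \<longleftrightarrow> v \<in> N \<and> l \<in> {1, 2} \<and>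
    \<not> (\<exists>i\<in>{1..sum_list (lens s)}. inner_head s i = v \<and> inner_label s i = l)"
    by (auto simp: dag_edges_def N_def)
  then show ?thesis using inner_clash(1,2)[of v] by (cases "l = 1"; cases "l = 2") simp_all
qed

lemma SinkEdge_mem:
  "SinkEdge v l \<in> dag_edges s \<longleftrightarrow> v \<in> N \<and>
     (l = 1 \<and> \<not> (\<exists>j i. j \<in> L \<and> even j \<and> lo j < i \<and> i \<le> hi j \<and> vtx i = v) \<or>
      l = 2 \<and> \<not> (\<exists>j i. j \<in> L \<and> odd j \<and> lo j \<le> i \<and> i < hi j \<and> vtx i = v))"
proof -
  have "SinkEdge v l \<in> dag_edges s \<longleftrightarrow> v \<in> N \<and> l \<in> {1, 2} \<and>
    \<not> (\<exists>i\<in>{1..sum_list (lens s)}. inner_tail s i = v \<and> inner_label s i = l)"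
    by (auto simp: dag_edges_def N_def)
  then show ?thesis using inner_clash(3,4)[of v] by (cases "l = 1"; cases "l = 2") simp_all
qed

lemma okt_less: "j \<in> L \<Longrightarrow> lo j \<le> i \<Longrightarrow> i < hi j \<Longrightarrow> okt j i"
  by (simp add: okt_def)

lemma okh_greater: "j \<in> L \<Longrightarrow> lo j < i \<Longrightarrow> i \<le> hi j \<Longrightarrow> okh j i"
  by (simp add: okh_def)

text \<open>Legs meeting at a junction have opposite parity; so a head and a tail at one vertex on
  legs of equal parity are the same position.\<close>

lemma parity_clash:
  "okt j p \<Longrightarrow> okt j' p' \<Longrightarrow> vtx p = vtx p' \<Longrightarrow> odd j \<longleftrightarrow> odd j'"
  "okh j p \<Longrightarrow> okh j' p' \<Longrightarrow> vtx p = vtx p' \<Longrightarrow> odd j \<longleftrightarrow> odd j'"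
  "okh j q \<Longrightarrow> okt j' p \<Longrightarrow> vtx q = vtx p \<Longrightarrow> (odd j \<longleftrightarrow> odd j') \<Longrightarrow> j = j' \<and> q = p"
proof -
  show "okt j p \<Longrightarrow> okt j' p' \<Longrightarrow> vtx p = vtx p' \<Longrightarrow> odd j \<longleftrightarrow> odd j'" using A.tail_unique by blast
  show "okh j p \<Longrightarrow> okh j' p' \<Longrightarrow> vtx p = vtx p' \<Longrightarrow> odd j \<longleftrightarrow> odd j'" using A.head_unique by blast
  assume a: "okh j q" "okt j' p" "vtx q = vtx p" "odd j \<longleftrightarrow> odd j'"
  show "j = j' \<and> q = p"
  proof (cases "j = j'")
    case True then show ?thesis using A.head_tail[OF a(1-3)] by simp
  next
    case False
    then have "A.adj j j'" using A.head_tail[OF a(1-3)] a by (auto simp: A.adj_def)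
    then show ?thesis using adj_parity a(4) by blast
  qed
qed

lemma lowE_mem:
  assumes "low_pos j p" shows "lowE j p \<in> dag_edges s"
proof -
  note P = low_posD[OF assms]
  have V: "vtx (max p (lo j)) \<in> N" using P lo_less_hi[OF P(1)] by (intro vtx_N[OF P(1)]) auto
  have t: "okt j (max p (lo j))" using P okt_low by (cases "lo j \<le> p") (auto simp: max_def)
  have l: "max p (lo j) = lo j" if "p < lo j" using that by simp
  show ?thesis
  proof (cases "odd j")
    case True
    have "\<not> (\<exists>j' i. j' \<in> L \<and> even j' \<and> lo j' \<le> i \<and> i < hi j' \<and> vtx i = vtx (max p (lo j)))"
      using parity_clash(1)[OF t] okt_less True by metis
    moreover have "\<not> (\<exists>j' i. j' \<in> L \<and> odd j' \<and> lo j' < i \<and> i \<le> hi j' \<and> vtx i = vtx (max p (lo j)))" if "p < lo j"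
      using parity_clash(3)[OF _ t] okh_greater True l[OF that] by (metis less_irrefl)
    ultimately show ?thesis using V True by (auto simp: lowE_def SourceEdge_mem)
  next
    case False
    have "\<not> (\<exists>j' i. j' \<in> L \<and> odd j' \<and> lo j' \<le> i \<and> i < hi j' \<and> vtx i = vtx (max p (lo j)))"
      using parity_clash(1)[OF t] okt_less False by metis
    moreover have "\<not> (\<exists>j' i. j' \<in> L \<and> even j' \<and> lo j' < i \<and> i \<le> hi j' \<and> vtx i = vtx (max p (lo j)))" if "p < lo j"
      using parity_clash(3)[OF _ t] okh_greater False l[OF that] by (metis less_irrefl)
    ultimately show ?thesis using V False by (auto simp: lowE_def SinkEdge_mem)
  qed
qed

lemma highE_mem:
  assumes "high_pos j q" shows "highE j q \<in> dag_edges s"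
proof -
  note P = high_posD[OF assms]
  have V: "vtx (min q (hi j)) \<in> N" using P lo_less_hi[OF P(1)] by (intro vtx_N[OF P(1)]) auto
  have t: "okh j (min q (hi j))" using P okh_high by (cases "q \<le> hi j") (auto simp: min_def)
  have l: "min q (hi j) = hi j" if "hi j < q" using that by simp
  show ?thesis
  proof (cases "odd j")
    case True
    have "\<not> (\<exists>j' i. j' \<in> L \<and> even j' \<and> lo j' < i \<and> i \<le> hi j' \<and> vtx i = vtx (min q (hi j)))"
      using parity_clash(2)[OF t] okh_greater True by metis
    moreover have "\<not> (\<exists>j' i. j' \<in> L \<and> odd j' \<and> lo j' \<le> i \<and> i < hi j' \<and> vtx i = vtx (min q (hi j)))" if "hi j < q"
      using parity_clash(3)[OF t] okt_less True l[OF that] by (metis less_irrefl)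
    ultimately show ?thesis using V True by (auto simp: highE_def SinkEdge_mem)
  next
    case False
    have "\<not> (\<exists>j' i. j' \<in> L \<and> odd j' \<and> lo j' < i \<and> i \<le> hi j' \<and> vtx i = vtx (min q (hi j)))"
      using parity_clash(2)[OF t] okh_greater False by metis
    moreover have "\<not> (\<exists>j' i. j' \<in> L \<and> even j' \<and> lo j' \<le> i \<and> i < hi j' \<and> vtx i = vtx (min q (hi j)))" if "hi j < q"
      using parity_clash(3)[OF t] okt_less False l[OF that] by (metis less_irrefl)
    ultimately show ?thesis using V False by (auto simp: highE_def SourceEdge_mem)
  qed
qed

text \<open>Above the low end an inner edge of the leg enters with label 2, so a source edge with
  label 2 exists only at \<open>lo j\<close>, where it stands for an absent turn. The next three
  lemmas treat the other end and the other parity.\<close>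

lemma source_edge_odd:
  assumes "SourceEdge (vtx i) l \<in> dag_edges s" "odd j" "j \<in> L" "lo j \<le> i" "okt j i"
  shows "\<exists>p. low_pos j p \<and> max p (lo j) = i \<and> lowE j p = SourceEdge (vtx i) l"
proof -
  have "l = 1 \<or> l = 2 \<and> i = lo j"
    using assms okh_greater[of j i] A.okt[OF assms(5)] unfolding SourceEdge_mem by force
  then show ?thesis
  proof
    assume "l = 1"
    then show ?thesis using assms by (intro exI[of _ i]) (auto simp: low_pos_def lowE_def)
  next
    assume "l = 2 \<and> i = lo j"
    then show ?thesis using assms lo_ge_1[of j] by (intro exI[of _ "lo j - 1"]) (auto simp: low_pos_def lowE_def)
  qed
qed

lemma sink_edge_odd:
  assumes "SinkEdge (vtx i) l \<in> dag_edges s" "odd j" "j \<in> L" "i \<le> hi j" "okh j i"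
  shows "\<exists>q. high_pos j q \<and> min q (hi j) = i \<and> highE j q = SinkEdge (vtx i) l"
proof -
  have "l = 1 \<or> l = 2 \<and> i = hi j"
    using assms A.okh[OF assms(5)] unfolding SinkEdge_mem by (metis le_neq_implies_less)
  then show ?thesis
  proof
    assume "l = 1"
    then show ?thesis using assms by (intro exI[of _ i]) (auto simp: high_pos_def highE_def)
  next
    assume "l = 2 \<and> i = hi j"
    then show ?thesis using assms by (intro exI[of _ "hi j + 1"]) (auto simp: high_pos_def highE_def)
  qed
qed

lemma source_edge_even:
  assumes "SourceEdge (vtx i) l \<in> dag_edges s" "even j" "j \<in> L" "i \<le> hi j" "okh j i"
  shows "\<exists>q. high_pos j q \<and> min q (hi j) = i \<and> highE j q = SourceEdge (vtx i) l"
proof -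
  have "l = 2 \<or> l = 1 \<and> i = hi j"
    using assms A.okh[OF assms(5)] unfolding SourceEdge_mem by (metis le_neq_implies_less)
  then show ?thesis
  proof
    assume "l = 2"
    then show ?thesis using assms by (intro exI[of _ i]) (auto simp: high_pos_def highE_def)
  next
    assume "l = 1 \<and> i = hi j"
    then show ?thesis using assms by (intro exI[of _ "hi j + 1"]) (auto simp: high_pos_def highE_def)
  qed
qed

lemma sink_edge_even:
  assumes "SinkEdge (vtx i) l \<in> dag_edges s" "even j" "j \<in> L" "lo j \<le> i" "okt j i"
  shows "\<exists>p. low_pos j p \<and> max p (lo j) = i \<and> lowE j p = SinkEdge (vtx i) l"
proof -
  have "l = 2 \<or> l = 1 \<and> i = lo j"
    using assms A.okt[OF assms(5)] unfolding SinkEdge_mem by (metis le_neq_implies_less)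
  then show ?thesis
  proof
    assume "l = 2"
    then show ?thesis using assms by (intro exI[of _ i]) (auto simp: low_pos_def lowE_def)
  next
    assume "l = 1 \<and> i = lo j"
    then show ?thesis using assms lo_ge_1[of j] by (intro exI[of _ "lo j - 1"]) (auto simp: low_pos_def lowE_def)
  qed
qed

text \<open>At a junction both legs enter or both leave, so the vertex lacks either source or sink
  edges. Elsewhere the head place and the tail place of a vertex coincide.\<close>

lemma trivial_route:
  assumes "SourceEdge v l \<in> dag_edges s" "SinkEdge v l' \<in> dag_edges s"
  shows "\<exists>c\<in>codes. rt c = [SourceEdge v l, SinkEdge v l']"
proof -
  have "v \<in> N" using assms by (simp add: SourceEdge_mem)
  then obtain j q j' p where q: "okh j q" "vtx q = v" and p: "okt j' p" "vtx p = v"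
    using A.head_exists A.tail_exists by metis
  have J: "j \<in> L" "j' \<in> L" using A.okh[OF q(1)] A.okt[OF p(1)] by auto
  have same: "j = j' \<and> q = p"
  proof (rule ccontr)
    assume no: "\<not> (j = j' \<and> q = p)"
    then have "j \<noteq> j'" and e: "q = hi j" "p = lo j'" using A.head_tail[OF q(1) p(1)] q p by (auto split: if_splits)
    then have adj: "A.adj j j'" using q p by (auto simp: A.adj_def)
    have lt: "lo j < hi j" "lo j' < hi j'" using lo_less_hi J by auto
    show False
    proof (cases "odd j")
      case True
      then show False using adj_parity[OF adj] assms(1) J lt q p e unfolding SourceEdge_mem by auto
    next
      case False
      then show False using adj_parity[OF adj] assms(2) J lt q p e unfolding SinkEdge_mem by auto
    qed
  qed
  then have j: "okt j q" using p by simp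
  have b: "lo j \<le> q" "q \<le> hi j" using A.okh[OF q(1)] by auto
  have fin: "(j, p', q') \<in> codes" if "low_pos j p'" "max p' (lo j) = q" "high_pos j q'" "min q' (hi j) = q" for p' q'
    using that low_posD[OF that(1)] high_posD[OF that(3)] unfolding codes_def by auto
  show ?thesis
  proof (cases "odd j")
    case True
    obtain p' where p': "low_pos j p'" "max p' (lo j) = q" "lowE j p' = SourceEdge v l"
      using source_edge_odd[of q l j] assms q True J b j by auto
    obtain q' where q': "high_pos j q'" "min q' (hi j) = q" "highE j q' = SinkEdge v l'"
      using sink_edge_odd[of q l' j] assms q True J b j by auto
    show ?thesis using fin[OF p'(1,2) q'(1,2)] p' q' True
      by (intro bexI[of _ "(j, p', q')"]) (auto simp: rt_def seg_def)
  next
    case False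
    obtain p' where p': "low_pos j p'" "max p' (lo j) = q" "lowE j p' = SinkEdge v l'"
      using sink_edge_even[of q l' j] assms q False J b j by auto
    obtain q' where q': "high_pos j q'" "min q' (hi j) = q" "highE j q' = SourceEdge v l"
      using source_edge_even[of q l j] assms q False J b j by auto
    show ?thesis using fin[OF p'(1,2) q'(1,2)] p' q' False
      by (intro bexI[of _ "(j, p', q')"]) (auto simp: rt_def seg_def)
  qed
qed

section \<open>Routes and their codes\<close>

fun wk :: "vertex \<Rightarrow> edge list \<Rightarrow> vertex \<Rightarrow> bool" where
  "wk u [] v \<longleftrightarrow> u = v"
| "wk u (e # es) v \<longleftrightarrow> edge_tail s e = u \<and> wk (edge_head s e) es v"

lemma wk_append: "wk u (p @ q) v \<longleftrightarrow> (\<exists>x. wk u p x \<and> wk x q v)"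
  by (induction p arbitrary: u) auto

lemma dag_simps [simp]:
  "verts (graph (dag s)) = {Source, Sink} \<union> Inner ` N" "pre_digraph.arcs (graph (dag s)) = dag_edges s"
  "tail (graph (dag s)) = edge_tail s" "head (graph (dag s)) = edge_head s"
  "src (dag s) = Source" "snk (dag s) = Sink" "lab (dag s) = edge_label s"
  by (simp_all add: dag_def N_def)

lemma cas_wk:
  assumes "tail G = edge_tail s" "head G = edge_head s"
  shows "pre_digraph.cas G u p v \<longleftrightarrow> wk u p v"
  by (induction p arbitrary: u) (simp_all add: assms pre_digraph.cas.simps)

lemma route_iff:
  "route (dag s) R \<longleftrightarrow> set R \<subseteq> dag_edges s \<and> wk Source R Sink \<and> distinct (map (edge_tail s) R @ [Sink])"
proof (cases "R = []")
  case True
  then show ?thesis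
    by (simp add: route_def pre_digraph.apath_def pre_digraph.awalk_def pre_digraph.cas.simps)
next
  case False
  have last: "edge_head s (last R) = Sink" if "wk Source R Sink"
  proof -
    have "R = butlast R @ [last R]" using False by simp
    then show ?thesis using that wk_append[of Source "butlast R" "[last R]" Sink] by auto
  qed
  have "route (dag s) R \<longleftrightarrow> (set R \<subseteq> dag_edges s \<and> wk Source R Sink) \<and>
      distinct (map (edge_tail s) R @ [edge_head s (last R)])"
    using False cas_wk[of "graph (dag s)"]
    by (simp add: route_def pre_digraph.apath_def pre_digraph.awalk_def pre_digraph.awalk_verts_conv)
  then show ?thesis using last by metis
qed

lemma wk_Sink: "wk Sink es v \<Longrightarrow> es = []"
proof (cases es)
  case (Cons e es')
  assume "wk Sink es v"
  then show ?thesis using Cons by (cases e) auto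
qed simp

lemma seg_Cons: "u < v \<Longrightarrow> seg u v = InnerEdge u # seg (Suc u) v"
  by (simp add: seg_def upt_conv_Cons)

lemma seg_snoc: "u \<le> v \<Longrightarrow> seg u (Suc v) = seg u v @ [InnerEdge v]"
  by (simp add: seg_def)

lemma seg_Nil: "v \<le> u \<Longrightarrow> seg u v = []"
  by (simp add: seg_def)

text \<open>The only inner edge that can leave a head position of an odd leg is the next edge of
  that leg, so the walk stays on the leg until it takes a sink edge.\<close>

lemma walk_odd:
  assumes "set es \<subseteq> dag_edges s" "wk (Inner (vtx x)) es Sink" "odd j" "okh j x"
  shows "\<exists>v l. x \<le> v \<and> v \<le> hi j \<and> okh j v \<and> es = seg x v @ [SinkEdge (vtx v) l]"
  using assms
proof (induction es arbitrary: x)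
  case (Cons e es)
  have J: "j \<in> L" "lo j \<le> x" "x \<le> hi j" using A.okh[OF Cons.prems(4)] by auto
  show ?case
  proof (cases e)
    case (SourceEdge v l)
    then show ?thesis using Cons.prems by simp
  next
    case (SinkEdge v l)
    then have "v = vtx x" "es = []" using Cons.prems wk_Sink by auto
    then show ?thesis using SinkEdge J Cons.prems by (intro exI[of _ x] exI[of _ l]) (simp add: seg_Nil)
  next
    case (InnerEdge i)
    then have "1 \<le> i" "i \<le> E" using Cons.prems InnerEdge_mem by auto
    then obtain j' where j': "j' \<in> L" "lo j' \<le> i" "i < hi j'" by (rule leg_of_edge)
    note I = inner_pos[OF j']
    have t: "inner_tail s i = vtx x" using Cons.prems InnerEdge by simp
    have "odd j'"
    proof (rule ccontr)
      assume "\<not> odd j'"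
      then show False using parity_clash(2)[of j' "Suc i" j x] okh_greater[of j' "Suc i"] t I(6) j' Cons.prems by auto
    qed
    then have "j = j' \<and> x = i"
      using parity_clash(3)[OF Cons.prems(4), of j' i] okt_less[OF j'] t I(6) Cons.prems by auto
    then have eq: "j' = j" "i = x" by auto
    have ok: "okh j (Suc x)" using okh_greater[of j "Suc x"] j' eq by auto
    have "wk (Inner (vtx (Suc x))) es Sink" using Cons.prems InnerEdge I(7) eq by simp
    then obtain v l where v: "Suc x \<le> v" "v \<le> hi j" "okh j v" "es = seg (Suc x) v @ [SinkEdge (vtx v) l]"
      using Cons.IH[OF _ _ Cons.prems(3) ok] Cons.prems by auto
    then show ?thesis using InnerEdge eq by (intro exI[of _ v] exI[of _ l]) (auto simp: seg_Cons)
  qed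
qed simp

lemma walk_even:
  assumes "set es \<subseteq> dag_edges s" "wk (Inner (vtx x)) es Sink" "even j" "okt j x"
  shows "\<exists>v l. v \<le> x \<and> lo j \<le> v \<and> okt j v \<and> es = rev (seg v x) @ [SinkEdge (vtx v) l]"
  using assms
proof (induction es arbitrary: x)
  case (Cons e es)
  have J: "j \<in> L" "lo j \<le> x" "x \<le> hi j" using A.okt[OF Cons.prems(4)] by auto
  show ?case
  proof (cases e)
    case (SourceEdge v l)
    then show ?thesis using Cons.prems by simp
  next
    case (SinkEdge v l)
    then have "v = vtx x" "es = []" using Cons.prems wk_Sink by auto
    then show ?thesis using SinkEdge J Cons.prems by (intro exI[of _ x] exI[of _ l]) (simp add: seg_Nil)
  next
    case (InnerEdge i)
    then have "1 \<le> i" "i \<le> E" using Cons.prems InnerEdge_mem by auto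
    then obtain j' where j': "j' \<in> L" "lo j' \<le> i" "i < hi j'" by (rule leg_of_edge)
    note I = inner_pos[OF j']
    have t: "inner_tail s i = vtx x" using Cons.prems InnerEdge by simp
    have "even j'"
    proof (rule ccontr)
      assume "\<not> even j'"
      then show False using parity_clash(1)[of j' i j x] okt_less[of j' i] t I(6) j' Cons.prems by auto
    qed
    then have "j' = j \<and> Suc i = x"
      using parity_clash(3)[of j' "Suc i" j x] okh_greater[of j' "Suc i"] t I(6) Cons.prems j' by auto
    then have eq: "j' = j" "x = Suc i" by auto
    have ok: "okt j i" using okt_less[of j i] j' eq by auto
    have "wk (Inner (vtx i)) es Sink" using Cons.prems InnerEdge I(7) eq \<open>even j'\<close> by simp
    then obtain v l where v: "v \<le> i" "lo j \<le> v" "okt j v" "es = rev (seg v i) @ [SinkEdge (vtx v) l]"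
      using Cons.IH[OF _ _ Cons.prems(3) ok] Cons.prems by auto
    then show ?thesis using InnerEdge eq by (intro exI[of _ v] exI[of _ l]) (auto simp: seg_snoc)
  qed
qed simp

text \<open>The first inner edge determines the leg, and \<open>walk_odd\<close> or
  \<open>walk_even\<close> the rest; without inner edges \<open>trivial_route\<close>
  applies.\<close>

lemma route_imp_code:
  assumes "set R \<subseteq> dag_edges s" "wk Source R Sink"
  shows "\<exists>c\<in>codes. R = rt c"
proof -
  obtain e es where R: "R = e # es" using assms by (cases R) auto
  then obtain v l where e: "e = SourceEdge v l" using assms by (cases e) auto
  have w1: "wk (Inner v) es Sink" and m: "set es \<subseteq> dag_edges s" "SourceEdge v l \<in> dag_edges s" using assms R e by auto
  obtain f fs where es: "es = f # fs" using w1 by (cases es) auto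
  show ?thesis
  proof (cases f)
    case (SourceEdge v' l')
    then show ?thesis using w1 es by simp
  next
    case (SinkEdge v' l')
    then have eq: "v' = v" "fs = []" using w1 es wk_Sink by auto
    then have "SinkEdge v l' \<in> dag_edges s" using m(1) es SinkEdge by simp
    then obtain c where "c \<in> codes" "rt c = [SourceEdge v l, SinkEdge v l']"
      using trivial_route[OF m(2)] by blast
    then show ?thesis using R e es SinkEdge eq by (intro bexI[of _ c]) simp_all
  next
    case (InnerEdge i)
    then have "1 \<le> i" "i \<le> E" using m es InnerEdge_mem by auto
    then obtain j where j: "j \<in> L" "lo j \<le> i" "i < hi j" by (rule leg_of_edge)
    note I = inner_pos[OF j]
    have t: "inner_tail s i = v" "wk (Inner (inner_head s i)) fs Sink" using w1 es InnerEdge by auto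
    have mf: "set fs \<subseteq> dag_edges s" using m es by simp
    have ot: "okt j i" "okh j (Suc i)" using okt_less[OF j] okh_greater[of j "Suc i"] j by auto
    show ?thesis
    proof (cases "odd j")
      case True
      obtain x l' where x: "Suc i \<le> x" "x \<le> hi j" "okh j x" "fs = seg (Suc i) x @ [SinkEdge (vtx x) l']"
        using walk_odd[OF mf _ True ot(2)] t I(7) True by auto
      obtain p where p: "low_pos j p" "max p (lo j) = i" "lowE j p = SourceEdge (vtx i) l"
        using source_edge_odd[of i l j] m(2) t(1) I(6) True j ot by auto
      obtain q where q: "high_pos j q" "min q (hi j) = x" "highE j q = SinkEdge (vtx x) l'"
        using sink_edge_odd[of x l' j] mf x True j by auto
      have "(j, p, q) \<in> codes" using p q x by (auto simp: codes_def)
      moreover have "R = rt (j, p, q)"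
        using True p q x t I(6) R e es InnerEdge by (auto simp: rt_def seg_Cons)
      ultimately show ?thesis by blast
    next
      case False
      obtain x l' where x: "x \<le> i" "lo j \<le> x" "okt j x" "fs = rev (seg x i) @ [SinkEdge (vtx x) l']"
        using walk_even[OF mf _ _ ot(1)] t I(7) False by auto
      obtain q where q: "high_pos j q" "min q (hi j) = Suc i" "highE j q = SourceEdge (vtx (Suc i)) l"
        using source_edge_even[of "Suc i" l j] m(2) t(1) I(6) False j ot by auto
      obtain p where p: "low_pos j p" "max p (lo j) = x" "lowE j p = SinkEdge (vtx x) l'"
        using sink_edge_even[of x l' j] mf x False j by auto
      have "(j, p, q) \<in> codes" using p q x by (auto simp: codes_def)
      moreover have "R = rt (j, p, q)"
        using False p q x t I(6) R e es InnerEdge by (auto simp: rt_def seg_snoc)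
      ultimately show ?thesis by blast
    qed
  qed
qed

lemma walk_seg:
  assumes "j \<in> L" "lo j \<le> u" "u \<le> v" "v \<le> hi j"
  shows "odd j \<Longrightarrow> wk (Inner (vtx u)) (seg u v) (Inner (vtx v))"
    "even j \<Longrightarrow> wk (Inner (vtx v)) (rev (seg u v)) (Inner (vtx u))"
proof -
  show "wk (Inner (vtx u)) (seg u v) (Inner (vtx v))" if "odd j"
    using assms(3,4)
  proof (induction v rule: dec_induct)
    case base then show ?case by (simp add: seg_Nil)
  next
    case (step n)
    then show ?case using inner_pos[of j n] assms that by (auto simp: seg_snoc wk_append)
  qed
  show "wk (Inner (vtx v)) (rev (seg u v)) (Inner (vtx u))" if "even j"
    using assms(3,4)
  proof (induction v rule: dec_induct)
    case base then show ?case by (simp add: seg_Nil)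
  next
    case (step n)
    then show ?case using inner_pos[of j n] assms that by (auto simp: seg_snoc)
  qed
qed

lemma seg_set: "set (seg u v) = InnerEdge ` {u..<v}"
  by (simp add: seg_def)

lemma set_rt: "set (rt (j, p, q)) = {lowE j p, highE j q} \<union> InnerEdge ` {max p (lo j)..<min q (hi j)}"
  by (auto simp: rt_def seg_set)

lemma code_route:
  assumes c: "c \<in> codes" shows "route (dag s) (rt c)"
proof -
  obtain j p q where cj: "c = (j, p, q)" by (cases c)
  note C = codesD[OF c[unfolded cj]]
  note P = low_posD[OF C(1)] and Q = high_posD[OF C(2)]
  let ?u = "max p (lo j)" and ?v = "min q (hi j)"
  have inner: "j \<in> L \<and> lo j \<le> i \<and> i < hi j" if "i \<in> {?u..<?v}" for i using that C P by auto
  have "InnerEdge i \<in> dag_edges s" if "i \<in> {?u..<?v}" for i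
    using inner[OF that] inner_pos(2,3) InnerEdge_mem by blast
  then have mem: "set (rt c) \<subseteq> dag_edges s"
    using lowE_mem[OF C(1)] highE_mem[OF C(2)] unfolding cj set_rt by blast
  have ws: "odd j \<Longrightarrow> wk (Inner (vtx ?u)) (seg ?u ?v) (Inner (vtx ?v))"
    "even j \<Longrightarrow> wk (Inner (vtx ?v)) (rev (seg ?u ?v)) (Inner (vtx ?u))"
    using walk_seg[OF P(1) C(5,4,6)] by auto
  have wk: "wk Source (rt c) Sink"
    using ws unfolding cj by (cases "odd j") (auto simp: rt_def wk_append lowE_def highE_def)
  have t: "inner_tail s i = (if odd j then vtx i else vtx (Suc i))" if "i \<in> {?u..<?v}" for i
    using inner_pos(6) inner[OF that] by blast
  have o: "map (edge_tail s) (seg ?u ?v) = map (\<lambda>i. Inner (vtx i)) [?u..<?v]" if "odd j"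
    using t that by (simp add: seg_def)
  \<comment> \<open>On an even leg edge \<open>i\<close> is traversed from position
    \<open>Suc i\<close> down to \<open>i\<close>, which shifts the tails by one.\<close>
  have e: "map (edge_tail s) (seg ?u ?v) = map (\<lambda>i. Inner (vtx i)) [Suc ?u..<Suc ?v]" if "even j"
    using t that by (simp add: seg_def map_Suc_upt[symmetric] del: upt_Suc)
  have tails: "map (edge_tail s) (rt c) = Source # map (\<lambda>i. Inner (vtx i))
      (if odd j then [?u..<Suc ?v] else rev [?u..<Suc ?v])"
  proof (cases "odd j")
    case True
    have "[?u..<Suc ?v] = [?u..<?v] @ [?v]" using C(4) by simp
    then show ?thesis unfolding cj
      using True o by (simp add: rt_def lowE_def highE_def del: upt_Suc)
  next
    case False
    have "[?u..<Suc ?v] = ?u # [Suc ?u..<Suc ?v]" by (rule upt_conv_Cons[OF le_imp_less_Suc[OF C(4)]])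
    then show ?thesis unfolding cj
      using False e by (simp add: rt_def lowE_def highE_def rev_map[symmetric] del: upt_Suc)
  qed
  have "distinct (map (\<lambda>i. Inner (vtx i)) (if odd j then [?u..<Suc ?v] else rev [?u..<Suc ?v]))"
  proof -
    have "x = y" if "x \<in> {?u..<Suc ?v}" "y \<in> {?u..<Suc ?v}" "vtx x = vtx y" for x y
      using vtx_inj_leg[OF P(1), of x y] that C by auto
    then have "inj_on (\<lambda>i. Inner (vtx i)) {?u..<Suc ?v}" by (auto simp: inj_on_def)
    then show ?thesis by (simp add: distinct_map del: upt_Suc)
  qed
  then have "distinct (map (edge_tail s) (rt c) @ [Sink])" unfolding tails by auto
  then show ?thesis using mem wk by (simp add: route_iff)
qed

theorem route_codes: "route (dag s) R \<longleftrightarrow> (\<exists>c\<in>codes. R = rt c)"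
proof
  assume "route (dag s) R"
  then have "set R \<subseteq> dag_edges s" "wk Source R Sink" by (simp_all add: route_iff)
  then show "\<exists>c\<in>codes. R = rt c" by (rule route_imp_code)
qed (use code_route in blast)

end

section \<open>Conflicts and g-vectors of coded routes\<close>

text \<open>In the use below, \<open>f (i - 1)\<close> and \<open>f i\<close> are the edges on the
  two sides of position \<open>i\<close>, with \<open>a\<close> and \<open>b\<close> at the
  extremes. A piece of a route is then given by the first and the last position, \<open>i\<close>
  and \<open>k\<close>, between its edges.\<close>

lemma sublist_segment_iff:
  assumes "u \<le> v"
  shows "sublist (x # m @ [y]) (a # map f [u..<v] @ [b]) \<longleftrightarrow>
    (\<exists>i k. u \<le> i \<and> i \<le> k \<and> k \<le> v \<and> x = (if i = u then a else f (i - 1)) \<and> m = map f [i..<k] \<and>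
      y = (if k = v then b else f k))" (is "sublist ?l ?X \<longleftrightarrow> _")
proof
  have nth: "?X ! Suc t = (if t < v - u then f (u + t) else b)" if "t \<le> v - u" for t
    using that by (auto simp: nth_append)
  have len: "length ?X = v - u + 2" by simp
  show "\<exists>i k. u \<le> i \<and> i \<le> k \<and> k \<le> v \<and> x = (if i = u then a else f (i - 1)) \<and> m = map f [i..<k] \<and>
      y = (if k = v then b else f k)" if "sublist ?l ?X"
  proof -
    obtain ps ss where X: "?X = ps @ ?l @ ss" using \<open>sublist ?l ?X\<close> unfolding sublist_def by blast
    define i where "i = u + length ps"
    define k where "k = i + length m"
    have "length ?X = length ps + length m + 2 + length ss" unfolding X by simp
    then have k: "k \<le> v" using len assms by (simp add: i_def k_def)
    have l: "?l ! t = ?X ! (length ps + t)" if "t < length ?l" for t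
      unfolding X using that by (simp only: nth_append add_diff_cancel_left' not_add_less1 if_True if_False)
    have "x = ?X ! length ps" using l[of 0] by simp
    then have x: "x = (if i = u then a else f (i - 1))"
      using nth[of "length ps - 1"] k by (cases "length ps") (auto simp: i_def k_def)
    have m: "m = map f [i..<k]"
    proof (rule nth_equalityI)
      show "length m = length (map f [i..<k])" by (simp add: k_def)
      fix t assume t: "t < length m"
      have "m ! t = ?l ! Suc t" using t by (simp add: nth_append)
      also have "\<dots> = ?X ! Suc (length ps + t)" using l[of "Suc t"] t by simp
      also have "\<dots> = f (i + t)"
      proof -
        have "length ps + t < v - u" using t k by (simp add: i_def k_def)
        then show ?thesis using nth[of "length ps + t"] by (simp add: i_def add.assoc)
      qed
      finally show "m ! t = map f [i..<k] ! t" using t by (simp add: k_def)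
    qed
    have "y = ?l ! Suc (length m)" by simp
    also have "\<dots> = ?X ! Suc (length ps + length m)" using l[of "Suc (length m)"] by simp
    also have "\<dots> = (if k = v then b else f k)" using nth[of "length ps + length m"] k by (auto simp: i_def k_def add.assoc)
    finally have y: "y = (if k = v then b else f k)" .
    have "u \<le> i" "i \<le> k" by (simp_all add: i_def k_def)
    then show ?thesis using x m k y by blast
  qed
  assume "\<exists>i k. u \<le> i \<and> i \<le> k \<and> k \<le> v \<and> x = (if i = u then a else f (i - 1)) \<and> m = map f [i..<k] \<and>
      y = (if k = v then b else f k)"
  then obtain i k where ik: "u \<le> i" "i \<le> k" "k \<le> v" "x = (if i = u then a else f (i - 1))" "m = map f [i..<k]"
      "y = (if k = v then b else f k)" by blast
  have "?l = take (k - i + 2) (drop (i - u) ?X)"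
  proof (rule nth_equalityI)
    show "length ?l = length (take (k - i + 2) (drop (i - u) ?X))" using ik by simp
    fix t assume t: "t < length ?l"
    then have tk: "t \<le> Suc (k - i)" using ik by simp
    have R: "take (k - i + 2) (drop (i - u) ?X) ! t = ?X ! (i - u + t)"
      using tk ik len by (subst nth_take; (subst nth_drop)?) auto
    show "?l ! t = take (k - i + 2) (drop (i - u) ?X) ! t"
    proof (cases t)
      case 0
      then show ?thesis unfolding R using ik(1-4) nth[of "i - u - 1"] by (cases "i = u") auto
    next
      case (Suc t')
      then have "?X ! (i - u + t) = (if i - u + t' < v - u then f (u + (i - u + t')) else b)"
        using nth[of "i - u + t'"] tk ik by simp
      moreover have "?l ! t = (if t' < k - i then f (i + t') else y)"
        using Suc tk ik(2,5) by (auto simp: nth_append)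
      ultimately show ?thesis unfolding R using ik tk Suc by auto
    qed
  qed
  then show "sublist ?l ?X" by (metis sublist_drop sublist_order.order_trans sublist_take)
qed

context framed_shape
begin

text \<open>\<open>inn\<close> is the edge of the route just below a position and \<open>out\<close>
  the one just above; so \<open>inn\<close> is incoming on odd legs but outgoing on even
  ones.\<close>

definition inn :: "nat \<Rightarrow> nat \<Rightarrow> nat \<Rightarrow> edge" where
  "inn j p i = (if i = max p (lo j) then lowE j p else InnerEdge (i - 1))"

definition out :: "nat \<Rightarrow> nat \<Rightarrow> nat \<Rightarrow> edge" where
  "out j q k = (if k = min q (hi j) then highE j q else InnerEdge k)"

lemma sublist_rt:
  assumes "(j, p, q) \<in> codes"
  shows "sublist (a # m @ [b]) (rt (j, p, q)) \<longleftrightarrow> (\<exists>i k. max p (lo j) \<le> i \<and> i \<le> k \<and> k \<le> min q (hi j) \<and>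
    (if odd j then a = inn j p i \<and> m = seg i k \<and> b = out j q k
     else b = inn j p i \<and> m = rev (seg i k) \<and> a = out j q k))"
proof -
  note C = codesD[OF assms]
  have up: "sublist (x # m @ [y]) (up (j, p, q)) \<longleftrightarrow> (\<exists>i k. max p (lo j) \<le> i \<and> i \<le> k \<and> k \<le> min q (hi j) \<and>
    x = inn j p i \<and> m = seg i k \<and> y = out j q k)" for x m y
    using sublist_segment_iff[OF C(4), of x m y "lowE j p" InnerEdge "highE j q"]
    by (simp add: inn_def out_def seg_def)
  show ?thesis
  proof (cases "odd j")
    case True
    then show ?thesis using up by (simp add: rt_def)
  next
    case False
    have "sublist (a # m @ [b]) (rt (j, p, q)) \<longleftrightarrow> sublist (b # rev m @ [a]) (up (j, p, q))"
      using False sublist_rev_right[of "a # m @ [b]" "up (j, p, q)"] by (simp add: rt_def del: up.simps)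
    then show ?thesis unfolding up using False by (auto simp: rev_swap)
  qed
qed

text \<open>A label differs from that of the leg exactly at a turn. Absent turns fit into the same
  formula, since no position of the leg equals \<open>lo j - 1\<close> or
  \<open>hi j + 1\<close>.\<close>

lemma inn_out:
  assumes "(j, p, q) \<in> codes" "max p (lo j) \<le> i" "i \<le> min q (hi j)"
  shows "odd j \<Longrightarrow> edge_head s (inn j p i) = Inner (vtx i)"
    "odd j \<Longrightarrow> edge_tail s (out j q i) = Inner (vtx i)"
    "even j \<Longrightarrow> edge_tail s (inn j p i) = Inner (vtx i)"
    "even j \<Longrightarrow> edge_head s (out j q i) = Inner (vtx i)"
    "edge_label s (inn j p i) = (if odd j then (if i = p then 1 else 2) else (if i = p then 2 else 1))"
    "edge_label s (out j q i) = (if odd j then (if i = q then 1 else 2) else (if i = q then 2 else 1))"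
proof -
  note C = codesD[OF assms(1)]
  have J: "j \<in> L" using low_posD[OF C(1)] by simp
  have A: "edge_head s (inn j p i) = Inner (vtx i) \<and> edge_label s (inn j p i) = (if i = p then 1 else 2)" if o: "odd j"
  proof (cases "i = max p (lo j)")
    case True
    then show ?thesis using o by (auto simp: inn_def lowE_def)
  next
    case False
    then have "lo j \<le> i - 1" "i - 1 < hi j" "i \<noteq> p" "Suc (i - 1) = i" using assms by auto
    then show ?thesis using inner_pos[OF J, of "i - 1"] False o by (simp add: inn_def)
  qed
  have B: "edge_tail s (inn j p i) = Inner (vtx i) \<and> edge_label s (inn j p i) = (if i = p then 2 else 1)" if o: "even j"
  proof (cases "i = max p (lo j)")
    case True
    then show ?thesis using o by (auto simp: inn_def lowE_def)
  next
    case False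
    then have "lo j \<le> i - 1" "i - 1 < hi j" "i \<noteq> p" "Suc (i - 1) = i" using assms by auto
    then show ?thesis using inner_pos[OF J, of "i - 1"] False o by (simp add: inn_def)
  qed
  have A': "edge_tail s (out j q i) = Inner (vtx i) \<and> edge_label s (out j q i) = (if i = q then 1 else 2)" if o: "odd j"
  proof (cases "i = min q (hi j)")
    case True
    then show ?thesis using o by (auto simp: out_def highE_def)
  next
    case False
    then have "lo j \<le> i" "i < hi j" "i \<noteq> q" using assms by auto
    then show ?thesis using inner_pos[OF J, of i] False o by (simp add: out_def)
  qed
  have B': "edge_head s (out j q i) = Inner (vtx i) \<and> edge_label s (out j q i) = (if i = q then 2 else 1)" if o: "even j"
  proof (cases "i = min q (hi j)")
    case True
    then show ?thesis using o by (auto simp: out_def highE_def)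
  next
    case False
    then have "lo j \<le> i" "i < hi j" "i \<noteq> q" using assms by auto
    then show ?thesis using inner_pos[OF J, of i] False o by (simp add: out_def)
  qed
  show "odd j \<Longrightarrow> edge_head s (inn j p i) = Inner (vtx i)"
    "odd j \<Longrightarrow> edge_tail s (out j q i) = Inner (vtx i)"
    "even j \<Longrightarrow> edge_tail s (inn j p i) = Inner (vtx i)"
    "even j \<Longrightarrow> edge_head s (out j q i) = Inner (vtx i)"
    "edge_label s (inn j p i) = (if odd j then (if i = p then 1 else 2) else (if i = p then 2 else 1))"
    "edge_label s (out j q i) = (if odd j then (if i = q then 1 else 2) else (if i = q then 2 else 1))"
    using A B A' B' by (cases "odd j"; simp)+
qed

lemma conflictI:
  assumes "sublist (a # m @ [b]) R" "sublist (a' # m @ [b']) S" "edge_head s a = edge_head s a'" "edge_tail s b = edge_tail s b'"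
    "edge_label s a < edge_label s a' \<and> edge_label s b' < edge_label s b \<or>
      edge_label s a' < edge_label s a \<and> edge_label s b < edge_label s b'"
  shows "conflict (dag s) R S"
  unfolding conflict_def dag_simps using assms by blast

text \<open>In a conflict on \<open>[i, k]\<close> one route has its low turn at \<open>i\<close>
  and the other its high turn at \<open>k\<close>; as an interval the former then both begins and
  ends higher.\<close>

lemma conflict_same_leg:
  assumes c: "(j, p, q) \<in> codes" "(j, p', q') \<in> codes"
  shows "conflict (dag s) (rt (j, p, q)) (rt (j, p', q')) \<longleftrightarrow>
    p < p' \<and> p' \<le> q \<and> q < q' \<or> p' < p \<and> p \<le> q' \<and> q' < q"
proof -
  note C = codesD[OF c(1)] and C' = codesD[OF c(2)]
  have J: "j \<in> L" using low_posD[OF C(1)] by simp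
  note P = low_posD[OF C(1)] low_posD[OF C'(1)] high_posD[OF C(2)] high_posD[OF C'(2)]
  let ?lab = "\<lambda>i x. if i = x then 1 else 2 :: nat"
  have "conflict (dag s) (rt (j, p, q)) (rt (j, p', q')) \<longleftrightarrow>
    (\<exists>i k. max p (lo j) \<le> i \<and> i \<le> k \<and> k \<le> min q (hi j) \<and> max p' (lo j) \<le> i \<and> k \<le> min q' (hi j) \<and>
      (i = p \<and> i \<noteq> p' \<and> k \<noteq> q \<and> k = q' \<or> i \<noteq> p \<and> i = p' \<and> k = q \<and> k \<noteq> q'))" (is "?L \<longleftrightarrow> ?R")
  proof
    assume ?L
    then obtain m a b a' b' where S: "sublist (a # m @ [b]) (rt (j, p, q))" "sublist (a' # m @ [b']) (rt (j, p', q'))"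
      and e: "edge_head s a = edge_head s a'" "edge_tail s b = edge_tail s b'"
      and l: "edge_label s a < edge_label s a' \<and> edge_label s b' < edge_label s b \<or>
        edge_label s a' < edge_label s a \<and> edge_label s b < edge_label s b'"
      unfolding conflict_def by auto
    obtain i k where i: "max p (lo j) \<le> i" "i \<le> k" "k \<le> min q (hi j)"
      "if odd j then a = inn j p i \<and> m = seg i k \<and> b = out j q k else b = inn j p i \<and> m = rev (seg i k) \<and> a = out j q k"
      using S(1) unfolding sublist_rt[OF c(1)] by blast
    obtain i' k' where i': "max p' (lo j) \<le> i'" "i' \<le> k'" "k' \<le> min q' (hi j)"
      "if odd j then a' = inn j p' i' \<and> m = seg i' k' \<and> b' = out j q' k' else b' = inn j p' i' \<and> m = rev (seg i' k') \<and> a' = out j q' k'"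
      using S(2) unfolding sublist_rt[OF c(2)] by blast
    have r: "i \<le> min q (hi j)" "max p (lo j) \<le> k" "i' \<le> min q' (hi j)" "max p' (lo j) \<le> k'" using i i' by auto
    note I = inn_out[OF c(1) i(1) r(1)] and K = inn_out[OF c(1) r(2) i(3)]
      and I' = inn_out[OF c(2) i'(1) r(3)] and K' = inn_out[OF c(2) r(4) i'(3)]
    have "vtx i = vtx i' \<and> vtx k = vtx k'"
      using e i(4) i'(4) I K I' K' by (cases "odd j") auto
    then have eq: "i' = i" "k' = k" using vtx_inj_leg[OF J, of i i'] vtx_inj_leg[OF J, of k k'] i i' r by auto
    have "i = p \<and> i \<noteq> p' \<and> k \<noteq> q \<and> k = q' \<or> i \<noteq> p \<and> i = p' \<and> k = q \<and> k \<noteq> q'"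
      using l i(4) i'(4) I(5) K(6) I'(5) K'(6) unfolding eq by (cases "odd j") (auto split: if_splits)
    then show ?R using i i' eq by blast
  next
    assume ?R
    then obtain i k where i: "max p (lo j) \<le> i" "i \<le> k" "k \<le> min q (hi j)" "max p' (lo j) \<le> i" "k \<le> min q' (hi j)"
      and d: "i = p \<and> i \<noteq> p' \<and> k \<noteq> q \<and> k = q' \<or> i \<noteq> p \<and> i = p' \<and> k = q \<and> k \<noteq> q'" by blast
    have r: "i \<le> min q (hi j)" "max p (lo j) \<le> k" "i \<le> min q' (hi j)" "max p' (lo j) \<le> k" using i by auto
    note I = inn_out[OF c(1) i(1) r(1)] and K = inn_out[OF c(1) r(2) i(3)]
      and I' = inn_out[OF c(2) i(4) r(3)] and K' = inn_out[OF c(2) r(4) i(5)]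
    show ?L
    proof (cases "odd j")
      case True
      have "sublist (inn j p i # seg i k @ [out j q k]) (rt (j, p, q))"
        unfolding sublist_rt[OF c(1)] using i True by auto
      moreover have "sublist (inn j p' i # seg i k @ [out j q' k]) (rt (j, p', q'))"
        unfolding sublist_rt[OF c(2)] using i True by auto
      ultimately show ?thesis
        by (rule conflictI) (use True I(1,5) K(2,6) I'(1,5) K'(2,6) d in auto)
    next
      case False
      have "sublist (out j q k # rev (seg i k) @ [inn j p i]) (rt (j, p, q))"
        unfolding sublist_rt[OF c(1)] using i False by auto
      moreover have "sublist (out j q' k # rev (seg i k) @ [inn j p' i]) (rt (j, p', q'))"
        unfolding sublist_rt[OF c(2)] using i False by auto
      ultimately show ?thesis
        by (rule conflictI) (use False I(3,5) K(4,6) I'(3,5) K'(4,6) d in auto)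
    qed
  qed
  also have "?R \<longleftrightarrow> p < p' \<and> p' \<le> q \<and> q < q' \<or> p' < p \<and> p \<le> q' \<and> q' < q"
  proof
    assume ?R
    then show "p < p' \<and> p' \<le> q \<and> q < q' \<or> p' < p \<and> p \<le> q' \<and> q' < q" by force
  next
    assume d: "p < p' \<and> p' \<le> q \<and> q < q' \<or> p' < p \<and> p \<le> q' \<and> q' < q"
    then show ?R
    proof
      assume "p < p' \<and> p' \<le> q \<and> q < q'"
      then show ?R using P by (intro exI[of _ p'] exI[of _ q]) auto
    next
      assume "p' < p \<and> p \<le> q' \<and> q' < q"
      then show ?R using P by (intro exI[of _ p] exI[of _ q']) auto
    qed
  qed
  finally show ?thesis .
qed

text \<open>Labels with which the coded route enters and, for \<open>lout\<close>, leaves position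
  \<open>i\<close>. An even leg is entered from above, so there \<open>q\<close> governs the
  incoming label.\<close>

definition lin :: "nat \<Rightarrow> nat \<Rightarrow> nat \<Rightarrow> nat \<Rightarrow> nat" where
  "lin j p q i = (if odd j then (if i = p then 1 else 2) else (if i = q then 2 else 1))"

definition lout :: "nat \<Rightarrow> nat \<Rightarrow> nat \<Rightarrow> nat \<Rightarrow> nat" where
  "lout j p q i = (if odd j then (if i = q then 1 else 2) else (if i = p then 2 else 1))"

lemma seg_eq_Nil: "seg i k = [] \<longleftrightarrow> k \<le> i"
  by (auto simp: seg_def)

lemma sublist_rt_pair:
  assumes "(j, p, q) \<in> codes"
  shows "(\<exists>a b. sublist [a, b] (rt (j, p, q)) \<and> edge_head s a = Inner v \<and> edge_label s a = l \<and> edge_label s b = l') \<longleftrightarrow>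
    (\<exists>i. max p (lo j) \<le> i \<and> i \<le> min q (hi j) \<and> vtx i = v \<and> lin j p q i = l \<and> lout j p q i = l')"
proof -
  have s: "sublist [a, b] (rt (j, p, q)) \<longleftrightarrow> (\<exists>i. max p (lo j) \<le> i \<and> i \<le> min q (hi j) \<and>
    (if odd j then a = inn j p i \<and> b = out j q i else b = inn j p i \<and> a = out j q i))" for a b
  proof -
    have "sublist (a # [] @ [b]) (rt (j, p, q)) \<longleftrightarrow> (\<exists>i. max p (lo j) \<le> i \<and> i \<le> min q (hi j) \<and>
      (if odd j then a = inn j p i \<and> b = out j q i else b = inn j p i \<and> a = out j q i))"
      unfolding sublist_rt[OF assms]
    proof
      assume "\<exists>i k. max p (lo j) \<le> i \<and> i \<le> k \<and> k \<le> min q (hi j) \<and>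
        (if odd j then a = inn j p i \<and> [] = seg i k \<and> b = out j q k
         else b = inn j p i \<and> [] = rev (seg i k) \<and> a = out j q k)"
      then obtain i k where i: "max p (lo j) \<le> i" "i \<le> k" "k \<le> min q (hi j)"
        "if odd j then a = inn j p i \<and> [] = seg i k \<and> b = out j q k
         else b = inn j p i \<and> [] = rev (seg i k) \<and> a = out j q k" by blast
      then have "seg i k = []" by (auto split: if_splits)
      then have "k = i" using i(2) by (simp add: seg_eq_Nil)
      then show "\<exists>i. max p (lo j) \<le> i \<and> i \<le> min q (hi j) \<and>
        (if odd j then a = inn j p i \<and> b = out j q i else b = inn j p i \<and> a = out j q i)"
        using i by (intro exI[of _ i]) auto
    next
      assume "\<exists>i. max p (lo j) \<le> i \<and> i \<le> min q (hi j) \<and>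
        (if odd j then a = inn j p i \<and> b = out j q i else b = inn j p i \<and> a = out j q i)"
      then obtain i where i: "max p (lo j) \<le> i" "i \<le> min q (hi j)"
        "if odd j then a = inn j p i \<and> b = out j q i else b = inn j p i \<and> a = out j q i" by blast
      have "seg i i = []" by (simp add: seg_def)
      then show "\<exists>i k. max p (lo j) \<le> i \<and> i \<le> k \<and> k \<le> min q (hi j) \<and>
        (if odd j then a = inn j p i \<and> [] = seg i k \<and> b = out j q k
         else b = inn j p i \<and> [] = rev (seg i k) \<and> a = out j q k)"
        using i by (intro exI[of _ i]) auto
    qed
    then show ?thesis by simp
  qed
  note I = inn_out[OF assms]
  show ?thesis
  proof
    assume "\<exists>a b. sublist [a, b] (rt (j, p, q)) \<and> edge_head s a = Inner v \<and> edge_label s a = l \<and> edge_label s b = l'"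
    then obtain a b i where ab: "edge_head s a = Inner v" "edge_label s a = l" "edge_label s b = l'"
      "max p (lo j) \<le> i" "i \<le> min q (hi j)" "if odd j then a = inn j p i \<and> b = out j q i else b = inn j p i \<and> a = out j q i"
      unfolding s by blast
    then show "\<exists>i. max p (lo j) \<le> i \<and> i \<le> min q (hi j) \<and> vtx i = v \<and> lin j p q i = l \<and> lout j p q i = l'"
      using I[OF ab(4,5)] by (intro exI[of _ i]) (cases "odd j"; simp add: lin_def lout_def)
  next
    assume "\<exists>i. max p (lo j) \<le> i \<and> i \<le> min q (hi j) \<and> vtx i = v \<and> lin j p q i = l \<and> lout j p q i = l'"
    then obtain i where i: "max p (lo j) \<le> i" "i \<le> min q (hi j)" "vtx i = v" "lin j p q i = l" "lout j p q i = l'" by blast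
    show "\<exists>a b. sublist [a, b] (rt (j, p, q)) \<and> edge_head s a = Inner v \<and> edge_label s a = l \<and> edge_label s b = l'"
    proof (cases "odd j")
      case True
      then show ?thesis unfolding s using i I[OF i(1,2)]
        by (intro exI[of _ "inn j p i"] exI[of _ "out j q i"]) (auto simp: lin_def lout_def)
    next
      case False
      then show ?thesis unfolding s using i I[OF i(1,2)]
        by (intro exI[of _ "out j q i"] exI[of _ "inn j p i"]) (auto simp: lin_def lout_def)
    qed
  qed
qed

text \<open>An inner edge belongs to only one leg, so a common subpath of routes on different legs
  is a single vertex.\<close>

lemma conflict_other_leg:
  assumes c: "(j, p, q) \<in> codes" "(j', p', q') \<in> codes" "j \<noteq> j'"
  shows "conflict (dag s) (rt (j, p, q)) (rt (j', p', q')) \<longleftrightarrow>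
    (\<exists>i i'. max p (lo j) \<le> i \<and> i \<le> min q (hi j) \<and> max p' (lo j') \<le> i' \<and> i' \<le> min q' (hi j') \<and> vtx i = vtx i' \<and>
      (lin j p q i < lin j' p' q' i' \<and> lout j p q i > lout j' p' q' i' \<or>
       lin j p q i > lin j' p' q' i' \<and> lout j p q i < lout j' p' q' i'))" (is "?L \<longleftrightarrow> ?R")
proof
  assume ?L
  then obtain m a b a' b' where S: "sublist (a # m @ [b]) (rt (j, p, q))" "sublist (a' # m @ [b']) (rt (j', p', q'))"
    and e: "edge_head s a = edge_head s a'" "edge_tail s b = edge_tail s b'"
    and l: "edge_label s a < edge_label s a' \<and> edge_label s b' < edge_label s b \<or>
      edge_label s a' < edge_label s a \<and> edge_label s b < edge_label s b'"
    unfolding conflict_def by auto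
  obtain i k where i: "max p (lo j) \<le> i" "i \<le> k" "k \<le> min q (hi j)"
    "if odd j then a = inn j p i \<and> m = seg i k \<and> b = out j q k else b = inn j p i \<and> m = rev (seg i k) \<and> a = out j q k"
    using S(1) unfolding sublist_rt[OF c(1)] by blast
  obtain i' k' where i': "max p' (lo j') \<le> i'" "i' \<le> k'" "k' \<le> min q' (hi j')"
    "if odd j' then a' = inn j' p' i' \<and> m = seg i' k' \<and> b' = out j' q' k' else b' = inn j' p' i' \<and> m = rev (seg i' k') \<and> a' = out j' q' k'"
    using S(2) unfolding sublist_rt[OF c(2)] by blast
  have "m = seg i k \<or> m = rev (seg i k)" "m = seg i' k' \<or> m = rev (seg i' k')"
    using i(4) i'(4) by (auto split: if_splits)
  then have sm: "set m = InnerEdge ` {i..<k}" "set m = InnerEdge ` {i'..<k'}" by (metis seg_set set_rev)+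
  have "m = []"
  proof (rule ccontr)
    assume "m \<noteq> []"
    then obtain x where x: "InnerEdge x \<in> set m" using sm(1) by (metis ex_in_conv imageE set_empty)
    have "x \<in> {i..<k}" using x unfolding sm(1) by blast
    moreover have "x \<in> {i'..<k'}" using x unfolding sm(2) by blast
    ultimately have "x \<in> {i..<k}" "x \<in> {i'..<k'}" by blast+
    then have "lo j \<le> x" "x < hi j" "lo j' \<le> x" "x < hi j'" using i i' by auto
    then show False using leg_unique c(3) by blast
  qed
  then have k: "k = i" "k' = i'" using sm i(2) i'(2) by auto
  have r: "i \<le> min q (hi j)" "i' \<le> min q' (hi j')" using i i' k by auto
  note I = inn_out[OF c(1) i(1) r(1)] and I' = inn_out[OF c(2) i'(1) r(2)]
  have v: "vtx i = vtx i'" using e(1) i(4) i'(4) I(1,4) I'(1,4) unfolding k by (cases "odd j"; cases "odd j'") auto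
  have "edge_label s a = lin j p q i" "edge_label s b = lout j p q i"
    using i(4) I(5,6) unfolding k by (cases "odd j"; simp add: lin_def lout_def)+
  moreover have "edge_label s a' = lin j' p' q' i'" "edge_label s b' = lout j' p' q' i'"
    using i'(4) I'(5,6) unfolding k by (cases "odd j'"; simp add: lin_def lout_def)+
  ultimately show ?R using l v r i(1) i'(1) by metis
next
  assume ?R
  then obtain i i' where i: "max p (lo j) \<le> i" "i \<le> min q (hi j)" "max p' (lo j') \<le> i'" "i' \<le> min q' (hi j')" "vtx i = vtx i'"
    and l: "lin j p q i < lin j' p' q' i' \<and> lout j p q i > lout j' p' q' i' \<or>
       lin j p q i > lin j' p' q' i' \<and> lout j p q i < lout j' p' q' i'" by blast
  have ends: "\<exists>a b. sublist (a # [] @ [b]) (rt (j, p, q)) \<and> edge_head s a = Inner (vtx i) \<and> edge_tail s b = Inner (vtx i) \<and>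
      edge_label s a = lin j p q i \<and> edge_label s b = lout j p q i"
    if "(j, p, q) \<in> codes" "max p (lo j) \<le> i" "i \<le> min q (hi j)" for j p q i
  proof (cases "odd j")
    case True
    have "sublist (inn j p i # [] @ [out j q i]) (rt (j, p, q))"
      unfolding sublist_rt[OF that(1)] using True that by (intro exI[of _ i]) (auto simp: seg_def)
    then show ?thesis using True inn_out[OF that] by (intro exI[of _ "inn j p i"] exI[of _ "out j q i"]) (simp add: lin_def lout_def)
  next
    case False
    have "sublist (out j q i # [] @ [inn j p i]) (rt (j, p, q))"
      unfolding sublist_rt[OF that(1)] using False that by (intro exI[of _ i]) (auto simp: seg_def)
    then show ?thesis using False inn_out[OF that] by (intro exI[of _ "out j q i"] exI[of _ "inn j p i"]) (simp add: lin_def lout_def)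
  qed
  obtain a b where 1: "sublist (a # [] @ [b]) (rt (j, p, q))" "edge_head s a = Inner (vtx i)" "edge_tail s b = Inner (vtx i)"
      "edge_label s a = lin j p q i" "edge_label s b = lout j p q i" using ends[OF c(1) i(1,2)] by blast
  obtain a' b' where 2: "sublist (a' # [] @ [b']) (rt (j', p', q'))" "edge_head s a' = Inner (vtx i')" "edge_tail s b' = Inner (vtx i')"
      "edge_label s a' = lin j' p' q' i'" "edge_label s b' = lout j' p' q' i'" using ends[OF c(2) i(3,4)] by blast
  show ?L unfolding conflict_def using 1 2 i(5) l
    by (intro exI[of _ "[]"] exI[of _ a] exI[of _ b] exI[of _ a'] exI[of _ b']) (auto simp del: append.simps)
qed

lemma adj_ends:
  assumes "A.adj j j'"
  shows "low_pos j p \<Longrightarrow> p \<noteq> hi j" "high_pos j' q' \<Longrightarrow> q' \<noteq> lo j'"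
proof -
  have J: "j \<in> L" "j' \<in> L" using adj_L[OF assms] by auto
  note lt = lo_less_hi[OF J(1)] lo_less_hi[OF J(2)]
  show "p \<noteq> hi j" if "low_pos j p"
  proof
    assume "p = hi j"
    then have "okt j (hi j)" using low_posD(2)[OF that] lt by simp
    then show False using assms A.tail_unique[of j "hi j" j' "lo j'"] unfolding A.adj_def by auto
  qed
  show "q' \<noteq> lo j'" if "high_pos j' q'"
  proof
    assume "q' = lo j'"
    then have "okh j' (lo j')" using high_posD(2)[OF that] lt by simp
    then show False using assms A.head_unique[of j "hi j" j' "lo j'"] unfolding A.adj_def by auto
  qed
qed

text \<open>On different legs the common vertex is a junction. On one side of it the two routes use
  the inner edges of their legs, with distinct labels; a conflict means that on the other side both
  change label, that is, both turn there.\<close>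

theorem conflict_iff_cross:
  assumes "c \<in> codes" "d \<in> codes"
  shows "conflict (dag s) (rt c) (rt d) \<longleftrightarrow> A.cross c d"
proof -
  obtain j p q j' p' q' where cd: "c = (j, p, q)" "d = (j', p', q')" by (cases c; cases d)
  have m: "(j, p, q) \<in> codes" "(j', p', q') \<in> codes" using assms cd by auto
  show ?thesis
  proof (cases "j = j'")
    case True
    then show ?thesis using conflict_same_leg[of j p q p' q'] m unfolding cd by simp
  next
    case False
    note C = codesD[OF m(1)] and C' = codesD[OF m(2)]
    have J: "j \<in> L" "j' \<in> L" using low_posD C C' by auto
    note lt = lo_less_hi[OF J(1)] lo_less_hi[OF J(2)]
    have cr: "A.cross c d \<longleftrightarrow> (A.adj j j' \<and> q = hi j \<and> p' = lo j') \<or> (A.adj j' j \<and> q' = hi j' \<and> p = lo j)"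
    proof -
      have "A.hv (j, p, q) = A.tv (j', p', q') \<and> A.hv (j, p, q) \<noteq> None \<longleftrightarrow> A.adj j j' \<and> q = hi j \<and> p' = lo j'"
        if "high_pos j q" "low_pos j' p'" "j \<noteq> j'" for j p q j' p' q'
      proof
        assume "A.hv (j, p, q) = A.tv (j', p', q') \<and> A.hv (j, p, q) \<noteq> None"
        then have e: "q \<le> hi j" "lo j' \<le> p'" "vtx q = vtx p'" by (auto split: if_splits)
        then have ok: "okh j q" "okt j' p'" using high_posD[OF that(1)] low_posD[OF that(2)] by auto
        then show "A.adj j j' \<and> q = hi j \<and> p' = lo j'" using A.head_tail[OF ok e(3)] that(3) e unfolding A.adj_def by auto
      next
        assume "A.adj j j' \<and> q = hi j \<and> p' = lo j'"
        then show "A.hv (j, p, q) = A.tv (j', p', q') \<and> A.hv (j, p, q) \<noteq> None" by (auto simp: A.adj_def)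
      qed
      from this[OF C(2) C'(1) False, of p q'] this[OF C'(2) C(1) False[symmetric], of p' q]
      show ?thesis unfolding cd using False by (simp only: A.cross.simps) auto
    qed
    have "conflict (dag s) (rt c) (rt d) \<longleftrightarrow> (A.adj j j' \<and> q = hi j \<and> p' = lo j') \<or> (A.adj j' j \<and> q' = hi j' \<and> p = lo j)"
      unfolding cd conflict_other_leg[OF m False]
    proof
      assume "\<exists>i i'. max p (lo j) \<le> i \<and> i \<le> min q (hi j) \<and> max p' (lo j') \<le> i' \<and> i' \<le> min q' (hi j') \<and> vtx i = vtx i' \<and>
      (lin j p q i < lin j' p' q' i' \<and> lout j p q i > lout j' p' q' i' \<or>
       lin j p q i > lin j' p' q' i' \<and> lout j p q i < lout j' p' q' i')"
      then obtain i i' where i: "max p (lo j) \<le> i" "i \<le> min q (hi j)" "max p' (lo j') \<le> i'" "i' \<le> min q' (hi j')" "vtx i = vtx i'"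
        and l: "lin j p q i < lin j' p' q' i' \<and> lout j p q i > lout j' p' q' i' \<or>
       lin j p q i > lin j' p' q' i' \<and> lout j p q i < lout j' p' q' i'" by blast
      have "i = hi j \<and> i' = lo j' \<and> A.adj j j' \<or> i = lo j \<and> i' = hi j' \<and> A.adj j' j"
        using share_vertex[OF J False, of i i'] i by auto
      then show "(A.adj j j' \<and> q = hi j \<and> p' = lo j') \<or> (A.adj j' j \<and> q' = hi j' \<and> p = lo j)"
      proof
        assume a: "i = hi j \<and> i' = lo j' \<and> A.adj j j'"
        then have "p \<noteq> hi j" "q' \<noteq> lo j'" using adj_ends(1)[of j j' p] adj_ends(2)[of j j' q'] C C' by blast+
        then show ?thesis using a l adj_parity[of j j'] by (cases "odd j") (auto simp: lin_def lout_def split: if_splits)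
      next
        assume a: "i = lo j \<and> i' = hi j' \<and> A.adj j' j"
        then have "p' \<noteq> hi j'" "q \<noteq> lo j" using adj_ends(1)[of j' j p'] adj_ends(2)[of j' j q] C C' by blast+
        then show ?thesis using a l adj_parity[of j' j] by (cases "odd j") (auto simp: lin_def lout_def split: if_splits)
      qed
    next
      assume "(A.adj j j' \<and> q = hi j \<and> p' = lo j') \<or> (A.adj j' j \<and> q' = hi j' \<and> p = lo j)"
      then show "\<exists>i i'. max p (lo j) \<le> i \<and> i \<le> min q (hi j) \<and> max p' (lo j') \<le> i' \<and> i' \<le> min q' (hi j') \<and> vtx i = vtx i' \<and>
      (lin j p q i < lin j' p' q' i' \<and> lout j p q i > lout j' p' q' i' \<or>
       lin j p q i > lin j' p' q' i' \<and> lout j p q i < lout j' p' q' i')"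
      proof
        assume a: "A.adj j j' \<and> q = hi j \<and> p' = lo j'"
        then have ne: "p \<noteq> hi j" "q' \<noteq> lo j'" using adj_ends(1)[of j j' p] adj_ends(2)[of j j' q'] C C' by blast+
        have "vtx (hi j) = vtx (lo j')" using a by (simp add: A.adj_def)
        then show ?thesis using a ne adj_parity[of j j'] C C' lt
          by (intro exI[of _ "hi j"] exI[of _ "lo j'"], cases "odd j") (auto simp: lin_def lout_def)
      next
        assume a: "A.adj j' j \<and> q' = hi j' \<and> p = lo j"
        then have ne: "p' \<noteq> hi j'" "q \<noteq> lo j" using adj_ends(1)[of j' j p'] adj_ends(2)[of j' j q] C C' by blast+
        have "vtx (lo j) = vtx (hi j')" using a by (simp add: A.adj_def)
        then show ?thesis using a ne adj_parity[of j' j] C C' lt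
          by (intro exI[of _ "lo j"] exI[of _ "hi j'"], cases "odd j") (auto simp: lin_def lout_def)
      qed
    qed
    then show ?thesis using cr by simp
  qed
qed

text \<open>For either direction of the leg a low turn passes from label 1 to 2 and a high turn from
  2 to 1: reversing the direction exchanges entering with leaving, but the label of the leg changes
  too.\<close>

theorem gvec_rt:
  assumes "c \<in> codes" shows "gvec (dag s) w (rt c) = A.gv c"
proof -
  obtain j p q where cj: "c = (j, p, q)" by (cases c)
  have m: "(j, p, q) \<in> codes" using assms cj by simp
  note C = codesD[OF m]
  note P = low_posD[OF C(1)] and Q = high_posD[OF C(2)]
  have J: "j \<in> L" using P by simp
  have turns: "turns (dag s) (rt c) (Inner v) l l' \<longleftrightarrow>
    (\<exists>i. max p (lo j) \<le> i \<and> i \<le> min q (hi j) \<and> vtx i = v \<and> lin j p q i = l \<and> lout j p q i = l')" for v l l'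
    unfolding turns_def cj using sublist_rt_pair[OF m, of v l l'] by simp
  have t12: "turns (dag s) (rt c) (Inner v) 1 2 \<longleftrightarrow> lo j \<le> p \<and> p \<noteq> q \<and> vtx p = v" for v
    unfolding turns lin_def lout_def using C P Q by (cases "odd j") (auto split: if_splits)
  have t21: "turns (dag s) (rt c) (Inner v) 2 1 \<longleftrightarrow> q \<le> hi j \<and> p \<noteq> q \<and> vtx q = v" for v
    unfolding turns lin_def lout_def using C P Q by (cases "odd j") (auto split: if_splits)
  show ?thesis
  proof (rule vec_eq_iff[THEN iffD2], rule allI)
    fix x
    have "w x \<in> Inner ` N" using w by (metis bij_betw_def inner_vertices_eq rangeI)
    then obtain v where v: "v \<in> N" "w x = Inner v" by blast
    have ax: "ax v = x" unfolding ax_def v(2)[symmetric] using w by (simp add: bij_betw_def inv_into_f_f)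
    have ev: "A.ev u $ x = of_bool (u = Some v)" if "\<And>y. u = Some y \<Longrightarrow> y \<in> N" for u
      using that v A.ax ax[symmetric] by (cases u) (auto simp: A.ev_def axis_def bij_betw_def inj_on_def)
    have "A.gv c $ x = of_bool (A.hv c = Some v) - of_bool (A.tv c = Some v)"
    proof -
      have "A.ev (A.hv c) $ x = of_bool (A.hv c = Some v)"
        by (rule ev) (use Q vtx_N[OF J] in \<open>auto simp: cj split: if_splits\<close>)
      moreover have "A.ev (A.tv c) $ x = of_bool (A.tv c = Some v)"
        by (rule ev) (use P vtx_N[OF J] in \<open>auto simp: cj split: if_splits\<close>)
      ultimately show ?thesis by (simp add: A.gv_def)
    qed
    also have "\<dots> = gvec (dag s) w (rt c) $ x"
    proof -
      have "vtx p \<noteq> vtx q" if "lo j \<le> p" "q \<le> hi j" "p \<noteq> q"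
        using vtx_inj_leg[OF J, of p q] that P Q by auto
      then show ?thesis unfolding gvec_def vec_lambda_beta v(2) t12 t21 using P Q by (auto simp: cj)
    qed
    finally show "gvec (dag s) w (rt c) $ x = A.gv c $ x" by simp
  qed
qed

theorem exceptional_rt:
  assumes "c \<in> codes" shows "exceptional (dag s) (rt c) \<longleftrightarrow> exc c"
proof -
  obtain j p q where cj: "c = (j, p, q)" by (cases c)
  have m: "(j, p, q) \<in> codes" using assms cj by simp
  note C = codesD[OF m]
  note P = low_posD[OF C(1)] and Q = high_posD[OF C(2)]
  have il: "inner_label s i = (if odd j then 2 else 1)" if "max p (lo j) \<le> i" "i < min q (hi j)" for i
    using inner_pos(8)[OF P(1), of i] that by auto
  have ll: "edge_label s (lowE j p) = (if odd j then (if p < lo j then 2 else 1) else (if p < lo j then 1 else 2))"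
    "edge_label s (highE j q) = (if odd j then (if hi j < q then 2 else 1) else (if hi j < q then 1 else 2))"
    by (auto simp: lowE_def highE_def)
  have "exceptional (dag s) (rt c) \<longleftrightarrow> (\<exists>l. \<forall>e\<in>set (rt c). edge_label s e = l)"
    using code_route[OF assms] by (simp add: exceptional_def constant_label_def)
  also have "\<dots> \<longleftrightarrow> exc c"
  proof
    assume "\<exists>l. \<forall>e\<in>set (rt c). edge_label s e = l"
    then obtain l where l: "edge_label s (lowE j p) = l" "edge_label s (highE j q) = l"
      "\<And>i. max p (lo j) \<le> i \<Longrightarrow> i < min q (hi j) \<Longrightarrow> inner_label s i = l" unfolding cj set_rt by auto
    have same: "p < lo j \<longleftrightarrow> hi j < q" using l(1,2) ll by (auto split: if_splits)
    show "exc c"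
    proof (cases "p < lo j")
      case True then show ?thesis using same cj by simp
    next
      case False
      have "p = q"
      proof (rule ccontr)
        assume "p \<noteq> q"
        then have "max p (lo j) < min q (hi j)" using False same C P Q by (auto simp: not_less)
        then show False using l(1) l(3)[of "max p (lo j)"] il[of "max p (lo j)"] ll False by (auto split: if_splits)
      qed
      then show ?thesis using cj by simp
    qed
  next
    assume "exc c"
    then have "p = q \<or> p < lo j \<and> hi j < q" using cj by simp
    then show "\<exists>l. \<forall>e\<in>set (rt c). edge_label s e = l"
    proof
      assume "p = q"
      then have "edge_label s (lowE j p) = edge_label s (highE j q)" using ll P Q by auto
      then show ?thesis using \<open>p = q\<close> C unfolding cj set_rt by auto
    next
      assume a: "p < lo j \<and> hi j < q"
      then show ?thesis using ll il unfolding cj set_rt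
        by (intro exI[of _ "if odd j then 2 else 1"]) auto
    qed
  qed
  finally show ?thesis .
qed

section \<open>The DKK triangulation as the fan of arcs\<close>

lemma arcs_codes: "c \<in> A.arcs \<Longrightarrow> c \<in> codes"
  using codes_arcs by blast

lemma arcs_not_exceptional: "c \<in> A.arcs \<Longrightarrow> \<not> exceptional (dag s) (rt c)"
  using exceptional_rt codes_arcs by blast

lemma nonexceptional_route: "route (dag s) R \<and> \<not> exceptional (dag s) R \<longleftrightarrow> R \<in> rt ` A.arcs"
proof
  assume "route (dag s) R \<and> \<not> exceptional (dag s) R"
  then show "R \<in> rt ` A.arcs" using route_codes[of R] exceptional_rt codes_arcs by blast
next
  assume "R \<in> rt ` A.arcs"
  then show "route (dag s) R \<and> \<not> exceptional (dag s) R"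
    using code_route arcs_codes arcs_not_exceptional by blast
qed

lemma rt_inj: "c \<in> A.arcs \<Longrightarrow> d \<in> A.arcs \<Longrightarrow> rt c = rt d \<Longrightarrow> c = d"
  using gvec_rt arcs_codes A.fan.g_inj by metis

lemma exc_gv: "c \<in> codes \<Longrightarrow> exc c \<Longrightarrow> A.gv c = 0"
proof -
  assume "c \<in> codes" "exc c"
  moreover obtain j p q where "c = (j, p, q)" by (cases c)
  ultimately show ?thesis using low_posD[of j p] high_posD[of j q] codesD[of j p q] by (auto simp: A.gv_def)
qed

text \<open>With both turns absent the interval contains all others of its leg. With
  \<open>p = q\<close> no overlap is possible on the leg, and the position, being head and tail
  there, is neither on another leg.\<close>

lemma exc_not_cross:
  assumes "c \<in> codes" "exc c" "d \<in> codes"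
  shows "\<not> A.cross c d"
proof
  assume cr: "A.cross c d"
  obtain j p q j' p' q' where cd: "c = (j, p, q)" "d = (j', p', q')" by (cases c; cases d)
  note C = codesD[OF assms(1)[unfolded cd]] and D = codesD[OF assms(3)[unfolded cd]]
  note P = low_posD[OF C(1)] and Q = high_posD[OF C(2)] and P' = low_posD[OF D(1)] and Q' = high_posD[OF D(2)]
  show False
  proof (cases "j = j'")
    case True
    then show False using cr assms(2) P Q P' Q' unfolding cd by auto
  next
    case False
    then have "p = q" using cr assms(2) unfolding cd by (auto split: if_splits)
    then have ok: "okt j p" "okh j p" using P Q by auto
    have "A.hv d = Some (vtx p) \<or> A.tv d = Some (vtx p)" using cr False \<open>p = q\<close> unfolding cd by (auto split: if_splits)
    then show False
    proof
      assume "A.hv d = Some (vtx p)"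
      then show False using A.head_unique[OF ok(2), of j' q'] Q' False cd by (auto split: if_splits)
    next
      assume "A.tv d = Some (vtx p)"
      then show False using A.tail_unique[OF ok(1), of j' p'] P' False cd by (auto split: if_splits)
    qed
  qed
qed

lemma coherent_rt:
  "c \<in> codes \<Longrightarrow> d \<in> codes \<Longrightarrow> coherent (dag s) (rt c) (rt d) \<longleftrightarrow> exc c \<or> exc d \<or> A.coh c d"
  using conflict_iff_cross[of c d] exc_not_cross[of c d] exc_not_cross[of d c] A.cross_sym
  unfolding coherent_def A.coh_def by blast

lemma exceptional_exists: "\<exists>R. exceptional (dag s) R"
proof -
  have J: "r \<in> L" using r_pos by (simp add: L_def)
  have "(r, lo r - 1, hi r + 1) \<in> codes" using J lo_less_hi[OF J] by (auto simp: codes_def low_pos_def high_pos_def)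
  moreover have "exc (r, lo r - 1, hi r + 1)" using lo_ge_1[of r] by simp
  ultimately show ?thesis using exceptional_rt by blast
qed

lemma exceptional_route: "exceptional (dag s) R \<longleftrightarrow> (\<exists>c\<in>codes. exc c \<and> R = rt c)"
  using exceptional_rt route_codes exceptional_def by metis

lemma gvec_image:
  assumes M: "\<And>R. R \<in> M \<Longrightarrow> route (dag s) R" "{R. exceptional (dag s) R} \<subseteq> M"
  shows "gvec (dag s) w ` M = insert 0 (A.gv ` {c \<in> A.arcs. rt c \<in> M})"
proof
  show "gvec (dag s) w ` M \<subseteq> insert 0 (A.gv ` {c \<in> A.arcs. rt c \<in> M})"
  proof
    fix x assume "x \<in> gvec (dag s) w ` M"
    then obtain R where R: "R \<in> M" "x = gvec (dag s) w R" by blast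
    obtain c where c: "c \<in> codes" "R = rt c" using M(1)[OF R(1)] route_codes by blast
    show "x \<in> insert 0 (A.gv ` {c \<in> A.arcs. rt c \<in> M})"
      using gvec_rt[OF c(1)] exc_gv[OF c(1)] codes_arcs[of c] c R by (cases "exc c") auto
  qed
  show "insert 0 (A.gv ` {c \<in> A.arcs. rt c \<in> M}) \<subseteq> gvec (dag s) w ` M"
  proof -
    obtain c where c: "c \<in> codes" "exc c" using exceptional_exists exceptional_route by blast
    then have "exceptional (dag s) (rt c)" using exceptional_rt by blast
    then have "rt c \<in> M" using M(2) by blast
    moreover have "0 = gvec (dag s) w (rt c)" using gvec_rt[OF c(1)] exc_gv[OF c] by simp
    ultimately have "0 \<in> gvec (dag s) w ` M" by blast
    moreover have "A.gv c \<in> gvec (dag s) w ` M" if "c \<in> A.arcs" "rt c \<in> M" for c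
      using gvec_rt[OF arcs_codes[OF that(1)]] that(2) by (metis image_eqI)
    ultimately show ?thesis by blast
  qed
qed

lemma g_polytope_points: "g_polytope (dag s) w = convex hull A.fan.points"
proof -
  have "{c \<in> A.arcs. rt c \<in> {R. route (dag s) R}} = A.arcs" using code_route arcs_codes by blast
  then show ?thesis using gvec_image[of "{R. route (dag s) R}"]
    by (simp add: g_polytope_def A.fan.points_def exceptional_def Collect_mono_iff)
qed

lemma pull_routes_cells:
  assumes "set V \<subseteq> A.arcs"
  shows "pull_routes (dag s) w (map rt V) = A.fan.cells V"
proof -
  have "map (gvec (dag s) w) (map rt V) = map A.gv V" using assms gvec_rt arcs_codes by auto
  then show ?thesis by (simp add: pull_routes_def A.fan.cells_def g_polytope_points del: map_map)
qed

lemma clique_union: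
  assumes "A.fan.cliq K"
  shows "clique (dag s) (rt ` K \<union> {R. exceptional (dag s) R})"
  unfolding clique_def
proof (intro conjI ballI)
  have K: "K \<subseteq> A.arcs" "\<And>c d. c \<in> K \<Longrightarrow> d \<in> K \<Longrightarrow> A.coh c d" using assms by (auto simp: A.fan.cliq_def)
  have code: "\<exists>c\<in>codes. R = rt c \<and> (c \<in> K \<or> exc c)" if "R \<in> rt ` K \<union> {R. exceptional (dag s) R}" for R
    using that K arcs_codes exceptional_route by blast
  show "route (dag s) R" if "R \<in> rt ` K \<union> {R. exceptional (dag s) R}" for R
    using code[OF that] code_route by blast
  show "coherent (dag s) R S" if RS: "R \<in> rt ` K \<union> {R. exceptional (dag s) R}" "S \<in> rt ` K \<union> {R. exceptional (dag s) R}" for R S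
  proof -
    obtain c d where cd: "c \<in> codes" "R = rt c" "c \<in> K \<or> exc c" "d \<in> codes" "S = rt d" "d \<in> K \<or> exc d"
      using code[OF RS(1)] code[OF RS(2)] by blast
    have "exc c \<or> exc d \<or> A.coh c d" using cd K(2) by blast
    then show ?thesis unfolding cd(2,5) coherent_rt[OF cd(1,4)] .
  qed
qed

text \<open>Every maximal clique contains all exceptional routes, as they are coherent with every
  route. What remains is a maximal clique of arcs, and the exceptional routes contribute the apex
  0.\<close>

theorem dkk_fan_cells: "dkk_triangulation (dag s) w = A.fan.fan_cells"
proof
  have restrict: "A.fan.cliq {c \<in> A.arcs. rt c \<in> M}" if "clique (dag s) M" for M
    using that coherent_rt arcs_codes codes_arcs unfolding clique_def A.fan.cliq_def by blast
  have img: "gvec (dag s) w ` M = insert 0 (A.gv ` {c \<in> A.arcs. rt c \<in> M})"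
    if "clique (dag s) M" "{R. exceptional (dag s) R} \<subseteq> M" for M
    using gvec_image[of M] that by (auto simp: clique_def)
  have split: "M = rt ` {c \<in> A.arcs. rt c \<in> M} \<union> {R. exceptional (dag s) R}"
    if "clique (dag s) M" "{R. exceptional (dag s) R} \<subseteq> M" for M
  proof
    show "M \<subseteq> rt ` {c \<in> A.arcs. rt c \<in> M} \<union> {R. exceptional (dag s) R}"
    proof
      fix R assume R: "R \<in> M"
      then have "route (dag s) R" using that by (auto simp: clique_def)
      then show "R \<in> rt ` {c \<in> A.arcs. rt c \<in> M} \<union> {R. exceptional (dag s) R}"
        using nonexceptional_route[of R] R by blast
    qed
  qed (use that in blast)
  have exc_coh: "coherent (dag s) R S \<and> coherent (dag s) S R" if RS: "exceptional (dag s) R" "route (dag s) S" for R S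
  proof -
    obtain c where c: "c \<in> codes" "exc c" "R = rt c" using RS(1) unfolding exceptional_route by blast
    obtain d where d: "d \<in> codes" "S = rt d" using RS(2) unfolding route_codes by blast
    show ?thesis unfolding c(3) d(2) coherent_rt[OF c(1) d(1)] coherent_rt[OF d(1) c(1)] using c(2) by blast
  qed
  show "dkk_triangulation (dag s) w \<subseteq> A.fan.fan_cells"
  proof
    fix T assume "T \<in> dkk_triangulation (dag s) w"
    then obtain M where M: "maximal_clique (dag s) M" "T = convex hull (gvec (dag s) w ` M)"
      unfolding dkk_triangulation_def by blast
    have cM: "clique (dag s) M" using M by (simp add: maximal_clique_def)
    have "clique (dag s) (M \<union> {R. exceptional (dag s) R})"
      using cM exc_coh unfolding clique_def by (auto simp: exceptional_def)
    then have eM: "{R. exceptional (dag s) R} \<subseteq> M" using M(1) unfolding maximal_clique_def by blast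
    let ?K = "{c \<in> A.arcs. rt c \<in> M}"
    have "A.fan.max_cliq ?K" unfolding A.fan.max_cliq_def
    proof (intro conjI allI impI)
      show "A.fan.cliq ?K" by (rule restrict[OF cM])
      fix K' assume K': "A.fan.cliq K' \<and> ?K \<subseteq> K'"
      have "M \<subseteq> rt ` K' \<union> {R. exceptional (dag s) R}" using split[OF cM eM] K' by blast
      then have "rt ` K' \<union> {R. exceptional (dag s) R} = M"
        using M(1) clique_union[of K'] K' unfolding maximal_clique_def by blast
      then show "K' = ?K" using K' by (auto simp: A.fan.cliq_def)
    qed
    moreover have "T = A.fan.simplex_of ?K" unfolding A.fan.simplex_of_def M(2) img[OF cM eM] ..
    ultimately show "T \<in> A.fan.fan_cells" unfolding A.fan.fan_cells_def by blast
  qed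
  show "A.fan.fan_cells \<subseteq> dkk_triangulation (dag s) w"
  proof
    fix T assume "T \<in> A.fan.fan_cells"
    then obtain K where K: "A.fan.max_cliq K" "T = A.fan.simplex_of K" unfolding A.fan.fan_cells_def by blast
    then have cK: "A.fan.cliq K" by (simp add: A.fan.max_cliq_def)
    let ?M = "rt ` K \<union> {R. exceptional (dag s) R}"
    have cM: "clique (dag s) ?M" by (rule clique_union[OF cK])
    have KM: "{c \<in> A.arcs. rt c \<in> ?M} = K"
      using cK rt_inj arcs_not_exceptional unfolding A.fan.cliq_def by blast
    have "maximal_clique (dag s) ?M" unfolding maximal_clique_def
    proof (intro conjI allI impI)
      fix M' assume M': "clique (dag s) M' \<and> ?M \<subseteq> M'"
      have "K \<subseteq> {c \<in> A.arcs. rt c \<in> M'}" using M' cK by (auto simp: A.fan.cliq_def)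
      then have "{c \<in> A.arcs. rt c \<in> M'} = K" using restrict[of M'] M' K(1) unfolding A.fan.max_cliq_def by blast
      then show "M' = ?M" using split[of M'] M' by blast
    qed (rule cM)
    moreover have "T = convex hull (gvec (dag s) w ` ?M)"
      using img[OF cM] KM K(2) by (simp add: A.fan.simplex_of_def)
    ultimately show "T \<in> dkk_triangulation (dag s) w" unfolding dkk_triangulation_def by blast
  qed
qed

end

section \<open>The coherence diagram in terms of arcs\<close>

context framed_shape
begin

section \<open>End edges and junctions\<close>

lemma lowE_eq:
  assumes "low_pos j p" "low_pos j' p'" "lowE j p = lowE j' p'"
  shows "j = j' \<and> p = p'"
proof -
  note P = low_posD[OF assms(1)] and P' = low_posD[OF assms(2)]
  have e: "vtx (max p (lo j)) = vtx (max p' (lo j'))" "p < lo j \<longleftrightarrow> p' < lo j'"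
    using assms(3) by (auto simp: lowE_def split: if_splits)
  have "okt j (max p (lo j))" "okt j' (max p' (lo j'))"
    using P P' okt_low by (auto simp: max_def)
  then have "j = j'" "max p (lo j) = max p' (lo j')" using A.tail_unique e(1) by blast+
  then show ?thesis using e(2) P P' by auto
qed

lemma highE_eq:
  assumes "high_pos j q" "high_pos j' q'" "highE j q = highE j' q'"
  shows "j = j' \<and> q = q'"
proof -
  note Q = high_posD[OF assms(1)] and Q' = high_posD[OF assms(2)]
  have e: "vtx (min q (hi j)) = vtx (min q' (hi j'))" "hi j < q \<longleftrightarrow> hi j' < q'"
    using assms(3) by (auto simp: highE_def split: if_splits)
  have "okh j (min q (hi j))" "okh j' (min q' (hi j'))"
    using Q Q' okh_high by (auto simp: min_def)
  then have "j = j'" "min q (hi j) = min q' (hi j')" using A.head_unique e(1) by blast+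
  then show ?thesis using e(2) Q Q' by auto
qed

text \<open>At a junction one edge serves both legs: a turn for one leg is the absence of a turn for
  the other. This is how a row or column comes to contain routes of two legs.\<close>

lemma lowE_highE:
  assumes "low_pos j p" "high_pos j' q'"
  shows "lowE j p = highE j' q' \<longleftrightarrow>
    A.adj j' j \<and> (p = lo j \<and> q' = hi j' + 1 \<or> p = lo j - 1 \<and> q' = hi j')"
proof
  note P = low_posD[OF assms(1)] and Q = high_posD[OF assms(2)]
  assume eq: "lowE j p = highE j' q'"
  then have e: "odd j \<longleftrightarrow> even j'" "vtx (max p (lo j)) = vtx (min q' (hi j'))" "p < lo j \<longleftrightarrow> \<not> hi j' < q'"
    by (auto simp: lowE_def highE_def split: if_splits)
  have ok: "okt j (max p (lo j))" "okh j' (min q' (hi j'))" using P Q okt_low okh_high by (auto simp: max_def min_def)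
  have ne: "j' \<noteq> j" using e(1) by auto
  then have h: "min q' (hi j') = hi j'" "max p (lo j) = lo j" using A.head_tail[OF ok(2,1)] e(2) by auto
  then have "A.adj j' j" using ne ok e(2) by (simp add: A.adj_def)
  moreover have "p = lo j \<and> q' = hi j' + 1 \<or> p = lo j - 1 \<and> q' = hi j'"
    using h e(3) P Q by (cases "p < lo j") auto
  ultimately show "A.adj j' j \<and> (p = lo j \<and> q' = hi j' + 1 \<or> p = lo j - 1 \<and> q' = hi j')" by blast
next
  assume a: "A.adj j' j \<and> (p = lo j \<and> q' = hi j' + 1 \<or> p = lo j - 1 \<and> q' = hi j')"
  then have "vtx (hi j') = vtx (lo j)" "odd j' \<longleftrightarrow> even j" using adj_parity by (auto simp: A.adj_def)
  then show "lowE j p = highE j' q'" using a lo_ge_1[of j] by (auto simp: lowE_def highE_def)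
qed

section \<open>Legs and short exceptional routes\<close>

definition leg_path :: "nat \<Rightarrow> edge list" where
  "leg_path j = (if odd j then seg (lo j) (hi j) else rev (seg (lo j) (hi j)))"

lemma inner_arcs: "pre_digraph.arcs (inner_graph (dag s)) = InnerEdge ` {1..E}"
proof -
  have "Inner (inner_tail s i) \<in> Inner ` N \<and> Inner (inner_head s i) \<in> Inner ` N" if i: "1 \<le> i" "i \<le> E" for i
  proof -
    obtain j where j: "j \<in> L" "lo j \<le> i" "i < hi j" by (rule leg_of_edge[OF i])
    then show ?thesis using inner_pos[OF j] vtx_N[of j i] vtx_N[of j "Suc i"] by auto
  qed
  then show ?thesis
    unfolding inner_graph_def induce_subgraph_arcs inner_vertices_eq dag_simps
  proof (intro set_eqI iffI)
    fix e assume "e \<in> {e \<in> dag_edges s. edge_tail s e \<in> Inner ` N \<and> edge_head s e \<in> Inner ` N}"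
    then show "e \<in> InnerEdge ` {1..E}" by (cases e) (auto simp: InnerEdge_mem)
  qed (auto simp: InnerEdge_mem)
qed

lemma inner_path_iff:
  assumes "p \<noteq> []"
  shows "inner_path (dag s) p \<longleftrightarrow> (\<exists>u v. u \<in> Inner ` N \<and> set p \<subseteq> InnerEdge ` {1..E} \<and> wk u p v \<and>
    distinct (map (edge_tail s) p @ [edge_head s (last p)]))"
proof -
  have t: "tail (inner_graph (dag s)) = edge_tail s" "head (inner_graph (dag s)) = edge_head s"
    "verts (inner_graph (dag s)) = Inner ` N"
    by (simp_all add: inner_graph_def inner_vertices_eq)
  show ?thesis using assms
    by (simp add: inner_path_def pre_digraph.apath_def pre_digraph.awalk_def pre_digraph.awalk_verts_conv
        t inner_arcs cas_wk[OF t(1,2)])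
qed

lemma wk_last: "wk u p v \<Longrightarrow> p \<noteq> [] \<Longrightarrow> edge_head s (last p) = v"
  by (induction p arbitrary: u) auto

lemma leg_code: "j \<in> L \<Longrightarrow> (j, lo j - 1, hi j + 1) \<in> codes"
  using lo_less_hi[of j] by (auto simp: codes_def low_pos_def high_pos_def)

lemma rt_leg: "j \<in> L \<Longrightarrow> rt (j, lo j - 1, hi j + 1) =
    (if odd j then lowE j (lo j - 1) # leg_path j @ [highE j (hi j + 1)]
     else highE j (hi j + 1) # leg_path j @ [lowE j (lo j - 1)])"
  using lo_ge_1[of j] by (simp add: rt_def leg_path_def)

lemma leg_path_ne: "j \<in> L \<Longrightarrow> leg_path j \<noteq> []"
  using lo_less_hi[of j] by (simp add: leg_path_def seg_eq_Nil)

lemma leg_path_set: "set (leg_path j) = InnerEdge ` {lo j..<hi j}"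
  by (simp add: leg_path_def seg_set)

lemma leg_path_walk:
  assumes "j \<in> L"
  shows "wk (Inner (vtx (if odd j then lo j else hi j))) (leg_path j) (Inner (vtx (if odd j then hi j else lo j)))"
  using walk_seg[OF assms order_refl less_imp_le[OF lo_less_hi[OF assms]] order_refl] by (simp add: leg_path_def)

lemma leg_path_inner_path:
  assumes "j \<in> L" shows "inner_path (dag s) (leg_path j)"
proof -
  let ?v = "Inner (vtx (if odd j then hi j else lo j))"
  have "route (dag s) (rt (j, lo j - 1, hi j + 1))" by (rule code_route[OF leg_code[OF assms]])
  then have d: "distinct (map (edge_tail s) (rt (j, lo j - 1, hi j + 1)) @ [Sink])" by (simp add: route_iff)
  have "edge_tail s (highE j (hi j + 1)) = ?v" if "odd j" using that by (simp add: highE_def)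
  moreover have "edge_tail s (lowE j (lo j - 1)) = ?v" if "even j" using that by (simp add: lowE_def)
  ultimately have "distinct (map (edge_tail s) (leg_path j) @ [?v])"
    using d unfolding rt_leg[OF assms] by (cases "odd j") auto
  moreover have "edge_head s (last (leg_path j)) = ?v" by (rule wk_last[OF leg_path_walk[OF assms] leg_path_ne[OF assms]])
  moreover have "Inner (vtx (if odd j then lo j else hi j)) \<in> Inner ` N"
    using vtx_N[OF assms] lo_less_hi[OF assms] by auto
  moreover have "set (leg_path j) \<subseteq> InnerEdge ` {1..E}"
    unfolding leg_path_set using lo_ge_1[of j] hi_le[OF assms] by auto
  ultimately show ?thesis unfolding inner_path_iff[OF leg_path_ne[OF assms]]
    using leg_path_walk[OF assms] by auto
qed

text \<open>Two legs meeting at a common end both finish or both start there, so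
  \<open>leg_path\<close> cannot be prolonged.\<close>

lemma no_edge_from_leg_end:
  assumes "j \<in> L" "1 \<le> i" "i \<le> E"
  shows "inner_tail s i \<noteq> vtx (if odd j then hi j else lo j)" "inner_head s i \<noteq> vtx (if odd j then lo j else hi j)"
proof -
  obtain k where k: "k \<in> L" "lo k \<le> i" "i < hi k" by (rule leg_of_edge[OF assms(2,3)])
  note I = inner_pos[OF k]
  have ok: "okt k i" "okh k (Suc i)" using okt_less[OF k] okh_greater[of k "Suc i"] k by auto
  note l = okt_low[OF assms(1)] and h = okh_high[OF assms(1)]
  note c1 = parity_clash(1)[OF ok(1) l] and c2 = parity_clash(2)[OF ok(2) h]
    and c3 = parity_clash(3)[OF ok(2) l] and c4 = parity_clash(3)[OF h ok(1)]
  show "inner_tail s i \<noteq> vtx (if odd j then hi j else lo j)"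
    using I(6) c1 c2 c3 c4 k by (cases "odd j"; cases "odd k") auto
  show "inner_head s i \<noteq> vtx (if odd j then lo j else hi j)"
    using I(7) c1 c2 c3 c4 k by (cases "odd j"; cases "odd k") auto
qed

lemma leg_path_leg:
  assumes "j \<in> L" shows "leg (dag s) (leg_path j)"
  unfolding leg_def inner_route_def
proof (intro conjI allI impI)
  show "inner_path (dag s) (leg_path j)" by (rule leg_path_inner_path[OF assms])
  have "inner_label s i = (if odd j then 2 else 1)" if "lo j \<le> i" "i < hi j" for i
    using inner_pos(8)[OF assms that] .
  then show "constant_label (dag s) (leg_path j)"
    unfolding constant_label_def leg_path_set by (intro exI[of _ "if odd j then 2 else 1"]) auto
  fix p assume p: "inner_path (dag s) p \<and> sublist (leg_path j) p"
  then obtain ps ss where ps: "p = ps @ leg_path j @ ss" unfolding sublist_def by blast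
  have "p \<noteq> []" using ps leg_path_ne[OF assms] by simp
  then obtain u v where uv: "set p \<subseteq> InnerEdge ` {1..E}" "wk u p v" using p inner_path_iff by blast
  then obtain x y where xy: "wk u ps x" "wk x (leg_path j) y" "wk y ss v" unfolding ps wk_append by blast
  have uniq: "x = x' \<and> y = y'" if "wk x q y" "wk x' q y'" "q \<noteq> []" for x y x' y' q
    using that wk_last[of x q y] wk_last[of x' q y'] by (cases q) auto
  have e: "x = Inner (vtx (if odd j then lo j else hi j))" "y = Inner (vtx (if odd j then hi j else lo j))"
    using uniq[OF xy(2) leg_path_walk[OF assms] leg_path_ne[OF assms]] by auto
  have "ss = []"
  proof (cases ss)
    case (Cons f fs)
    then obtain i where "f = InnerEdge i" "1 \<le> i" "i \<le> E" using uv ps by auto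
    then show ?thesis using no_edge_from_leg_end(1)[OF assms, of i] xy(3) Cons e(2) by simp
  qed simp
  moreover have "ps = []"
  proof (rule ccontr)
    assume ne: "ps \<noteq> []"
    then have "last ps \<in> set p" using ps by simp
    then obtain i where i: "last ps = InnerEdge i" "1 \<le> i" "i \<le> E" using uv by auto
    then show False using no_edge_from_leg_end(2)[OF assms, of i] wk_last[OF xy(1) ne] e(1) by simp
  qed
  ultimately show "p = leg_path j" using ps by simp
qed

lemma leg_inner_edges:
  assumes "leg (dag s) p" shows "p \<noteq> []" "set p \<subseteq> InnerEdge ` {1..E}"
proof -
  have J: "r \<in> L" using r_pos by (simp add: L_def)
  show ne: "p \<noteq> []"
  proof
    assume "p = []"
    then have "leg_path r = []" using assms leg_path_inner_path[OF J] unfolding leg_def inner_route_def by auto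
    then show False using leg_path_ne[OF J] by simp
  qed
  show "set p \<subseteq> InnerEdge ` {1..E}" using assms inner_path_iff[OF ne] unfolding leg_def inner_route_def by blast
qed

lemma lowE_not_inner: "lowE j p \<noteq> InnerEdge i" and highE_not_inner: "highE j q \<noteq> InnerEdge i"
  by (auto simp: lowE_def highE_def)

lemma short_exceptional_iff:
  "short_exceptional (dag s) R \<longleftrightarrow> (\<exists>j p. okt j p \<and> okh j p \<and> R = rt (j, p, p))"
proof
  assume R: "short_exceptional (dag s) R"
  then obtain c where c: "c \<in> codes" "exc c" "R = rt c"
    unfolding short_exceptional_def exceptional_route by blast
  obtain j p q where cj: "c = (j, p, q)" by (cases c)
  note C = codesD[OF c(1)[unfolded cj]]
  note P = low_posD[OF C(1)] and Q = high_posD[OF C(2)]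
  have "p = q"
  proof (rule ccontr)
    assume "p \<noteq> q"
    then have "p = lo j - 1" "q = hi j + 1" using c(2) cj P Q by auto
    then have "sublist (leg_path j) R" using rt_leg[OF P(1)] unfolding c(3) cj
      by (auto simp: sublist_Cons_right)
    then show False using R leg_path_leg[OF P(1)] unfolding short_exceptional_def long_exceptional_def by blast
  qed
  then show "\<exists>j p. okt j p \<and> okh j p \<and> R = rt (j, p, p)" using P Q c(3) cj by auto
next
  assume "\<exists>j p. okt j p \<and> okh j p \<and> R = rt (j, p, p)"
  then obtain j p where jp: "okt j p" "okh j p" "R = rt (j, p, p)" by blast
  then have m: "(j, p, p) \<in> codes" using A.okt[OF jp(1)] by (auto simp: codes_def low_pos_def high_pos_def)
  have "exceptional (dag s) R" using exceptional_rt[OF m] jp(3) by simp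
  moreover have "\<not> sublist p' R" if lg: "leg (dag s) p'" for p'
  proof
    assume sub: "sublist p' R"
    obtain e where e: "e \<in> set p'" using leg_inner_edges(1)[OF lg] by (cases p') auto
    then have "e \<in> set R" using sub by (auto simp: sublist_def)
    moreover obtain i where "e = InnerEdge i" using e leg_inner_edges(2)[OF lg] by blast
    ultimately show False using A.okt[OF jp(1)] lowE_not_inner highE_not_inner unfolding jp(3) set_rt
      by (auto dest: sym)
  qed
  ultimately show "short_exceptional (dag s) R" unfolding short_exceptional_def long_exceptional_def by blast
qed

lemma on_short_iff: "on_short s e \<longleftrightarrow> (\<exists>j p. okt j p \<and> okh j p \<and> (e = lowE j p \<or> e = highE j p))"
proof -
  have "e \<in> set (rt (j, p, p)) \<longleftrightarrow> e = lowE j p \<or> e = highE j p" if "okt j p" for j p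
    using A.okt[OF that] by (auto simp: set_rt)
  then show ?thesis unfolding on_short_def short_exceptional_iff by blast
qed

text \<open>An edge shared with a neighbouring leg sits at a junction, where no position is both
  head and tail, so it lies on no short exceptional route.\<close>

lemma on_short_lowE:
  assumes "low_pos j p" shows "on_short s (lowE j p) \<longleftrightarrow> lo j \<le> p \<and> okh j p"
proof
  assume "on_short s (lowE j p)"
  then obtain k x where k: "okt k x" "okh k x" "lowE j p = lowE k x \<or> lowE j p = highE k x"
    unfolding on_short_iff by blast
  have kx: "low_pos k x" "high_pos k x" using k A.okt[OF k(1)] by (auto simp: low_pos_def high_pos_def)
  from k(3) show "lo j \<le> p \<and> okh j p"
  proof
    assume "lowE j p = lowE k x"
    then show ?thesis using lowE_eq[OF assms kx(1)] k A.okt[OF k(1)] by auto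
  next
    assume "lowE j p = highE k x"
    then have "A.adj k j" "x = hi k \<or> x = hi k + 1" using lowE_highE[OF assms kx(2)] by auto
    then show ?thesis using adj_ends(1)[of k j x] kx(1) A.okt[OF k(1)] by auto
  qed
next
  assume "lo j \<le> p \<and> okh j p"
  then show "on_short s (lowE j p)" using low_posD[OF assms] unfolding on_short_iff by blast
qed

lemma on_short_highE:
  assumes "high_pos j q" shows "on_short s (highE j q) \<longleftrightarrow> q \<le> hi j \<and> okt j q"
proof
  assume "on_short s (highE j q)"
  then obtain k x where k: "okt k x" "okh k x" "highE j q = lowE k x \<or> highE j q = highE k x"
    unfolding on_short_iff by blast
  have kx: "low_pos k x" "high_pos k x" using k A.okt[OF k(1)] by (auto simp: low_pos_def high_pos_def)
  from k(3) show "q \<le> hi j \<and> okt j q"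
  proof
    assume "highE j q = highE k x"
    then show ?thesis using highE_eq[OF assms kx(2)] k A.okt[OF k(1)] by auto
  next
    assume "highE j q = lowE k x"
    then have "A.adj j k" "x = lo k \<or> x = lo k - 1" using lowE_highE[OF kx(1) assms] by auto
    then show ?thesis using adj_ends(2)[of j k x] kx(2) A.okt[OF k(1)] lo_ge_1[of k] by auto
  qed
next
  assume "q \<le> hi j \<and> okt j q"
  then show "on_short s (highE j q)" using high_posD[OF assms] unfolding on_short_iff by blast
qed

text \<open>The signs in the names make one formula valid for both parities: minus for an absent
  turn, plain on a short exceptional route, plus otherwise. It increases with
  \<open>p\<close>.\<close>

lemma rank_low:
  assumes "low_pos j p"
  shows "name_rank s (lowE j p) = 3 * max p (lo j) + (if p < lo j then 0 else if okh j p then 1 else 2)"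
proof -
  note P = low_posD[OF assms]
  have "\<not> (cyc \<and> max p (lo j) = E + 1)"
    using P lo_less_hi[OF P(1)] hi_le[OF P(1)] by (auto simp: okt_def max_def split: if_splits)
  then have v: "vtx (max p (lo j)) = max p (lo j)" by (auto simp: vtx_def)
  show ?thesis
  proof (cases "odd j")
    case True
    then have "lowE j p = SourceEdge (max p (lo j)) (if p < lo j then 2 else 1)" by (simp add: lowE_def v)
    then show ?thesis using on_short_lowE[OF assms] by (simp add: name_rank.simps)
  next
    case False
    then have "lowE j p = SinkEdge (max p (lo j)) (if p < lo j then 1 else 2)" by (simp add: lowE_def v)
    then show ?thesis using on_short_lowE[OF assms] by (simp add: name_rank.simps)
  qed
qed

lemma rank_high:
  assumes "high_pos j q"
  shows "name_rank s (highE j q) = 3 * vtx (min q (hi j)) + (if hi j < q then 2 else if okt j q then 1 else 0)"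
proof (cases "odd j")
  case True
  then have "highE j q = SinkEdge (vtx (min q (hi j))) (if hi j < q then 2 else 1)" by (simp add: highE_def)
  then show ?thesis using on_short_highE[OF assms] by (simp add: name_rank.simps)
next
  case False
  then have "highE j q = SourceEdge (vtx (min q (hi j))) (if hi j < q then 1 else 2)" by (simp add: highE_def)
  then show ?thesis using on_short_highE[OF assms] by (simp add: name_rank.simps)
qed

section \<open>Positions in the coherence diagram\<close>

lemma hd_last_rt:
  "hd (rt (j, p, q)) = (if odd j then lowE j p else highE j q)"
  "last (rt (j, p, q)) = (if odd j then highE j q else lowE j p)"
  by (simp_all add: rt_def hd_append)

lemma last_leg_eq: "last_leg (lens s) = rev (seg (lo r) (hi r))"
proof -
  have "sum_list (butlast (lens s)) = psum (r - 1)" by (simp add: psum_def r_def butlast_conv_take)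
  moreover have "sum_list (lens s) = psum r" by (simp add: psum_def r_def)
  ultimately show ?thesis by (simp add: last_leg_def seg_def lo_def hi_def rev_map)
qed

text \<open>A source edge at vertex 1 is at the low end of leg 1 or, across the seam, at the high
  end of leg \<open>r\<close>. A route of the first kind contains inner edge 1, which is not on the
  last leg.\<close>

lemma in_bottom_row_rt:
  assumes "(j, p, q) \<in> codes"
  shows "in_bottom_row s (rt (j, p, q)) \<longleftrightarrow> cyc \<and> j = r \<and> hi j \<le> q"
proof -
  have b: "in_bottom_row s R \<longleftrightarrow> cyc \<and> edge_head s (hd R) = Inner 1 \<and> lies_on (dag s) R (last_leg (lens s))" for R
    unfolding cyc_def by (cases s) auto
  note C = codesD[OF assms]
  note P = low_posD[OF C(1)] and Q = high_posD[OF C(2)]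
  have rL: "r \<in> L" using r_pos by (simp add: L_def)
  show ?thesis
  proof
    assume a: "in_bottom_row s (rt (j, p, q))"
    then have cyc: cyc and h: "edge_head s (hd (rt (j, p, q))) = Inner 1"
      and l: "set (rt (j, p, q)) \<inter> InnerEdge ` {1..E} \<subseteq> InnerEdge ` {lo r..<hi r}"
      unfolding b by (auto simp: lies_on_def inner_arcs last_leg_eq seg_set)
    have lo_V: "lo j < min q (hi j)"
      using Q lo_less_hi[OF Q(1)] cyc by (cases "q \<le> hi j") (auto simp: okh_def)
    have U_hi: "max p (lo j) < hi j"
      using P lo_less_hi[OF P(1)] cyc by (cases "lo j \<le> p") (auto simp: okt_def)
    show "cyc \<and> j = r \<and> hi j \<le> q"
    proof (cases "odd j")
      case True
      then have "vtx (max p (lo j)) = 1" using h by (simp add: hd_last_rt lowE_def)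
      then have U: "max p (lo j) = 1" using U_hi hi_le[OF P(1)] by (auto simp: vtx_def split: if_splits)
      then have "lo j = 1" using lo_ge_1[of j] by (simp add: max_def split: if_splits)
      then have "InnerEdge 1 \<in> set (rt (j, p, q)) \<inter> InnerEdge ` {1..E}"
        using lo_V U hi_le[OF P(1)] unfolding set_rt by auto
      then have "lo r \<le> 1" using l by auto
      then have "r = 1" using lo_eq_1[OF rL] lo_ge_1[of r] by simp
      then show ?thesis using cyc_r[OF cyc] by simp
    next
      case False
      then have "vtx (min q (hi j)) = 1" using h by (simp add: hd_last_rt highE_def)
      moreover have "min q (hi j) \<noteq> 1" using lo_V lo_ge_1[of j] by linarith
      ultimately have "min q (hi j) = E + 1" unfolding vtx_def by presburger
      then have "hi j = E + 1" "hi j \<le> q" using hi_le[OF P(1)] by auto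
      then show ?thesis using cyc hi_eq_top[OF P(1)] by simp
    qed
  next
    assume a: "cyc \<and> j = r \<and> hi j \<le> q"
    then have ev: "even j" using cyc_even by simp
    have V: "min q (hi j) = hi r" using a by auto
    have "edge_head s (hd (rt (j, p, q))) = Inner 1"
      using ev V a hi_r by (simp add: hd_last_rt highE_def vtx_def)
    moreover have "lies_on (dag s) (rt (j, p, q)) (last_leg (lens s))"
      unfolding lies_on_def
    proof
      show "set (rt (j, p, q)) \<inter> pre_digraph.arcs (inner_graph (dag s)) \<subseteq> set (last_leg (lens s))"
        using a lowE_not_inner highE_not_inner unfolding inner_arcs last_leg_eq set_rt by (auto simp: seg_set dest: sym)
      have pv: "Inner (vtx x) \<in> path_vertices (dag s) (last_leg (lens s))" if "lo r \<le> x" "x \<le> hi r" for x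
      proof (cases "x < hi r")
        case True
        then have "edge_head s (InnerEdge x) = Inner (vtx x)" using inner_pos(7)[OF rL that(1) True] ev a by simp
        moreover have "InnerEdge x \<in> set (last_leg (lens s))" using that True by (simp add: last_leg_eq seg_set)
        ultimately show ?thesis unfolding path_vertices_def by (metis UnI2 dag_simps(4) image_eqI)
      next
        case False
        then have x: "Suc (x - 1) = x" "lo r \<le> x - 1" "x - 1 < hi r" using that lo_less_hi[OF rL] by auto
        then have "edge_tail s (InnerEdge (x - 1)) = Inner (vtx x)" using inner_pos(6)[OF rL x(2,3)] ev a by simp
        moreover have "InnerEdge (x - 1) \<in> set (last_leg (lens s))" using x by (simp add: last_leg_eq seg_set)
        ultimately show ?thesis unfolding path_vertices_def by (metis UnI1 dag_simps(3) image_eqI)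
      qed
      show "path_vertices (dag s) (rt (j, p, q)) \<inter> inner_vertices (dag s) \<subseteq> path_vertices (dag s) (last_leg (lens s))"
      proof
        fix y assume y: "y \<in> path_vertices (dag s) (rt (j, p, q)) \<inter> inner_vertices (dag s)"
        then obtain e where e: "e \<in> set (rt (j, p, q))" "y = edge_tail s e \<or> y = edge_head s e" "y \<in> Inner ` N"
          by (auto simp: path_vertices_def inner_vertices_eq)
        then consider "e = lowE j p" | "e = highE j q" | i where "e = InnerEdge i" "max p (lo j) \<le> i" "i < min q (hi j)"
          unfolding set_rt by auto
        then have "\<exists>x. lo r \<le> x \<and> x \<le> hi r \<and> y = Inner (vtx x)"
        proof cases
          case 1
          then have "y = Inner (vtx (max p (lo j)))" using e ev by (auto simp: lowE_def)
          then show ?thesis using a C by (intro exI[of _ "max p (lo j)"]) auto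
        next
          case 2
          then have "y = Inner (vtx (min q (hi j)))" using e ev by (auto simp: highE_def)
          then show ?thesis using a C by (intro exI[of _ "min q (hi j)"]) auto
        next
          case 3
          then have i: "lo j \<le> i" "i < hi j" by auto
          then have "y = Inner (vtx i) \<or> y = Inner (vtx (Suc i))"
            using e(2) 3(1) inner_pos(6,7)[OF P(1) i] ev by auto
          then show ?thesis using i a by (metis Suc_leI le_SucI less_imp_le)
        qed
        then show "y \<in> path_vertices (dag s) (last_leg (lens s))" using pv by blast
      qed
    qed
    ultimately show "in_bottom_row s (rt (j, p, q))" unfolding b using a by simp
  qed
qed

text \<open>For a route on an odd leg the high end determines the column; on an even leg it
  determines the row.\<close>

definition high_coord :: "nat \<Rightarrow> edge list \<Rightarrow> nat" where
  "high_coord j R = (if odd j then horizontal_pos s R else vertical_pos s R)"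

definition low_coord :: "nat \<Rightarrow> edge list \<Rightarrow> nat" where
  "low_coord j R = (if odd j then vertical_pos s R else horizontal_pos s R)"

lemma coords_rt:
  fixes j p q defines "b \<equiv> cyc \<and> j = r \<and> hi j \<le> q" and "M \<equiv> 3 * (num_inner s + 1)"
  assumes "(j, p, q) \<in> codes"
  shows "odd j \<Longrightarrow> vertical_pos s (rt (j, p, q)) = name_rank s (lowE j p)"
    "odd j \<Longrightarrow> horizontal_pos s (rt (j, p, q)) = name_rank s (highE j q) + M"
    "even j \<Longrightarrow> vertical_pos s (rt (j, p, q)) = name_rank s (highE j q) + (if b then M else 0)"
    "even j \<Longrightarrow> horizontal_pos s (rt (j, p, q)) = name_rank s (lowE j p) + (if b then 0 else M)"
proof -
  have "\<not> b" if "odd j" using that cyc_even by (auto simp: b_def)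
  then show "odd j \<Longrightarrow> vertical_pos s (rt (j, p, q)) = name_rank s (lowE j p)"
    "odd j \<Longrightarrow> horizontal_pos s (rt (j, p, q)) = name_rank s (highE j q) + M"
    "even j \<Longrightarrow> vertical_pos s (rt (j, p, q)) = name_rank s (highE j q) + (if b then M else 0)"
    "even j \<Longrightarrow> horizontal_pos s (rt (j, p, q)) = name_rank s (lowE j p) + (if b then 0 else M)"
    using in_bottom_row_rt[OF assms(3)]
    by (auto simp: vertical_pos_def horizontal_pos_def hd_last_rt b_def M_def)
qed

lemma vtx_high_odd:
  assumes "high_pos j q" "odd j" shows "vtx (min q (hi j)) = min q (hi j)"
proof -
  note Q = high_posD[OF assms(1)]
  have "\<not> (cyc \<and> hi j = E + 1)" using hi_eq_top[OF Q(1)] cyc_even assms(2) by auto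
  then show ?thesis using hi_le[OF Q(1)] by (auto simp: vtx_def)
qed

lemma vtx_high_even:
  assumes "high_pos j q" "\<not> (cyc \<and> j = r \<and> hi j \<le> q)"
  shows "vtx (min q (hi j)) = min q (hi j)" "min q (hi j) \<le> num_inner s"
proof -
  note Q = high_posD[OF assms(1)]
  have "\<not> (cyc \<and> min q (hi j) = E + 1)" using hi_eq_top[OF Q(1)] hi_le[OF Q(1)] assms(2) by (auto simp: min_def split: if_splits)
  then show "vtx (min q (hi j)) = min q (hi j)" "min q (hi j) \<le> num_inner s"
    using hi_le[OF Q(1)] by (auto simp: vtx_def num_inner_eq)
qed

text \<open>Monotony is endangered only at the seam, where \<open>vtx\<close> returns to 1; the
  offset given to the bottom rows repairs it.\<close>

lemma high_coord_less:
  assumes "(j, p, q) \<in> codes" "(j, p, q') \<in> codes"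
  shows "high_coord j (rt (j, p, q)) < high_coord j (rt (j, p, q')) \<longleftrightarrow> q < q'"
proof -
  have H: "high_pos j q" "high_pos j q'" using codesD assms by blast+
  note Q = high_posD[OF H(1)] and Q' = high_posD[OF H(2)]
  have mono: "high_coord j (rt (j, p, q)) < high_coord j (rt (j, p, q'))"
    if "(j, p, q) \<in> codes" "(j, p, q') \<in> codes" "q < q'" for q q'
  proof -
    have H: "high_pos j q" "high_pos j q'" using codesD that by blast+
    note Q = high_posD[OF H(1)] and Q' = high_posD[OF H(2)]
    show ?thesis
    proof (cases "odd j")
      case True
      then show ?thesis unfolding high_coord_def
        using coords_rt(2)[OF that(1)] coords_rt(2)[OF that(2)] rank_high[OF H(1)] rank_high[OF H(2)]
          vtx_high_odd[OF H(1)] vtx_high_odd[OF H(2)] that(3) Q Q' by auto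
    next
      case False
      show ?thesis
      proof (cases "cyc \<and> j = r \<and> hi j \<le> q'")
        case b': True
        show ?thesis
        proof (cases "hi j \<le> q")
          case True
          then have "q = hi j" "q' = hi j + 1" using that(3) Q' by auto
          then show ?thesis unfolding high_coord_def
            using False coords_rt(3)[OF that(1)] coords_rt(3)[OF that(2)] rank_high[OF H(1)] rank_high[OF H(2)] b' by auto
        next
          case q: False
          have "vtx (min q (hi j)) \<le> num_inner s" using vtx_high_even[OF H(1)] q by auto
          then show ?thesis unfolding high_coord_def
            using False coords_rt(3)[OF that(1)] coords_rt(3)[OF that(2)] rank_high[OF H(1)] rank_high[OF H(2)] b' q by auto
        qed
      next
        case b': False
        then have b: "\<not> (cyc \<and> j = r \<and> hi j \<le> q)" using that(3) by auto
        show ?thesis unfolding high_coord_def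
          using False coords_rt(3)[OF that(1)] coords_rt(3)[OF that(2)] rank_high[OF H(1)] rank_high[OF H(2)]
            vtx_high_even(1)[OF H(1) b] vtx_high_even(1)[OF H(2) b'] b b' that(3) Q Q' by auto
      qed
    qed
  qed
  show ?thesis using mono[OF assms] mono[OF assms(2,1)] by (cases q q' rule: linorder_cases) auto
qed

lemma low_coord_less:
  assumes "(j, p, q) \<in> codes" "(j, p', q) \<in> codes"
  shows "low_coord j (rt (j, p, q)) < low_coord j (rt (j, p', q)) \<longleftrightarrow> p < p'"
proof -
  have mono: "low_coord j (rt (j, p, q)) < low_coord j (rt (j, p', q))"
    if "(j, p, q) \<in> codes" "(j, p', q) \<in> codes" "p < p'" for p p'
  proof -
    have H: "low_pos j p" "low_pos j p'" using codesD that by blast+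
    note P = low_posD[OF H(1)] and P' = low_posD[OF H(2)]
    have "name_rank s (lowE j p) < name_rank s (lowE j p')"
      unfolding rank_low[OF H(1)] rank_low[OF H(2)] using that(3) P P' by auto
    then show ?thesis unfolding low_coord_def
      using coords_rt(1)[OF that(1)] coords_rt(1)[OF that(2)] coords_rt(4)[OF that(1)] coords_rt(4)[OF that(2)] by auto
  qed
  show ?thesis using mono[OF assms] mono[OF assms(2,1)] by (cases p p' rule: linorder_cases) auto
qed

text \<open>In the line of a shared edge the routes of \<open>j'\<close> precede those of
  \<open>j\<close>: the other end of a route on \<open>j'\<close> lies below the junction, that of a
  route on \<open>j\<close> at it or above. Across the seam the offset between bottom and top rows
  orders them.\<close>

lemma coord_across:
  assumes c: "(j, p, q) \<in> codes" and d: "(j', p', q') \<in> codes" and eq: "lowE j p = highE j' q'"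
  shows "high_coord j (rt (j', p', q')) < high_coord j (rt (j, p, q))"
proof -
  note C = codesD[OF c] and D = codesD[OF d]
  note P = low_posD[OF C(1)] and Q = high_posD[OF C(2)] and P' = low_posD[OF D(1)] and Q' = high_posD[OF D(2)]
  have adj: "A.adj j' j" and q': "hi j' \<le> q'" using lowE_highE[OF C(1) D(2)] eq by auto
  have par: "odd j' \<longleftrightarrow> even j" by (rule adj_parity[OF adj])
  have "p' \<noteq> hi j'" by (rule adj_ends(1)[OF adj D(1)])
  then have U: "max p' (lo j') < hi j'" using P' lo_less_hi[OF P'(1)] by auto
  have rl: "name_rank s (lowE j' p') < 3 * hi j'" unfolding rank_low[OF D(1)] using U by auto
  have V: "lo j \<le> min q (hi j)" using Q lo_less_hi[OF Q(1)] by auto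
  have hl: "hi j' = lo j \<or> cyc \<and> j' = r \<and> j = 1"
    using adj_iff[OF P'(1) P(1)] adj by (auto simp: lo_def hi_def)
  show ?thesis
  proof (cases "odd j")
    case True
    have rh: "3 * lo j \<le> name_rank s (highE j q)"
      unfolding rank_high[OF C(2)] vtx_high_odd[OF C(2) True] using V by simp
    show ?thesis
    proof (cases "cyc \<and> j' = r")
      case b: True
      have "hi j' \<le> num_inner s + 1" using hi_le[OF P'(1)] b by (simp add: num_inner_eq)
      then have "name_rank s (lowE j' p') < 3 * (num_inner s + 1)" using rl by simp
      then show ?thesis unfolding high_coord_def
        using True par coords_rt(4)[OF d] coords_rt(2)[OF c] b q' by simp
    next
      case False
      then show ?thesis unfolding high_coord_def
        using True par coords_rt(4)[OF d] coords_rt(2)[OF c] hl rl rh by auto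
    qed
  next
    case False
    then have e: "hi j' = lo j" using hl by auto
    have "name_rank s (lowE j' p') < vertical_pos s (rt (j, p, q))"
    proof (cases "cyc \<and> j = r \<and> hi j \<le> q")
      case True
      have "lo j \<le> num_inner s" using lo_less_hi[OF P(1)] hi_le[OF P(1)] True by (simp add: num_inner_eq)
      then show ?thesis using coords_rt(3)[OF c] False True rl e by auto
    next
      case b: False
      show ?thesis using coords_rt(3)[OF c] False b rl e rank_high[OF C(2)] vtx_high_even(1)[OF C(2) b] V by auto
    qed
    then show ?thesis unfolding high_coord_def using False par coords_rt(1)[OF d] by simp
  qed
qed

lemma coord_parity: "(odd j \<longleftrightarrow> even j') \<Longrightarrow> low_coord j' R = high_coord j R"
  by (auto simp: low_coord_def high_coord_def)

definition share_low :: "nat \<times> nat \<times> nat \<Rightarrow> edge list \<Rightarrow> bool" where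
  "share_low c R \<longleftrightarrow> route (dag s) R \<and>
    (if odd (fst c) then hd R = hd (rt c) else last R = last (rt c))"

definition share_high :: "nat \<times> nat \<times> nat \<Rightarrow> edge list \<Rightarrow> bool" where
  "share_high c R \<longleftrightarrow> route (dag s) R \<and>
    (if odd (fst c) then last R = last (rt c) else hd R = hd (rt c))"

lemma share_low_rt:
  assumes "(j, p, q) \<in> codes" "(j', p', q') \<in> codes"
  shows "share_low (j, p, q) (rt (j', p', q')) \<longleftrightarrow> j = j' \<and> p = p' \<or> lowE j p = highE j' q'"
proof -
  have P: "low_pos j p" "low_pos j' p'" "high_pos j' q'" using codesD assms by blast+
  have "share_low (j, p, q) (rt (j', p', q')) \<longleftrightarrow> lowE j p = (if odd j \<longleftrightarrow> odd j' then lowE j' p' else highE j' q')"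
    using code_route[OF assms(2)] by (auto simp: share_low_def hd_last_rt)
  then show ?thesis
    using lowE_eq[OF P(1,2)] lowE_highE[OF P(1,3)] adj_parity[of j' j] by auto
qed

lemma share_high_rt:
  assumes "(j, p, q) \<in> codes" "(j', p', q') \<in> codes"
  shows "share_high (j, p, q) (rt (j', p', q')) \<longleftrightarrow> j = j' \<and> q = q' \<or> lowE j' p' = highE j q"
proof -
  have P: "high_pos j q" "high_pos j' q'" "low_pos j' p'" using codesD assms by blast+
  have "share_high (j, p, q) (rt (j', p', q')) \<longleftrightarrow> highE j q = (if odd j \<longleftrightarrow> odd j' then highE j' q' else lowE j' p')"
    using code_route[OF assms(2)] by (auto simp: share_high_def hd_last_rt)
  then show ?thesis
    using highE_eq[OF P(1,2)] lowE_highE[OF P(3,1)] adj_parity[of j j'] by (auto simp: eq_commute)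
qed

text \<open>When \<open>p = lo j - 1\<close>, the low edge may be a turn for a neighbouring leg
  whose boxes also come earlier in the line; \<open>A.narrow_high\<close> omits them, hence the
  condition \<open>lo j \<le> p\<close>. Likewise for \<open>q\<close>.\<close>

lemma diagram_arcs:
  assumes c: "c \<in> A.arcs" "c = (j, p, q)" and d: "d \<in> A.arcs"
  shows "share_low c (rt d) \<and> high_coord j (rt c) < high_coord j (rt d) \<longleftrightarrow> d \<in> A.widen_high c"
    "lo j \<le> p \<Longrightarrow> share_low c (rt d) \<and> high_coord j (rt d) < high_coord j (rt c) \<longleftrightarrow> d \<in> A.narrow_high c"
    "share_high c (rt d) \<and> low_coord j (rt d) < low_coord j (rt c) \<longleftrightarrow> d \<in> A.widen_low c"
    "q \<le> hi j \<Longrightarrow> share_high c (rt d) \<and> low_coord j (rt c) < low_coord j (rt d) \<longleftrightarrow> d \<in> A.narrow_low c"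
proof -
  obtain j' p' q' where dj: "d = (j', p', q')" by (cases d)
  have cm: "(j, p, q) \<in> codes" "(j, p, q) \<in> A.arcs" using c arcs_codes by auto
  have dm: "(j', p', q') \<in> codes" "(j', p', q') \<in> A.arcs" using d dj arcs_codes by auto
  note C = codesD[OF cm(1)] and D = codesD[OF dm(1)]
  note low = share_low_rt[OF cm(1) dm(1)] and high = share_high_rt[OF cm(1) dm(1)]
  have across_low: "high_coord j (rt d) < high_coord j (rt c)" "A.adj j' j"
      "p = lo j \<and> q' = hi j' + 1 \<or> p = lo j - 1 \<and> q' = hi j'" if "lowE j p = highE j' q'"
    using coord_across[OF cm(1) dm(1) that] lowE_highE[OF C(1) D(2)] that c dj by auto
  have across_high: "low_coord j (rt c) < low_coord j (rt d)" "A.adj j j'"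
      "p' = lo j' \<and> q = hi j + 1 \<or> p' = lo j' - 1 \<and> q = hi j" if "lowE j' p' = highE j q"
  proof -
    show a: "A.adj j j'" and "p' = lo j' \<and> q = hi j + 1 \<or> p' = lo j' - 1 \<and> q = hi j"
      using lowE_highE[OF D(1) C(2)] that by auto
    have "high_coord j' R = low_coord j R" for R using coord_parity[of j' j] adj_parity[OF a] by auto
    then show "low_coord j (rt c) < low_coord j (rt d)" using coord_across[OF dm(1) cm(1) that] c dj by simp
  qed
  have loop: "\<not> A.adj j j" by (simp add: A.adj_def)
  show "share_low c (rt d) \<and> high_coord j (rt c) < high_coord j (rt d) \<longleftrightarrow> d \<in> A.widen_high c"
  proof
    assume a: "share_low c (rt d) \<and> high_coord j (rt c) < high_coord j (rt d)"
    then have "j = j' \<and> p = p'" using low across_low(1) c dj by auto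
    then show "d \<in> A.widen_high c" using a high_coord_less[of j p q q'] cm dm c dj by auto
  next
    assume "d \<in> A.widen_high c"
    then show "share_low c (rt d) \<and> high_coord j (rt c) < high_coord j (rt d)"
      using low high_coord_less[of j p q q'] cm dm c dj by auto
  qed
  show "share_high c (rt d) \<and> low_coord j (rt d) < low_coord j (rt c) \<longleftrightarrow> d \<in> A.widen_low c"
  proof
    assume a: "share_high c (rt d) \<and> low_coord j (rt d) < low_coord j (rt c)"
    then have "j = j' \<and> q = q'" using high across_high(1) c dj by auto
    then show "d \<in> A.widen_low c" using a low_coord_less[of j p' q p] cm dm c dj by auto
  next
    assume "d \<in> A.widen_low c"
    then show "share_high c (rt d) \<and> low_coord j (rt d) < low_coord j (rt c)"
      using high low_coord_less[of j p' q p] cm dm c dj by auto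
  qed
  show "share_low c (rt d) \<and> high_coord j (rt d) < high_coord j (rt c) \<longleftrightarrow> d \<in> A.narrow_high c" if "lo j \<le> p"
  proof
    assume a: "share_low c (rt d) \<and> high_coord j (rt d) < high_coord j (rt c)"
    then consider "j = j'" "p = p'" | "lowE j p = highE j' q'" using low c dj by auto
    then show "d \<in> A.narrow_high c"
    proof cases
      case 1
      then show ?thesis using a high_coord_less[of j p q' q] cm dm c dj by auto
    next
      case 2
      then have "p = lo j" "q' = hi j' + 1" "A.adj j' j" using across_low that lo_ge_1[of j] by auto
      then show ?thesis using dm c dj by auto
    qed
  next
    assume "d \<in> A.narrow_high c"
    then consider "j' = j" "p' = p" "q' < q" | "p = lo j" "A.adj j' j" "q' = hi j' + 1" using c dj by auto
    then show "share_low c (rt d) \<and> high_coord j (rt d) < high_coord j (rt c)"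
    proof cases
      case 1
      then show ?thesis using low high_coord_less[of j p q' q] cm dm c dj by auto
    next
      case 2
      then have "lowE j p = highE j' q'" using lowE_highE[OF C(1) D(2)] by simp
      then show ?thesis using low across_low c dj by auto
    qed
  qed
  show "share_high c (rt d) \<and> low_coord j (rt c) < low_coord j (rt d) \<longleftrightarrow> d \<in> A.narrow_low c" if "q \<le> hi j"
  proof
    assume a: "share_high c (rt d) \<and> low_coord j (rt c) < low_coord j (rt d)"
    then consider "j = j'" "q = q'" | "lowE j' p' = highE j q" using high c dj by auto
    then show "d \<in> A.narrow_low c"
    proof cases
      case 1
      then show ?thesis using a low_coord_less[of j p q p'] cm dm c dj by auto
    next
      case 2
      then have "q = hi j" "p' = lo j' - 1" "A.adj j j'" using across_high that by auto
      then show ?thesis using dm c dj by auto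
    qed
  next
    assume "d \<in> A.narrow_low c"
    then consider "j' = j" "q' = q" "p < p'" | "q = hi j" "A.adj j j'" "p' = lo j' - 1" using c dj by auto
    then show "share_high c (rt d) \<and> low_coord j (rt c) < low_coord j (rt d)"
    proof cases
      case 1
      then show ?thesis using high low_coord_less[of j p q p'] cm dm c dj by auto
    next
      case 2
      then have "lowE j' p' = highE j q" using lowE_highE[OF D(1) C(2)] by simp
      then show ?thesis using high across_high c dj by auto
    qed
  qed
qed

section \<open>Pull steps compared\<close>

lemma visited_iff:
  assumes "\<And>R. R \<in> X \<Longrightarrow> route (dag s) R" "set V \<subseteq> A.arcs"
  shows "X \<subseteq> visited_routes (dag s) (map rt V) \<longleftrightarrow> (\<forall>d\<in>A.arcs. rt d \<in> X \<longrightarrow> d \<in> set V)"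
proof
  assume sub: "X \<subseteq> visited_routes (dag s) (map rt V)"
  show "\<forall>d\<in>A.arcs. rt d \<in> X \<longrightarrow> d \<in> set V"
  proof (intro ballI impI)
    fix d assume d: "d \<in> A.arcs" "rt d \<in> X"
    then have "rt d \<in> rt ` set V" using sub arcs_not_exceptional[OF d(1)] by (auto simp: visited_routes_def)
    then show "d \<in> set V" using rt_inj d(1) assms(2) by blast
  qed
next
  assume all: "\<forall>d\<in>A.arcs. rt d \<in> X \<longrightarrow> d \<in> set V"
  show "X \<subseteq> visited_routes (dag s) (map rt V)"
  proof
    fix R assume R: "R \<in> X"
    show "R \<in> visited_routes (dag s) (map rt V)"
    proof (cases "exceptional (dag s) R")
      case True
      then show ?thesis by (simp add: visited_routes_def)
    next
      case False
      then obtain d where "d \<in> A.arcs" "R = rt d" using nonexceptional_route[of R] assms(1)[OF R] by blast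
      then show ?thesis using all R by (auto simp: visited_routes_def)
    qed
  qed
qed

theorem step_ok_iff:
  assumes V: "set V \<subseteq> A.arcs" and c: "c \<in> A.arcs"
  shows "(west s (rt c) \<subseteq> visited_routes (dag s) (map rt V) \<or> north s (rt c) \<subseteq> visited_routes (dag s) (map rt V)) \<and>
     (east s (rt c) \<subseteq> visited_routes (dag s) (map rt V) \<or> south s (rt c) \<subseteq> visited_routes (dag s) (map rt V)) \<longleftrightarrow>
     A.step_ok (set V) c"
proof -
  obtain j p q where cj: "c = (j, p, q)" by (cases c)
  note C = A.arcsE[OF c[unfolded cj]]
  let ?Vis = "visited_routes (dag s) (map rt V)"
  let ?lm = "{R. share_low c R \<and> high_coord j R < high_coord j (rt c)}"
  let ?lp = "{R. share_low c R \<and> high_coord j (rt c) < high_coord j R}"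
  let ?hm = "{R. share_high c R \<and> low_coord j R < low_coord j (rt c)}"
  let ?hp = "{R. share_high c R \<and> low_coord j (rt c) < low_coord j R}"
  have dirs: "(west s (rt c) \<subseteq> ?Vis \<or> north s (rt c) \<subseteq> ?Vis) \<longleftrightarrow> (?lm \<subseteq> ?Vis \<or> ?hm \<subseteq> ?Vis)"
    "(east s (rt c) \<subseteq> ?Vis \<or> south s (rt c) \<subseteq> ?Vis) \<longleftrightarrow> (?lp \<subseteq> ?Vis \<or> ?hp \<subseteq> ?Vis)"
  proof -
    have "west s (rt c) = (if odd j then ?lm else ?hm)" "north s (rt c) = (if odd j then ?hm else ?lm)"
      "east s (rt c) = (if odd j then ?lp else ?hp)" "south s (rt c) = (if odd j then ?hp else ?lp)"
      by (auto simp: west_def north_def east_def south_def share_low_def share_high_def high_coord_def low_coord_def cj)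
    then show "(west s (rt c) \<subseteq> ?Vis \<or> north s (rt c) \<subseteq> ?Vis) \<longleftrightarrow> (?lm \<subseteq> ?Vis \<or> ?hm \<subseteq> ?Vis)"
      "(east s (rt c) \<subseteq> ?Vis \<or> south s (rt c) \<subseteq> ?Vis) \<longleftrightarrow> (?lp \<subseteq> ?Vis \<or> ?hp \<subseteq> ?Vis)"
      by (cases "odd j"; simp; blast)+
  qed
  note D = diagram_arcs[OF c cj]
  have vis: "X \<subseteq> ?Vis \<longleftrightarrow> (\<forall>d\<in>A.arcs. rt d \<in> X \<longrightarrow> d \<in> set V)" if "X \<in> {?lm, ?lp, ?hm, ?hp}" for X
    by (rule visited_iff[OF _ V]) (use that in \<open>auto simp: share_low_def share_high_def\<close>)
  have sub: "A.widen_high c \<subseteq> A.arcs" "A.narrow_high c \<subseteq> A.arcs" "A.widen_low c \<subseteq> A.arcs" "A.narrow_low c \<subseteq> A.arcs"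
    by (auto simp: cj)
  have lp: "?lp \<subseteq> ?Vis \<longleftrightarrow> A.widen_high c \<subseteq> set V" using vis[of ?lp] D(1) sub(1) by auto
  have hm: "?hm \<subseteq> ?Vis \<longleftrightarrow> A.widen_low c \<subseteq> set V" using vis[of ?hm] D(3) sub(3) by auto
  have "?lm \<subseteq> ?Vis \<or> ?hm \<subseteq> ?Vis \<longleftrightarrow> A.narrow_high c \<subseteq> set V \<or> A.widen_low c \<subseteq> set V"
  proof (cases "lo j \<le> p")
    case True
    have "?lm \<subseteq> ?Vis \<longleftrightarrow> A.narrow_high c \<subseteq> set V" using vis[of ?lm] D(2)[OF _ True] sub(2) by auto
    then show ?thesis using hm by blast
  next
    case False
    \<comment> \<open>The line may now hold more boxes than \<open>A.narrow_high c\<close>, but the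
      other alternative holds trivially on both sides.\<close>
    have "A.widen_low c = {}"
    proof -
      have "\<not> p' < p" if "(j, p', q) \<in> A.arcs" for p'
        using A.arcsE(8)[OF that] C(5) False by auto
      then show ?thesis by (auto simp: cj)
    qed
    then show ?thesis using hm by simp
  qed
  moreover have "?lp \<subseteq> ?Vis \<or> ?hp \<subseteq> ?Vis \<longleftrightarrow> A.widen_high c \<subseteq> set V \<or> A.narrow_low c \<subseteq> set V"
  proof (cases "q \<le> hi j")
    case True
    have "?hp \<subseteq> ?Vis \<longleftrightarrow> A.narrow_low c \<subseteq> set V" using vis[of ?hp] D(4)[OF _ True] sub(4) by auto
    then show ?thesis using lp by blast
  next
    case False
    have "A.widen_high c = {}"
    proof -
      have "\<not> q < q'" if "(j, p, q') \<in> A.arcs" for q'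
        using A.arcsE(9)[OF that] C(6) False by auto
      then show ?thesis by (auto simp: cj)
    qed
    then show ?thesis using lp by simp
  qed
  ultimately show ?thesis unfolding dirs A.step_ok_def by blast
qed

text \<open>Mutually adjacent legs occur only in a cycle with exactly two legs. A leg of length at
  least 2 has an inner position, and otherwise both lengths are 1.\<close>

lemma inside_exists:
  assumes "s \<noteq> Cycle [1, 1]" "A.adj j j'" "A.adj j' j"
  shows "\<exists>i. A.inside j i \<or> A.inside j' i"
proof -
  have J: "j \<in> L" "j' \<in> L" using adj_L assms by auto
  have a: "j' = Suc j \<or> cyc \<and> j = r \<and> j' = 1" "j = Suc j' \<or> cyc \<and> j' = r \<and> j = 1"
    using adj_iff[OF J] adj_iff[OF J(2,1)] assms(2,3) by blast+
  have ne: "j \<noteq> j'" using assms(2) by (simp add: A.adj_def)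
  have e: "cyc \<and> r = 2 \<and> (j = 1 \<and> j' = 2 \<or> j = 2 \<and> j' = 1)"
    using a(1)
  proof
    assume "j' = Suc j"
    then have "cyc \<and> j' = r \<and> j = 1" using a(2) by linarith
    then show ?thesis using \<open>j' = Suc j\<close> by simp
  next
    assume "cyc \<and> j = r \<and> j' = 1"
    moreover from this have "j = Suc j'" using a(2) ne by auto
    ultimately show ?thesis by simp
  qed
  have ins: "\<exists>i. A.inside k i" if "k \<in> L" "lens s ! (k - 1) \<noteq> 1" for k
  proof -
    have "0 < lens s ! (k - 1)" using that lens_pos[of "k - 1"] by (auto simp: L_def)
    then have "lo k + 1 < hi k" using hi_diff[OF that(1)] that(2) by simp
    then have "A.inside k (lo k + 1)" using that(1) by (simp add: A.inside_def okt_def okh_def)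
    then show ?thesis by blast
  qed
  have "lens s ! 0 \<noteq> 1 \<or> lens s ! 1 \<noteq> 1"
  proof (rule ccontr)
    assume no: "\<not> ?thesis"
    have "length (lens s) = 2" using e by (simp add: r_def)
    then have "lens s = [lens s ! 0, lens s ! 1]" by (auto simp: numeral_2_eq_2 length_Suc_conv)
    then have "lens s = [1, 1]" using no by simp
    moreover have "s = Cycle (lens s)" using e unfolding cyc_def by (cases s) auto
    ultimately show False using assms(1) by simp
  qed
  then have "\<exists>i. A.inside 1 i \<or> A.inside 2 i" using ins[of 1] ins[of 2] e by (auto simp: L_def)
  then show ?thesis using e by blast
qed

text \<open>Legality of \<open>V\<close> is the common link. Equality with the fan is a refinement
  and so gives legality, which passes to all prefixes and yields the steps; conversely the steps
  give legality, and completeness of the sequence turns it into equality.\<close>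

theorem yields_dkk_iff:
  assumes ne: "s \<noteq> Cycle [1, 1]" and seq: "pulling_sequence (dag s) w Rs"
  shows "yields_dkk (dag s) w Rs \<longleftrightarrow> consists_of_dkk_pull_steps s w Rs"
proof -
  have sub: "set Rs \<subseteq> rt ` A.arcs" using seq nonexceptional_route unfolding pulling_sequence_def by blast
  define V where "V = map (inv_into A.arcs rt) Rs"
  have V: "set V \<subseteq> A.arcs" using sub by (auto simp: V_def intro!: inv_into_into)
  have Rs: "Rs = map rt V" unfolding V_def map_map
    by (rule map_idI[symmetric]) (use sub in \<open>auto simp: f_inv_into_f\<close>)
  have dist: "distinct V" using seq Rs by (auto simp: pulling_sequence_def distinct_map)
  have takeV: "set (take i V) \<subseteq> A.arcs" for i using V set_take_subset by fast
  have Vi: "V ! i \<in> A.arcs" if "i < length V" for i using V that by auto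
  have yields: "yields_dkk (dag s) w Rs \<longleftrightarrow> A.fan.cells V = A.fan.fan_cells"
    by (simp add: yields_dkk_def Rs pull_routes_cells[OF V] dkk_fan_cells)
  have coh: "pull_coherent (dag s) w (map rt (take i V)) \<longleftrightarrow> refined_by (A.fan.cells (take i V)) A.fan.fan_cells" for i
    by (simp add: pull_coherent_def pull_routes_cells[OF takeV] dkk_fan_cells)
  have new: "rt (V ! i) \<notin> visited_routes (dag s) (map rt (take i V))" if i: "i < length V" for i
  proof
    assume "rt (V ! i) \<in> visited_routes (dag s) (map rt (take i V))"
    then have "rt (V ! i) \<in> rt ` set (take i V)"
      using arcs_not_exceptional[OF Vi[OF i]] by (auto simp: visited_routes_def)
    then have "V ! i \<in> set (take i V)" using rt_inj Vi[OF i] takeV by blast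
    then show False using dist i by (auto simp: in_set_conv_nth nth_eq_iff_index_eq)
  qed
  have steps: "consists_of_dkk_pull_steps s w Rs \<longleftrightarrow>
    (\<forall>i<length V. refined_by (A.fan.cells (take i V)) A.fan.fan_cells \<and> A.step_ok (set (take i V)) (V ! i))"
  proof -
    have "dkk_pull_step s w (take i Rs) (Rs ! i) \<longleftrightarrow>
      refined_by (A.fan.cells (take i V)) A.fan.fan_cells \<and> A.step_ok (set (take i V)) (V ! i)" if i: "i < length V" for i
      using step_ok_iff[OF takeV Vi[OF i], of i] coh[of i] new[OF i] code_route[OF arcs_codes[OF Vi[OF i]]] i
      unfolding dkk_pull_step_def Rs by (simp add: take_map)
    then show ?thesis unfolding consists_of_dkk_pull_steps_def Rs by simp
  qed
  have complete: "A.arcs \<subseteq> set V \<or> triangulation (A.fan.cells V)"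
  proof -
    have "A.arcs \<subseteq> set V" if "{R. route (dag s) R} \<subseteq> visited_routes (dag s) (map rt V)"
      using visited_iff[of "{R. route (dag s) R}" V] V that code_route arcs_codes by auto
    then show ?thesis using seq unfolding pulling_sequence_def Rs pull_routes_cells[OF V] by blast
  qed
  show ?thesis unfolding yields steps
  proof
    assume eq: "A.fan.cells V = A.fan.fan_cells"
    then have "refined_by (A.fan.cells V) A.fan.fan_cells" by (auto simp: refined_by_def)
    then have leg: "A.fan.legal_seq V" by (rule A.fan.refined_imp_legal[OF V])
    show "\<forall>i<length V. refined_by (A.fan.cells (take i V)) A.fan.fan_cells \<and> A.step_ok (set (take i V)) (V ! i)"
    proof (intro allI impI)
      fix i assume i: "i < length V"
      have pre: "A.fan.legal_seq (take i V)" using leg A.fan.legal_seq_prefix[of "take i V" "drop i V"] by simp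
      have "A.fan.legal (set (take i V)) (V ! i)" using leg i unfolding A.fan.legal_seq_def by blast
      then have "A.step_ok (set (take i V)) (V ! i)"
        using A.legal_imp_step_ok[OF pre takeV _ Vi[OF i]] inside_exists[OF ne] by blast
      then show "refined_by (A.fan.cells (take i V)) A.fan.fan_cells \<and> A.step_ok (set (take i V)) (V ! i)"
        using A.fan.legal_imp_refined[OF takeV pre] by blast
    qed
  next
    assume all: "\<forall>i<length V. refined_by (A.fan.cells (take i V)) A.fan.fan_cells \<and> A.step_ok (set (take i V)) (V ! i)"
    have "A.fan.legal_seq V" unfolding A.fan.legal_seq_def
      using all A.step_ok_imp_legal[OF Vi] by blast
    then show "A.fan.cells V = A.fan.fan_cells" using A.fan.legal_complete_imp_fan_cells[OF V] complete by blast
  qed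
qed

end

theorem corollary4p33:
  fixes s :: shape
    and w :: "'n::finite \<Rightarrow> vertex"
    and Rs :: "edge list list"
  assumes "valid_shape s" and "s \<noteq> Cycle [1, 1]"
    and "bij_betw w UNIV (inner_vertices (dag s))"
    and "pulling_sequence (dag s) w Rs"
  shows "yields_dkk (dag s) w Rs \<longleftrightarrow> consists_of_dkk_pull_steps s w Rs"
proof -
  interpret framed_shape s w by unfold_locales (use assms in auto)
  show ?thesis by (rule yields_dkk_iff[OF assms(2,4)])
qed

end
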